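(* 1. All coherent configurations with $15$ or fewer points and maximum fiber size $4$ are separable. 2. There is a unique, up to combinatorial isomorphism, non-separable coherent configuration on $16$ points with maximum fiber size $4$.
   Context: A coherent configuration on a finite set $V$ is a partition $\mathcal C$ of $V\times V$ into basis relations such that: (A) a basis relation containing a loop consists of loops; (B) the transpose $R^*=\{uv:vu\in R\}$ of a basis relation is a basis relation; (C) for all $R,S,T\in\mathcal C$ the number $|\{w:uw\in R,wv\in S\}|$ is the same for all $uv\in T$, denoted $p^T_{RS}$. A fiber is a set $X$ with $\{xx:x\in X\}\in\mathcal C$; the maximum fiber size is the largest number of points in a fiber. A combinatorial isomorphism between coherent configurations $\mathcal C$ on $V$ and $\mathcal C'$ on $V'$ is a bijection $\phi:V\to V'$ with $\phi(R)\in\mathcal C'$ for all $R\in\mathcal C$; an algebraic isomorphism is a bijection $f:\mathcal C\to\mathcal C'$ with $p^T_{RS}=p^{f(T)}_{f(R)f(S)}$ for all $R,S,T$. $\mathcal C$ is separable if every algebraic isomorphism from $\mathcal C$ to any coherent configuration $\mathcal C'$ is induced by a combinatorial isomorphism $\phi$, i.e. $f(R)=\phi(R)$ for all $R\in\mathcal C$. *)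

theory Defs
  imports Main "HOL-Library.Disjoint_Sets"
begin

definition coherent_configuration :: "'a set \<Rightarrow> ('a \<times> 'a) set set \<Rightarrow> bool" where
  "coherent_configuration V C \<longleftrightarrow>
     finite V \<and> partition_on (V \<times> V) C \<and>
     (\<forall>R\<in>C. (\<exists>x. (x, x) \<in> R) \<longrightarrow> R \<subseteq> Id) \<and>
     (\<forall>R\<in>C. R\<inverse> \<in> C) \<and>
     (\<forall>R\<in>C. \<forall>S\<in>C. \<forall>T\<in>C. \<exists>n. \<forall>(u, v)\<in>T. card {w. (u, w) \<in> R \<and> (w, v) \<in> S} = n)"

text \<open>The number \<open>p\<^sup>T\<^bsub>RS\<^esub>\<close>; it is well defined when \<open>R\<close>, \<open>S\<close>, \<open>T\<close> are basis relations
  of a coherent configuration (note that \<open>T\<close> is then nonempty).\<close>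

definition intersection_number :: "('a \<times> 'a) set \<Rightarrow> ('a \<times> 'a) set \<Rightarrow> ('a \<times> 'a) set \<Rightarrow> nat" where
  "intersection_number R S T =
     (THE n. \<forall>(u, v)\<in>T. card {w. (u, w) \<in> R \<and> (w, v) \<in> S} = n)"

definition fibers :: "('a \<times> 'a) set set \<Rightarrow> 'a set set" where
  "fibers C = {X. Id_on X \<in> C}"

text \<open>On \<open>nat\<close>, \<open>Sup\<close> is \<open>Max\<close> for finite nonempty sets and gives \<open>0\<close> for the empty set, so the
  empty configuration has maximum fiber size \<open>0\<close>.\<close>

definition max_fiber_size :: "('a \<times> 'a) set set \<Rightarrow> nat" where
  "max_fiber_size C = (SUP X\<in>fibers C. card X)"

definition combinatorial_isomorphism ::
  "'a set \<Rightarrow> ('a \<times> 'a) set set \<Rightarrow> 'b set \<Rightarrow> ('b \<times> 'b) set set \<Rightarrow> ('a \<Rightarrow> 'b) \<Rightarrow> bool" where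
  "combinatorial_isomorphism V C V' C' \<phi> \<longleftrightarrow>
     bij_betw \<phi> V V' \<and> (\<forall>R\<in>C. map_prod \<phi> \<phi> ` R \<in> C')"

definition algebraic_isomorphism ::
  "('a \<times> 'a) set set \<Rightarrow> ('b \<times> 'b) set set \<Rightarrow> (('a \<times> 'a) set \<Rightarrow> ('b \<times> 'b) set) \<Rightarrow> bool" where
  "algebraic_isomorphism C C' f \<longleftrightarrow>
     bij_betw f C C' \<and>
     (\<forall>R\<in>C. \<forall>S\<in>C. \<forall>T\<in>C.
        intersection_number R S T = intersection_number (f R) (f S) (f T))"

text \<open>Quantification over all finite point sets \<open>V'\<close> is rendered by finite sets of natural numbers,
  since a definition cannot quantify over types.  Lemma \<open>separableD\<close> below shows that the
  property then holds for target configurations over an arbitrary type.\<close>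

definition separable :: "'a set \<Rightarrow> ('a \<times> 'a) set set \<Rightarrow> bool" where
  "separable V C \<longleftrightarrow>
     (\<forall>(V' :: nat set) C' f.
        coherent_configuration V' C' \<longrightarrow> algebraic_isomorphism C C' f \<longrightarrow>
        (\<exists>\<phi>. combinatorial_isomorphism V C V' C' \<phi> \<and> (\<forall>R\<in>C. f R = map_prod \<phi> \<phi> ` R)))"

lemma coherent_configuration_subset:
  "coherent_configuration V C \<Longrightarrow> R \<in> C \<Longrightarrow> R \<subseteq> V \<times> V"
  by (auto simp: coherent_configuration_def partition_on_def)

lemma card_transport:
  assumes g: "inj_on g V" and R: "R \<subseteq> V \<times> V" and S: "S \<subseteq> V \<times> V" and u: "u \<in> V" and v: "v \<in> V"
  shows "card {w. (g u, w) \<in> map_prod g g ` R \<and> (w, g v) \<in> map_prod g g ` S}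
       = card {w. (u, w) \<in> R \<and> (w, v) \<in> S}"
proof -
  have "{w. (g u, w) \<in> map_prod g g ` R \<and> (w, g v) \<in> map_prod g g ` S}
      = g ` {w. (u, w) \<in> R \<and> (w, v) \<in> S}" (is "?L = ?R")
  proof
    show "?R \<subseteq> ?L" by force
    show "?L \<subseteq> ?R"
    proof
      fix w assume "w \<in> ?L"
      then obtain a b c d where "(a, b) \<in> R" "g a = g u" "g b = w" "(c, d) \<in> S" "g c = w" "g d = g v"
        unfolding mem_Collect_eq by (elim conjE imageE) (metis map_prod_simp prod.inject prod.collapse)
      note x = this
      have "a \<in> V" "b \<in> V" "c \<in> V" "d \<in> V" using x(1,4) R S by blast+
      then have "a = u" "d = v" "b = c"
        using inj_onD[OF g x(2)] inj_onD[OF g x(6)] inj_onD[OF g, of b c] x(3,5) u v by simp_all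
      then show "w \<in> ?R" using x(1,3,4) by blast
    qed
  qed
  moreover have "inj_on g {w. (u, w) \<in> R \<and> (w, v) \<in> S}"
    by (rule inj_on_subset[OF g]) (use R in auto)
  ultimately show ?thesis by (simp add: card_image)
qed

lemma transport:
  assumes C: "coherent_configuration V C" and g: "inj_on g V"
  shows "coherent_configuration (g ` V) ((`) (map_prod g g) ` C)"
    and "algebraic_isomorphism C ((`) (map_prod g g) ` C) ((`) (map_prod g g))"
proof -
  let ?G = "\<lambda>R. map_prod g g ` R"
  have sub: "R \<subseteq> V \<times> V" if "R \<in> C" for R
    using coherent_configuration_subset[OF C that] .
  have ne: "R \<noteq> {}" if "R \<in> C" for R
    using C that by (auto simp: coherent_configuration_def partition_on_def)
  have inj2: "inj_on (map_prod g g) (V \<times> V)"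
    by (rule map_prod_inj_on[OF g g])
  have dj: "R \<inter> S = {}" if "R \<in> C" "S \<in> C" "R \<noteq> S" for R S
    using C that by (auto simp: coherent_configuration_def partition_on_def disjoint_def)
  have card_eq: "card {w. (g u, w) \<in> ?G R \<and> (w, g v) \<in> ?G S} = card {w. (u, w) \<in> R \<and> (w, v) \<in> S}"
    if "R \<in> C" "S \<in> C" "T \<in> C" "(u, v) \<in> T" for R S T u v
    using card_transport[OF g sub[OF that(1)] sub[OF that(2)], of u v] sub[OF that(3)] that(4) by auto
  have pred_eq: "(\<forall>(u, v)\<in>?G T. card {w. (u, w) \<in> ?G R \<and> (w, v) \<in> ?G S} = n)
      \<longleftrightarrow> (\<forall>(u, v)\<in>T. card {w. (u, w) \<in> R \<and> (w, v) \<in> S} = n)"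
    if "R \<in> C" "S \<in> C" "T \<in> C" for R S T n
  proof -
    have "(\<forall>(u, v)\<in>?G T. card {w. (u, w) \<in> ?G R \<and> (w, v) \<in> ?G S} = n)
      \<longleftrightarrow> (\<forall>(u, v)\<in>T. card {w. (g u, w) \<in> ?G R \<and> (w, g v) \<in> ?G S} = n)"
      by (simp add: split_beta)
    also have "\<dots> \<longleftrightarrow> (\<forall>(u, v)\<in>T. card {w. (u, w) \<in> R \<and> (w, v) \<in> S} = n)"
      using card_eq[OF that] by (intro ball_cong) auto
    finally show ?thesis .
  qed
  have c1: "finite (g ` V)" using C by (simp add: coherent_configuration_def)
  have c2: "partition_on (g ` V \<times> g ` V) (?G ` C)"
  proof (rule partition_onI)
    have "\<Union>(?G ` C) = map_prod g g ` (\<Union>C)" by blast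
    also have "\<Union>C = V \<times> V" using C by (simp add: coherent_configuration_def partition_on_def)
    also have "map_prod g g ` (V \<times> V) = g ` V \<times> g ` V" by force
    finally show "\<Union>(?G ` C) = g ` V \<times> g ` V" .
    show "{} \<notin> ?G ` C" using ne by auto
    show "disjnt p q" if pq: "p \<in> ?G ` C" "q \<in> ?G ` C" "p \<noteq> q" for p q
    proof -
      obtain R S where RS: "R \<in> C" "S \<in> C" "p = ?G R" "q = ?G S" using pq by blast
      have "R \<noteq> S" using pq(3) unfolding RS(3,4) by (rule contrapos_nn) simp
      then have "R \<inter> S = {}" by (rule dj[OF RS(1,2)])
      then have "?G R \<inter> ?G S = {}"
        using inj_on_image_Int[OF inj2 sub[OF RS(1)] sub[OF RS(2)]] by simp
      then show ?thesis using RS by (simp add: disjnt_def)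
    qed
  qed
  have c3: "R' \<subseteq> Id" if R': "R' \<in> ?G ` C" "(x, x) \<in> R'" for R' x
  proof -
    obtain R a b where R: "R \<in> C" "R' = ?G R" "(a, b) \<in> R" "g a = x" "g b = x" using R' by auto
    have "a \<in> V" "b \<in> V" using sub[OF R(1)] R(3) by auto
    then have "a = b" using inj_onD[OF g, of a b] R(4,5) by simp
    then have "R \<subseteq> Id" using C R(1,3) unfolding coherent_configuration_def by blast
    then show ?thesis using R by auto
  qed
  have c4: "R'\<inverse> \<in> ?G ` C" if R': "R' \<in> ?G ` C" for R'
  proof -
    obtain R where R: "R \<in> C" "R' = ?G R" using R' by blast
    then have "R'\<inverse> = ?G (R\<inverse>)" by force
    moreover have "R\<inverse> \<in> C" using C R by (simp add: coherent_configuration_def)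
    ultimately show ?thesis by blast
  qed
  have c5: "\<exists>n. \<forall>(u, v)\<in>T'. card {w. (u, w) \<in> R' \<and> (w, v) \<in> S'} = n"
    if RST': "R' \<in> ?G ` C" "S' \<in> ?G ` C" "T' \<in> ?G ` C" for R' S' T'
  proof -
    obtain R S T where RST: "R \<in> C" "S \<in> C" "T \<in> C" "R' = ?G R" "S' = ?G S" "T' = ?G T"
      using RST' by blast
    have "\<exists>n. \<forall>(u, v)\<in>T. card {w. (u, w) \<in> R \<and> (w, v) \<in> S} = n"
      using C RST(1-3) unfolding coherent_configuration_def by blast
    then show ?thesis unfolding RST(4-6) pred_eq[OF RST(1-3)] .
  qed
  show "coherent_configuration (g ` V) (?G ` C)"
    unfolding coherent_configuration_def
  proof (intro conjI ballI impI c1 c2)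
    show "R' \<subseteq> Id" if "R' \<in> ?G ` C" "\<exists>x. (x, x) \<in> R'" for R'
      using that(2) by (rule exE) (rule c3[OF that(1)])
  qed (erule c4, erule (2) c5)
  have "inj_on ?G C"
  proof (rule inj_onI)
    show "R = S" if "R \<in> C" "S \<in> C" "?G R = ?G S" for R S
      using inj_on_image_eq_iff[OF inj2 sub[OF that(1)] sub[OF that(2)]] that(3) by simp
  qed
  moreover have "intersection_number R S T = intersection_number (?G R) (?G S) (?G T)"
    if "R \<in> C" "S \<in> C" "T \<in> C" for R S T
    unfolding intersection_number_def pred_eq[OF that] ..
  ultimately show "algebraic_isomorphism C (?G ` C) ?G"
    by (auto simp: algebraic_isomorphism_def bij_betw_def)
qed

lemma separableD:
  fixes V' :: "'b set"
  assumes sep: "separable V C" and C': "coherent_configuration V' C'"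
    and f: "algebraic_isomorphism C C' f"
  shows "\<exists>\<phi>. combinatorial_isomorphism V C V' C' \<phi> \<and> (\<forall>R\<in>C. f R = map_prod \<phi> \<phi> ` R)"
proof -
  have "finite V'" using C' by (simp add: coherent_configuration_def)
  then obtain g :: "'b \<Rightarrow> nat" where g: "inj_on g V'"
    using finite_imp_inj_to_nat_seg by blast
  let ?G = "\<lambda>R. map_prod g g ` R"
  note tr = transport[OF C' g]
  have fC: "f R \<in> C'" if "R \<in> C" for R
    using f that by (auto simp: algebraic_isomorphism_def bij_betw_def)
  have "algebraic_isomorphism C (?G ` C') (\<lambda>R. ?G (f R))"
    unfolding algebraic_isomorphism_def
  proof (intro conjI ballI)
    show "bij_betw (\<lambda>R. ?G (f R)) C (?G ` C')"
      using bij_betw_trans[of f C C' ?G "?G ` C'"] f tr(2)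
      by (simp add: algebraic_isomorphism_def comp_def)
    show "intersection_number R S T = intersection_number (?G (f R)) (?G (f S)) (?G (f T))"
      if "R \<in> C" "S \<in> C" "T \<in> C" for R S T
      using f tr(2) fC that by (simp add: algebraic_isomorphism_def)
  qed
  then have "\<exists>\<phi>. combinatorial_isomorphism V C (g ` V') (?G ` C') \<phi> \<and>
      (\<forall>R\<in>C. ?G (f R) = map_prod \<phi> \<phi> ` R)"
    by (rule sep[unfolded separable_def, rule_format, OF tr(1)])
  then obtain \<phi> where phi: "combinatorial_isomorphism V C (g ` V') (?G ` C') \<phi>"
    and "\<forall>R\<in>C. ?G (f R) = map_prod \<phi> \<phi> ` R"
    by (elim exE conjE)
  then have eq: "?G (f R) = map_prod \<phi> \<phi> ` R" if "R \<in> C" for R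
    using that by (rule_tac bspec)
  let ?h = "inv_into V' g"
  have h: "bij_betw ?h (g ` V') V'"
    by (rule bij_betw_inv_into[OF inj_on_imp_bij_betw[OF g]])
  have bij: "bij_betw (?h \<circ> \<phi>) V V'"
    using phi unfolding combinatorial_isomorphism_def by (auto intro: bij_betw_trans[OF _ h])
  have fR: "f R = map_prod (?h \<circ> \<phi>) (?h \<circ> \<phi>) ` R" if "R \<in> C" for R
  proof -
    have "map_prod (?h \<circ> \<phi>) (?h \<circ> \<phi>) ` R = map_prod ?h ?h ` ?G (f R)"
      unfolding eq[OF that] by (simp add: image_image map_prod_def split_beta)
    also have "\<dots> = (\<lambda>p. p) ` f R"
      unfolding image_image
      by (rule image_cong) (use coherent_configuration_subset[OF C' fC[OF that]] g in auto)
    finally show ?thesis by simp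
  qed
  show ?thesis
    unfolding combinatorial_isomorphism_def
  proof (intro exI[of _ "?h \<circ> \<phi>"] conjI ballI bij)
    show "map_prod (?h \<circ> \<phi>) (?h \<circ> \<phi>) ` R \<in> C'" if "R \<in> C" for R
      using fC[OF that] unfolding fR[OF that] .
  qed (rule fR)
qed

end

theory Submission
  imports Defs "HOL-Library.Multiset"
begin

text \<open>
  A fiber all of whose points are determined by points of another fiber can be discarded, because
  an isomorphism on the latter forces one on the former. Among the remaining fibers,
  only those of size 4 interact, and a non-uniform interspace is \<open>2K\<^sub>2\<^sub>,\<^sub>2\<close> or an 8-cycle.
  Isomorphisms are built up fiber by fiber: a new fiber can be added as soon as the previous ones
  split it along at most two matchings, and two fibers joined by an 8-cycle, which are split by all
  other fibers along one and the same matching, can be added together. The process therefore only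
  fails if there are four fibers of size 4 which split each other along three different
  matchings, as in the Cai-Fuerer-Immerman graph of \<open>K\<^sub>4\<close>. This determines the 16-point
  configuration, and exchanging the two relations between one pair of its fibers is an algebraic
  automorphism that is not induced, for parity reasons.
\<close>

section \<open>Two algebraically isomorphic configurations side by side\<close>

text \<open>Intersection numbers control triangles only: a third point can be copied over any pair
  of the same colour, on either side. The image of the first point of a new fiber can therefore be
  made to agree with two chosen points of earlier fibers, and everything else has to follow from
  these. If the fiber is split along at most two matchings, one reference point for each matching
  settles the colours towards all earlier fibers. With three matchings a pattern on four points
  would have to be copied, and this the intersection numbers do not guarantee. For an 8-cycle the
  obstacle is another one: a correct image of one point of a fiber leaves the colours of the other
  points towards the second fiber undecided, so both fibers have to be mapped at once. The bound 16
  comes from counting. Three different matchings on a fiber require three further fibers of size 4;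
  these four already have 16 points, which leaves no room for anything else.\<close>

text \<open>The two configurations live on the two sides of \<open>P\<close>, their basis relations being identified
  along the algebraic isomorphism; \<open>col\<close> is only meaningful for points on the same side. All
  lemmas that do not mention a side then hold within each configuration and also compare the two.\<close>

locale scheme_pair =
  fixes P :: "'p set" and sd :: "'p \<Rightarrow> bool" and col :: "'p \<Rightarrow> 'p \<Rightarrow> 'k"
    and nn :: "'k \<Rightarrow> 'k \<Rightarrow> 'k \<Rightarrow> nat"
  assumes fin: "finite P"
    and count: "\<lbrakk>p \<in> P; q \<in> P; sd p = sd q\<rbrakk> \<Longrightarrow>
      card {w \<in> P. sd w = sd p \<and> col p w = i \<and> col w q = j} = nn i j (col p q)"
    and diag: "\<lbrakk>p \<in> P; q \<in> P; w \<in> P; sd p = sd q; col p q = col w w\<rbrakk> \<Longrightarrow> p = q"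
    and conv: "\<lbrakk>p \<in> P; q \<in> P; p' \<in> P; q' \<in> P; sd p = sd q; sd p' = sd q'; col p q = col p' q'\<rbrakk>
      \<Longrightarrow> col q p = col q' p'"
    and types: "p \<in> P \<Longrightarrow> \<exists>p' \<in> P. sd p' = s \<and> col p' p' = col p p"
    and small: "p \<in> P \<Longrightarrow> \<not> sd p \<Longrightarrow> card {q \<in> P. \<not> sd q \<and> col q q = col p p} \<le> 4"
begin

section \<open>Fibers and the copying of triangles\<close>

definition X :: "bool \<Rightarrow> 'k \<Rightarrow> 'p set" where
  "X s k = {q \<in> P. sd q = s \<and> col q q = k}"

lemma X_iff: "p \<in> X s k \<longleftrightarrow> p \<in> P \<and> sd p = s \<and> col p p = k"
  by (auto simp: X_def)

lemma finite_X [simp]: "finite (X s k)"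
  using fin by (auto simp: X_def)

text \<open>A nonzero count on one side is nonzero on the other. Within this locale, this and the
  valencies of \<open>valency_eq\<close> are all that is extracted from the intersection
  numbers.\<close>

lemma third_point_raw:
  assumes "p \<in> P" "q \<in> P" "sd p = sd q" "p' \<in> P" "q' \<in> P" "sd p' = sd q'"
    "col p q = col p' q'" "w \<in> P" "sd w = sd p"
  shows "\<exists>w'\<in>P. sd w' = sd p' \<and> col p w = col p' w' \<and> col w q = col w' q'"
proof -
  let ?A = "{v \<in> P. sd v = sd p \<and> col p v = col p w \<and> col v q = col w q}"
  let ?B = "{v \<in> P. sd v = sd p' \<and> col p' v = col p w \<and> col v q' = col w q}"
  have "card ?A = card ?B" using count assms by simp
  moreover have "w \<in> ?A" using assms by simp
  moreover have "finite ?A" using fin by simp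
  ultimately have "card ?A \<noteq> 0" "card ?A = card ?B" using card_eq_0_iff[of ?A] by blast+
  then have "?B \<noteq> {}" by (metis card.empty)
  then obtain w' where "w' \<in> ?B" by blast
  then show ?thesis by (intro bexI[of _ w']) simp_all
qed

text \<open>The degenerate triangle \<open>p\<close>, \<open>q\<close>, \<open>p\<close> is copied.
  By \<open>diag\<close> the copy of its third point is \<open>p'\<close> itself, which therefore
  has the loop colour of \<open>p\<close>.\<close>

lemma type_eq:
  assumes "p \<in> X s k" "q \<in> X s l" "p' \<in> X s' k'" "q' \<in> X s' l'" "col p q = col p' q'"
  shows "k = k'" "l = l'"
proof -
  have *: "k = k'" if h: "p \<in> X s k" "q \<in> X s l" "p' \<in> X s' k'" "q' \<in> X s' l'" "col p q = col p' q'"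
    for p q p' q' k l k' l'
  proof -
    obtain w where w: "w \<in> P" "sd w = sd p'" "col p p = col p' w"
      using third_point_raw[of p q p' q' p] h by (auto simp: X_iff)
    then have "w = p'" using diag[of p' w p] h by (auto simp: X_iff)
    then show ?thesis using w h by (auto simp: X_iff)
  qed
  show "k = k'" using *[OF assms] .
  have "col q p = col q' p'" using conv[of p q p' q'] assms by (auto simp: X_iff)
  then show "l = l'" using *[of q l p k q' l' p' k'] assms by auto
qed

lemma conv_X:
  assumes "p \<in> X s k" "q \<in> X s l" "p' \<in> X s' k'" "q' \<in> X s' l'" "col p q = col p' q'"
  shows "col q p = col q' p'"
  using conv[of p q p' q'] assms by (auto simp: X_iff)

lemma diag_X:
  assumes "p \<in> X s k" "q \<in> X s l" "w \<in> X s' m" "col p q = col w w"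
  shows "p = q"
  using diag[of p q w] assms by (auto simp: X_iff)

lemma third_point:
  assumes "p \<in> X s k" "q \<in> X s l" "p' \<in> X s' k'" "q' \<in> X s' l'" "col p q = col p' q'" "w \<in> X s m"
  shows "\<exists>w'\<in>X s' m. col p w = col p' w' \<and> col w p = col w' p' \<and> col w q = col w' q' \<and> col q w = col q' w'"
proof -
  obtain w' where w': "w' \<in> P" "sd w' = sd p'" "col p w = col p' w'" "col w q = col w' q'"
    using third_point_raw[of p q p' q' w] assms by (auto simp: X_iff)
  then have "w' \<in> X s' (col w' w')" using assms by (auto simp: X_iff)
  moreover from this have "m = col w' w'"
    using type_eq(2)[OF assms(1,6,3)] w' by blast
  ultimately have "w' \<in> X s' m" by simp
  moreover from this have "col w p = col w' p'" "col q w = col q' w'"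
    using conv_X[OF assms(1,6,3) _ w'(3)] conv_X[OF assms(6,2) _ assms(4) w'(4)] by auto
  ultimately show ?thesis using w' by auto
qed

lemma second_point:
  assumes "p \<in> X s k" "p' \<in> X s' k" "w \<in> X s m"
  shows "\<exists>w'\<in>X s' m. col p w = col p' w' \<and> col w p = col w' p'"
  using third_point[OF assms(1,1,2,2) _ assms(3)] assms by (auto simp: X_iff)

text \<open>A valency is the intersection number of \<open>c\<close> and its converse over a loop
  colour; a colour that does not occur at \<open>p\<close> does not occur at \<open>p'\<close>
  either.\<close>

lemma valency_eq:
  assumes "p \<in> X s k" "p' \<in> X s' k"
  shows "card {w \<in> X s m. col p w = c} = card {w \<in> X s' m. col p' w = c}"
proof (cases "\<exists>w\<in>X s m. col p w = c")
  case True
  then obtain w where w: "w \<in> X s m" "col p w = c" by blast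
  have *: "{v \<in> X s'' m. col p'' v = c} = {v \<in> P. sd v = sd p'' \<and> col p'' v = c \<and> col v p'' = col w p}"
    if p'': "p'' \<in> X s'' k" for s'' p''
  proof (intro set_eqI iffI)
    fix v assume "v \<in> {v \<in> X s'' m. col p'' v = c}"
    then show "v \<in> {v \<in> P. sd v = sd p'' \<and> col p'' v = c \<and> col v p'' = col w p}"
      using conv_X[OF p'' _ assms(1) w(1)] w p'' by (auto simp: X_iff)
  next
    fix v assume v: "v \<in> {v \<in> P. sd v = sd p'' \<and> col p'' v = c \<and> col v p'' = col w p}"
    then have "v \<in> X s'' (col v v)" using p'' by (auto simp: X_iff)
    then show "v \<in> {v \<in> X s'' m. col p'' v = c}"
      using type_eq(2)[OF assms(1) w(1) p''] w v by auto
  qed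
  show ?thesis unfolding *[OF assms(1)] *[OF assms(2)]
    using count[of p p c "col w p"] count[of p' p' c "col w p"] assms by (simp add: X_iff)
next
  case False
  then have "\<not> (\<exists>w\<in>X s' m. col p' w = c)" using second_point[OF assms(2,1)] by metis
  with False have "{w \<in> X s m. col p w = c} = {}" "{w \<in> X s' m. col p' w = c} = {}" by auto
  then show ?thesis by (simp only:)
qed

lemma color_mset_eq:
  assumes "p \<in> X s k" "p' \<in> X s' k"
  shows "image_mset (col p) (mset_set (X s m)) = image_mset (col p') (mset_set (X s' m))"
proof (rule multiset_eqI)
  fix c
  show "count (image_mset (col p) (mset_set (X s m))) c = count (image_mset (col p') (mset_set (X s' m))) c"
    using valency_eq[OF assms, of m c] by (simp add: count_image_mset' Int_def vimage_def conj_commute eq_commute[of _ c])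
qed

lemma X_empty_iff: "X s k = {} \<longleftrightarrow> X s' k = {}"
proof -
  have "X s'' k \<noteq> {}" if "p \<in> X s k" for s s'' p
    using types[of p s''] that by (auto simp: X_def)
  then show ?thesis by blast
qed

lemma card_X: "card (X s k) = card (X s' k)"
proof (cases "X s k = {}")
  case True
  then show ?thesis using X_empty_iff by (metis)
next
  case False
  then obtain p p' where "p \<in> X s k" "p' \<in> X s' k" using X_empty_iff[of s k s'] by auto
  then have "size (image_mset (col p) (mset_set (X s k))) = size (image_mset (col p') (mset_set (X s' k)))"
    by (metis color_mset_eq)
  then show ?thesis by simp
qed

lemma card_X_le: "card (X s k) \<le> 4"
proof (cases "X False k = {}")
  case True
  then show ?thesis using card_X[of s k False] by simp
next
  case False
  then obtain p where "p \<in> X False k" by auto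
  then have "card (X False k) \<le> 4" using small[of p] by (simp add: X_def)
  then show ?thesis using card_X[of s k False] by simp
qed

text \<open>Three of the four colours seen from a point determine the remaining one, so matching up two
  points of each fiber leaves nothing to choose.\<close>

lemma fiber_iso:
  assumes p: "p \<in> X s k" and p': "p' \<in> X s' k"
  shows "\<exists>\<phi>. \<phi> p = p' \<and> (\<forall>x\<in>X s k. \<phi> x \<in> X s' k) \<and> (\<forall>x\<in>X s k. \<forall>y\<in>X s k. col (\<phi> x) (\<phi> y) = col x y)"
proof (cases "X s k = {p}")
  case True
  moreover have "col p p = k" "col p' p' = k" using p p' by (simp_all add: X_iff)
  ultimately show ?thesis using p' by (intro exI[of _ "\<lambda>_. p'"]) simp
next
  case False
  then obtain a where a: "a \<in> X s k" "a \<noteq> p" using p by auto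
  then obtain a' where a': "a' \<in> X s' k" "col p a = col p' a'" "col a p = col a' p'"
    using second_point[OF p p'] by metis
  have t: "col x x = k" if "x \<in> X s k \<or> x \<in> X s' k" for x using that by (auto simp: X_iff)
  have "a' \<noteq> p'" using diag_X[OF p a(1) p'] a' a by auto
  note pa = this
  show ?thesis
  proof (cases "X s k = {p, a}")
    case True
    show ?thesis
      by (intro exI[of _ "\<lambda>x. if x = p then p' else a'"]) (use a a' p p' t in \<open>simp add: True\<close>)
  next
    case False
    then obtain b where b: "b \<in> X s k" "b \<noteq> p" "b \<noteq> a" using a p by auto
    obtain b' where b': "b' \<in> X s' k" "col p b = col p' b'" "col b p = col b' p'" "col b a = col b' a'" "col a b = col a' b'"
      using third_point[OF p a(1) p' a'(1,2) b(1)] by metis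
    have pb: "b' \<noteq> p'" "b' \<noteq> a'" using diag_X[OF p b(1) p'] diag_X[OF a(1) b(1) a'(1)] b b' by auto
    show ?thesis
    proof (cases "X s k = {p, a, b}")
      case True
      show ?thesis
        by (intro exI[of _ "\<lambda>x. if x = p then p' else if x = a then a' else b'"])
          (use a a' p p' b b' t in \<open>simp add: True\<close>)
    next
      case False
      then obtain c where c: "c \<in> X s k" "c \<noteq> p" "c \<noteq> a" "c \<noteq> b" using a b p by auto
      have sub: "{p, a, b, c} \<subseteq> X s k" using p a b c by auto
      have c4: "card {p, a, b, c} = 4" using a b c by auto
      have Xk: "X s k = {p, a, b, c}"
        using card_seteq[OF finite_X sub] c4 card_X_le[of s k] by simp
      have "card (X s' k) = 4" using card_X[of s' k s] Xk c4 by simp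
      moreover have "card {p', a', b'} = 3" using pa pb by auto
      ultimately have "\<not> X s' k \<subseteq> {p', a', b'}" using card_mono[of "{p', a', b'}" "X s' k"] by auto
      then obtain c' where c': "c' \<in> X s' k" "c' \<noteq> p'" "c' \<noteq> a'" "c' \<noteq> b'" by auto
      have Xk': "X s' k = {p', a', b', c'}"
      proof (rule card_seteq[OF finite_X, symmetric])
        show "{p', a', b', c'} \<subseteq> X s' k" using p' a' b' c' by auto
        show "card (X s' k) \<le> card {p', a', b', c'}" using card_X_le[of s' k] c' pa pb by auto
      qed
      have m: "image_mset (col x) (mset_set {p, a, b, c}) = image_mset (col x') (mset_set {p', a', b', c'})"
        if "x \<in> X s k" "x' \<in> X s' k" for x x' using color_mset_eq[OF that, of k] Xk Xk' by simp
      have 1: "col p c = col p' c'" using m[OF p p'] a b c a' b' c' pa pb t p p' by auto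
      have 2: "col a c = col a' c'" using m[OF a(1) a'(1)] a b c a' b' c' pa pb t p p' by auto
      have 3: "col b c = col b' c'" using m[OF b(1) b'(1)] a b c a' b' c' pa pb t p p' by auto
      have 4: "col c p = col c' p'" "col c a = col c' a'" "col c b = col c' b'"
        using conv_X[OF p c(1) p' c'(1) 1] conv_X[OF a(1) c(1) a'(1) c'(1) 2] conv_X[OF b(1) c(1) b'(1) c'(1) 3] by auto
      show ?thesis
        by (intro exI[of _ "\<lambda>x. if x = p then p' else if x = a then a' else if x = b then b' else c'"])
          (use a a' p' p b b' c c' t 1 2 3 4 in \<open>simp add: Xk\<close>)
    qed
  qed
qed

section \<open>Points that determine other points\<close>

definition uniq :: "'p \<Rightarrow> 'p \<Rightarrow> bool" where
  "uniq p q \<longleftrightarrow> (\<forall>w\<in>X (sd q) (col q q). col p w = col p q \<longrightarrow> w = q)"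

lemma uniq_iff: "q \<in> X s l \<Longrightarrow> uniq p q \<longleftrightarrow> (\<forall>w\<in>X s l. col p w = col p q \<longrightarrow> w = q)"
  by (auto simp: uniq_def X_iff)

text \<open>To determine \<open>q\<close> means that the relation of the pair has valency 1, and
  valencies agree on all points of a fiber and on both sides.\<close>

lemma uniq_transfer:
  assumes "p \<in> X s k" "q \<in> X s l" "p' \<in> X s' k" "q' \<in> X s' l" "col p q = col p' q'" "uniq p q"
  shows "uniq p' q'"
proof -
  have "{w \<in> X s l. col p w = col p q} = {q}"
    using assms(2,6) unfolding uniq_iff[OF assms(2)] by blast
  then have "card {w \<in> X s' l. col p' w = col p' q'} = 1"
    using valency_eq[OF assms(1,3), of l "col p q"] assms(5) by simp
  then obtain v where "{w \<in> X s' l. col p' w = col p' q'} = {v}" by (auto simp: card_1_singleton_iff)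
  then have v: "\<forall>w. w \<in> X s' l \<and> col p' w = col p' q' \<longleftrightarrow> w = v" by (simp add: set_eq_iff)
  then have "q' = v" using assms(4) by blast
  then show ?thesis unfolding uniq_iff[OF assms(4)] using v by blast
qed

text \<open>If \<open>v\<close> has the colour of \<open>u\<close> from \<open>p\<close>, copying
  \<open>q\<close> over the pair \<open>p\<close>, \<open>v\<close> gives a point that must be
  \<open>q\<close>; so \<open>v\<close> also has the colour of \<open>u\<close> from
  \<open>q\<close>.\<close>

lemma uniq_trans:
  assumes p: "p \<in> X s k" and q: "q \<in> X s l" and u: "u \<in> X s m" and "uniq p q" "uniq q u"
  shows "uniq p u"
  unfolding uniq_iff[OF u]
proof (intro ballI impI)
  fix v assume v: "v \<in> X s m" "col p v = col p u"
  obtain w where w: "w \<in> X s l" "col p q = col p w" "col q u = col w v"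
    using third_point[OF p u p v(1) _ q] v by metis
  have "w = q" using w(1,2) \<open>uniq p q\<close> uniq_iff[OF q, of p] by simp
  then show "v = u" using w(3) v(1) \<open>uniq q u\<close> uniq_iff[OF u, of q] by simp
qed

text \<open>Isomorphisms from side \<open>False\<close> to side \<open>True\<close>, defined on the fibers with colour in \<open>Y\<close>.\<close>

definition piso :: "'k set \<Rightarrow> ('p \<Rightarrow> 'p) \<Rightarrow> bool" where
  "piso Y \<phi> \<longleftrightarrow> (\<forall>k\<in>Y. \<forall>x\<in>X False k. \<phi> x \<in> X True k) \<and>
     (\<forall>k\<in>Y. \<forall>l\<in>Y. \<forall>x\<in>X False k. \<forall>y\<in>X False l. col (\<phi> x) (\<phi> y) = col x y)"

definition dom :: "'k set \<Rightarrow> bool" where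
  "dom B \<longleftrightarrow> (\<forall>s l. \<forall>u\<in>X s l. \<exists>k\<in>B. \<exists>w\<in>X s k. uniq w u)"

lemma domE:
  assumes "dom B" "u \<in> X s l" obtains k w where "k \<in> B" "w \<in> X s k" "uniq w u"
  using assms unfolding dom_def by blast

text \<open>A point determined by \<open>w\<close> is sent to the one point that has the right
  colour from the image of \<open>w\<close>.\<close>

lemma piso_extend_all:
  assumes B: "dom B" and iso: "piso B \<phi>"
  shows "\<exists>\<phi>'. piso UNIV \<phi>'"
proof -
  have phi: "\<phi> x \<in> X True k" if "k \<in> B" "x \<in> X False k" for x k using iso that by (auto simp: piso_def)
  have phi2: "col (\<phi> x) (\<phi> y) = col x y" if "k \<in> B" "x \<in> X False k" "l \<in> B" "y \<in> X False l" for x k y l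
    using iso that by (auto simp: piso_def)
  have "\<exists>u'. \<exists>k\<in>B. \<exists>w\<in>X False k. uniq w u \<and> u' \<in> X True (col u u) \<and> col w u = col (\<phi> w) u' \<and> uniq (\<phi> w) u'"
    if u: "u \<in> P" "\<not> sd u" for u
  proof -
    have u1: "u \<in> X False (col u u)" using u by (auto simp: X_iff)
    obtain k w where kw: "k \<in> B" "w \<in> X False k" "uniq w u" using domE[OF B u1] by metis
    obtain u' where u': "u' \<in> X True (col u u)" "col w u = col (\<phi> w) u'"
      using second_point[OF kw(2) phi[OF kw(1,2)] u1] by metis
    have "uniq (\<phi> w) u'" using uniq_transfer[OF kw(2) u1 phi[OF kw(1,2)] u'] kw by simp
    then show ?thesis using kw u' by auto
  qed
  then obtain \<psi> where psi: "\<exists>k\<in>B. \<exists>w\<in>X False k. uniq w u \<and> \<psi> u \<in> X True (col u u) \<and> col w u = col (\<phi> w) (\<psi> u) \<and> uniq (\<phi> w) (\<psi> u)"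
    if "u \<in> P" "\<not> sd u" for u by metis
  have "col (\<psi> u) (\<psi> v) = col u v" if u: "u \<in> X False k" and v: "v \<in> X False l" for u v k l
  proof -
    obtain m w where w: "m \<in> B" "w \<in> X False m" "\<psi> u \<in> X True k" "col w u = col (\<phi> w) (\<psi> u)" "uniq (\<phi> w) (\<psi> u)"
      using psi[of u] u by (auto simp: X_iff)
    obtain n z where z: "n \<in> B" "z \<in> X False n" "\<psi> v \<in> X True l" "col z v = col (\<phi> z) (\<psi> v)" "uniq (\<phi> z) (\<psi> v)"
      using psi[of v] v by (auto simp: X_iff)
    \<comment> \<open>Agreement of colours is moved from the pair \<open>w\<close>, \<open>z\<close>
      to \<open>u\<close>, \<open>z\<close> and then to \<open>u\<close>, \<open>v\<close>. Each
      time a third point is copied over the known pair, and uniqueness identifies the copy with the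
      chosen image.\<close>
    have wz: "col w z = col (\<phi> w) (\<phi> z)" using phi2[OF w(1,2) z(1,2)] by simp
    obtain u' where u': "u' \<in> X True k" "col w u = col (\<phi> w) u'" "col u z = col u' (\<phi> z)"
      using third_point[OF w(2) z(2) phi[OF w(1,2)] phi[OF z(1,2)] wz u] by metis
    then have "u' = \<psi> u" using w uniq_iff[OF w(3)] by auto
    then have uz: "col u z = col (\<psi> u) (\<phi> z)" using u' by simp
    obtain v' where v': "v' \<in> X True l" "col u v = col (\<psi> u) v'" "col z v = col (\<phi> z) v'"
      using third_point[OF u z(2) w(3) phi[OF z(1,2)] uz v] by metis
    then have "v' = \<psi> v" using z uniq_iff[OF z(3)] by auto
    then show ?thesis using v' by simp
  qed
  moreover have "\<psi> u \<in> X True k" if "u \<in> X False k" for u k using psi[of u] that by (auto simp: X_iff)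
  ultimately show ?thesis by (intro exI[of _ \<psi>]) (auto simp: piso_def)
qed

definition T :: "'k set" where "T = (\<lambda>p. col p p) ` P"

lemma finite_T: "finite T" using fin by (simp add: T_def)

lemma X_notT: "k \<notin> T \<Longrightarrow> X s k = {}" by (auto simp: X_def T_def)

lemma X_T: "k \<in> T \<Longrightarrow> X s k \<noteq> {}" using types[of _ s] by (auto simp: X_def T_def)

text \<open>A dominating set of least size works: if one point of \<open>k\<close> determined a
  point of \<open>l\<close>, every point of \<open>l\<close> would be determined by some point of
  \<open>k\<close>, and by \<open>uniq_trans\<close> the fiber \<open>l\<close> could be
  removed.\<close>

lemma ex_dom:
  "\<exists>B\<subseteq>T. dom B \<and> (\<forall>k\<in>B. \<forall>l\<in>B. k \<noteq> l \<longrightarrow> (\<forall>s. \<forall>p\<in>X s k. \<forall>q\<in>X s l. \<not> uniq p q))"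
proof -
  have "dom T"
    unfolding dom_def
  proof (intro allI ballI)
    fix s l u assume u: "u \<in> X s l"
    then have "uniq u u" using diag_X uniq_iff by metis
    moreover have "l \<in> T" using u X_notT by blast
    ultimately show "\<exists>k\<in>T. \<exists>w\<in>X s k. uniq w u" using u by blast
  qed
  then have "\<exists>B. (B \<subseteq> T \<and> dom B) \<and> (\<forall>B'. B' \<subseteq> T \<and> dom B' \<longrightarrow> card B \<le> card B')"
    using ex_has_least_nat[of "\<lambda>B. B \<subseteq> T \<and> dom B" T card] by auto
  then obtain B where B: "B \<subseteq> T" "dom B" and min: "\<And>B'. B' \<subseteq> T \<Longrightarrow> dom B' \<Longrightarrow> card B \<le> card B'" by blast
  have "\<not> uniq p q" if kl: "k \<in> B" "l \<in> B" "k \<noteq> l" and p: "p \<in> X s k" and q: "q \<in> X s l" for k l s p q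
  proof
    assume u: "uniq p q"
    have "dom (B - {l})"
      unfolding dom_def
    proof (intro allI ballI)
      fix s' n v assume v: "v \<in> X s' n"
      obtain m w where w: "m \<in> B" "w \<in> X s' m" "uniq w v" using domE[OF B(2) v] by metis
      show "\<exists>k\<in>B - {l}. \<exists>w\<in>X s' k. uniq w v"
      proof (cases "m = l")
        case True
        then have wl: "w \<in> X s' l" using w by simp
        obtain p' where p': "p' \<in> X s' k" "col p q = col p' w"
          using second_point[OF q wl p] by metis
        have "uniq p' w" using uniq_transfer[OF p q p'(1) wl] p' u by simp
        then have "uniq p' v" using uniq_trans[OF p'(1) wl v] w by simp
        then show ?thesis using p' kl by auto
      qed (use w in auto)
    qed
    then have "card B \<le> card (B - {l})" using min[of "B - {l}"] B by blast
    moreover have "card (B - {l}) < card B" using kl B finite_T by (intro card_Diff1_less) (auto intro: finite_subset)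
    ultimately show False by simp
  qed
  then show ?thesis using B by auto
qed

lemma col_swap_iff:
  assumes "x \<in> X s k" "y \<in> X s l" "x' \<in> X s' k'" "y' \<in> X s' l'"
  shows "col x y = col x' y' \<longleftrightarrow> col y x = col y' x'"
  using conv_X[OF assms] conv_X[OF assms(2,1,4,3)] by blast

section \<open>Interspaces between independent fibers\<close>

definition indep :: "'k \<Rightarrow> 'k \<Rightarrow> bool" where
  "indep k l \<longleftrightarrow> (\<forall>s. \<forall>p\<in>X s k. \<forall>q\<in>X s l. \<not> uniq p q)"

definition unif :: "'k \<Rightarrow> 'k \<Rightarrow> bool" where
  "unif k l \<longleftrightarrow> (\<forall>s s'. \<forall>p\<in>X s k. \<forall>q\<in>X s l. \<forall>p'\<in>X s' k. \<forall>q'\<in>X s' l. col p q = col p' q')"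

text \<open>The interspaces that cause trouble. By \<open>bip_split\<close>, applied in both
  directions, each relation of such an interspace is a bipartite graph on 4 + 4 points, regular of
  degree 2: two disjoint 4-cycles or one 8-cycle.\<close>

definition bip :: "'k \<Rightarrow> 'k \<Rightarrow> bool" where
  "bip k l \<longleftrightarrow> indep k l \<and> indep l k \<and> \<not> unif k l"

lemma unif_sym: "unif k l \<Longrightarrow> unif l k"
  unfolding unif_def using conv_X by blast

lemma bip_sym: "bip k l \<Longrightarrow> bip l k"
  using unif_sym by (auto simp: bip_def)

lemma bip_partner:
  assumes "bip k l" "p \<in> X s k" "q \<in> X s l"
  obtains q2 where "q2 \<in> X s l" "q2 \<noteq> q" "col p q2 = col p q"
proof -
  have "\<not> uniq p q" using assms unfolding bip_def indep_def by blast
  then show thesis using that unfolding uniq_iff[OF assms(3)] by blast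
qed

text \<open>Independence gives every colour seen from \<open>p\<close> at least two of the at most
  four points, and if there were a single colour, copying would make the interspace uniform.\<close>

lemma bip_split:
  assumes b: "bip k l" and p: "p \<in> X s k" and q: "q \<in> X s l"
  shows "\<exists>b c d. X s l = {q, b, c, d} \<and> distinct [q, b, c, d] \<and>
    col p b = col p q \<and> col p c = col p d \<and> col p c \<noteq> col p q"
proof -
  have "\<exists>c\<in>X s l. col p c \<noteq> col p q"
  proof (rule ccontr)
    assume "\<not> ?thesis"
    then have c: "col p r = col p q" if "r \<in> X s l" for r using that by blast
    have "col p2 q2 = col p q" if h: "p2 \<in> X s2 k" "q2 \<in> X s2 l" for p2 q2 s2
      using second_point[OF h(1) p h(2)] c by auto
    then have "unif k l" unfolding unif_def by metis
    then show False using b by (simp add: bip_def)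
  qed
  then obtain c where c: "c \<in> X s l" "col p c \<noteq> col p q" by blast
  obtain b where b: "b \<in> X s l" "b \<noteq> q" "col p b = col p q" using bip_partner[OF b p q] .
  obtain d where d: "d \<in> X s l" "d \<noteq> c" "col p d = col p c" using bip_partner[OF assms(1) p c(1)] .
  have dist: "distinct [q, b, c, d]" using b c d by auto
  then have "card {q, b, c, d} = 4" by auto
  moreover have "{q, b, c, d} \<subseteq> X s l" using q b c d by auto
  ultimately have "X s l = {q, b, c, d}" using card_seteq[of "X s l" "{q, b, c, d}"] card_X_le[of s l] by simp
  then show ?thesis using dist b c d by (intro exI[of _ b] exI[of _ c] exI[of _ d]) simp
qed

lemma bip_card: "bip k l \<Longrightarrow> p \<in> X s k \<Longrightarrow> q \<in> X s l \<Longrightarrow> card (X s l) = 4"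
  using bip_split[of k l p s q] by auto

lemma bip_two:
  assumes b: "bip k l" and p: "p \<in> X s k" and q: "q1 \<in> X s l" "q2 \<in> X s l" "q3 \<in> X s l"
    and "q1 \<noteq> q2" "q1 \<noteq> q3" "q2 \<noteq> q3" "col p q1 = col p q2" "col p q1 = col p q3"
  shows False
proof -
  obtain b c d where h: "X s l = {q1, b, c, d}" "distinct [q1, b, c, d]"
    "col p b = col p q1" "col p c = col p d" "col p c \<noteq> col p q1"
    using bip_split[OF b p q(1)] by blast
  have "q2 = b" "q3 = b" using q assms h by auto
  then show False using assms by simp
qed

lemma bip_two':
  assumes b: "bip k l" and p: "p \<in> X s l" and q: "q1 \<in> X s k" "q2 \<in> X s k" "q3 \<in> X s k"
    and d: "q1 \<noteq> q2" "q1 \<noteq> q3" "q2 \<noteq> q3" and c: "col q1 p = col q2 p" "col q1 p = col q3 p"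
  shows False
  using bip_two[OF bip_sym[OF b] p q d] col_swap_iff[OF q(1) p q(2) p] col_swap_iff[OF q(1) p q(3) p] c by simp

text \<open>All colours of the interspace, on both sides, are visible from \<open>p1\<close>, where
  there are only two.\<close>

lemma bip_three:
  assumes b: "bip k l" and "p1 \<in> X s1 k" "q1 \<in> X s1 l" "p2 \<in> X s2 k" "q2 \<in> X s2 l" "p3 \<in> X s3 k" "q3 \<in> X s3 l"
    and "col p1 q1 \<noteq> col p2 q2" "col p1 q1 \<noteq> col p3 q3"
  shows "col p2 q2 = col p3 q3"
proof -
  obtain b c d where h: "X s1 l = {q1, b, c, d}"
    "col p1 b = col p1 q1" "col p1 c = col p1 d" "col p1 c \<noteq> col p1 q1"
    using bip_split[OF b assms(2,3)] by blast
  obtain r2 where r2: "r2 \<in> X s1 l" "col p2 q2 = col p1 r2" using second_point[OF assms(4,2,5)] by blast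
  obtain r3 where r3: "r3 \<in> X s1 l" "col p3 q3 = col p1 r3" using second_point[OF assms(6,2,7)] by blast
  have "col p1 r2 = col p1 c" "col p1 r3 = col p1 c" using r2 r3 h assms by auto
  then show ?thesis using r2 r3 by simp
qed

text \<open>\<open>Q k m m'\<close>: the splitting of the fiber \<open>k\<close> by a point of \<open>m\<close> refines the one by any point of
  \<open>m'\<close>. For a non-uniform interspace, \<open>Q k l l\<close> says that it is \<open>2K\<^sub>2\<^sub>,\<^sub>2\<close> and not an 8-cycle.\<close>

definition Q :: "'k \<Rightarrow> 'k \<Rightarrow> 'k \<Rightarrow> bool" where
  "Q k m m' \<longleftrightarrow> (\<forall>s. \<forall>x1\<in>X s k. \<forall>x2\<in>X s k. \<forall>z\<in>X s m. \<forall>z'\<in>X s m'.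
     col x1 z = col x2 z \<longrightarrow> col x1 z' = col x2 z')"

lemma QD: "Q k m m' \<Longrightarrow> x1 \<in> X s k \<Longrightarrow> x2 \<in> X s k \<Longrightarrow> z \<in> X s m \<Longrightarrow> z' \<in> X s m' \<Longrightarrow>
     col x1 z = col x2 z \<Longrightarrow> col x1 z' = col x2 z'"
  unfolding Q_def by blast

lemma Q_swapD:
  assumes "Q k m m'" "x1 \<in> X s k" "x2 \<in> X s k" "z \<in> X s m" "z' \<in> X s m'" "col z x1 = col z x2"
  shows "col z' x1 = col z' x2"
  using QD[OF assms(1-5)] assms(6) col_swap_iff[OF assms(2,4,3,4)] col_swap_iff[OF assms(2,5,3,5)] by simp

lemma unif_Q: "unif k m' \<Longrightarrow> Q k m m'"
  unfolding unif_def Q_def by blast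

lemma twins_transfer:
  assumes a: "a1 \<in> X s k" "a2 \<in> X s k" and x: "x1 \<in> X s' k" "x2 \<in> X s' k"
    and eq: "col a1 a2 = col x1 x2" and tw: "\<And>y. y \<in> X s l \<Longrightarrow> col a1 y = col a2 y"
    and y: "y \<in> X s' l"
  shows "col x1 y = col x2 y"
  using third_point[OF x a eq[symmetric] y] tw by metis

text \<open>One pair that \<open>l\<close> does not separate is enough: its colour produces such a
  partner \<open>x3\<close> for every \<open>x1\<close>, and since the classes at a point of
  \<open>l\<close> have size 2, this partner is the whole rest of the class.\<close>

lemma twins_Q:
  assumes b: "bip k l" and a: "a1 \<in> X s k" "a2 \<in> X s k" "a1 \<noteq> a2"
    and tw: "\<And>y. y \<in> X s l \<Longrightarrow> col a1 y = col a2 y"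
  shows "Q k l l"
  unfolding Q_def
proof (intro allI ballI impI)
  fix s' x1 x2 z z'
  assume x: "x1 \<in> X s' k" "x2 \<in> X s' k" and z: "z \<in> X s' l" "z' \<in> X s' l" and eq: "col x1 z = col x2 z"
  obtain x3 where x3: "x3 \<in> X s' k" "col a1 a2 = col x1 x3" using second_point[OF a(1) x(1) a(2)] by blast
  have ne: "x3 \<noteq> x1" using diag_X[OF a(1,2) x(1)] x3 a by auto
  have t: "col x1 y = col x3 y" if "y \<in> X s' l" for y
    using twins_transfer[OF a(1,2) x(1) x3 tw that] by simp
  have "x2 = x1 \<or> x2 = x3" using bip_two'[OF b z(1) x(1) x(2) x3(1)] ne eq t[OF z(1)] by auto
  then show "col x1 z' = col x2 z'" using t[OF z(2)] by auto
qed

text \<open>By \<open>Q k l l\<close> the points \<open>y1\<close> and \<open>y2\<close> split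
  \<open>k\<close> into the same two pairs. If they agree on one pair, they agree on the other,
  because only one colour remains for it.\<close>

lemma Q_sym:
  assumes b: "bip k l" and Q: "Q k l l"
  shows "Q l k k"
  unfolding Q_def
proof (intro allI ballI impI)
  fix s y1 y2 x x'
  assume y: "y1 \<in> X s l" "y2 \<in> X s l" and x: "x \<in> X s k" "x' \<in> X s k" and eq: "col y1 x = col y2 x"
  have eq': "col x y1 = col x y2" using eq col_swap_iff[OF x(1) y(1) x(1) y(2)] by simp
  obtain x2 where x2: "x2 \<in> X s k" "x2 \<noteq> x" "col y1 x2 = col y1 x"
    using bip_partner[OF bip_sym[OF b] y(1) x(1)] .
  have x2': "col x y1 = col x2 y1" using x2 col_swap_iff[OF x(1) y(1) x2(1) y(1)] by simp
  have x2'': "col x y2 = col x2 y2" using QD[OF Q x(1) x2(1) y(1) y(2) x2'] .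
  have "col x' y1 = col x' y2"
  proof (cases "x' = x \<or> x' = x2")
    case True
    then show ?thesis using eq' x2' x2'' by auto
  next
    case False
    then have "col x y1 \<noteq> col x' y1" "col x y2 \<noteq> col x' y2"
      using bip_two'[OF b y(1) x(1) x2(1) x(2)] bip_two'[OF b y(2) x(1) x2(1) x(2)] x2 x2' x2'' by auto
    then show ?thesis using bip_three[OF b x(1) y(1) x(2) y(1) x(2) y(2)] eq' by simp
  qed
  then show "col y1 x' = col y2 x'" using col_swap_iff[OF x(2) y(1) x(2) y(2)] by simp
qed

section \<open>Gluing partial isomorphisms\<close>

lemma pisoD:
  assumes "piso Y \<phi>"
  shows "k \<in> Y \<Longrightarrow> x \<in> X False k \<Longrightarrow> \<phi> x \<in> X True k"
    and "k \<in> Y \<Longrightarrow> l \<in> Y \<Longrightarrow> x \<in> X False k \<Longrightarrow> y \<in> X False l \<Longrightarrow> col (\<phi> x) (\<phi> y) = col x y"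
  using assms by (auto simp: piso_def)

lemma X_disj: "x \<in> X s k \<Longrightarrow> x \<in> X s' l \<Longrightarrow> k = l"
  by (simp add: X_iff)

lemma piso_combine:
  assumes phi: "piso Y \<phi>" and psi: "piso Z \<psi>" and dis: "Y \<inter> Z = {}"
    and cross: "\<And>k m x z. k \<in> Z \<Longrightarrow> m \<in> Y \<Longrightarrow> x \<in> X False k \<Longrightarrow> z \<in> X False m \<Longrightarrow> col (\<psi> x) (\<phi> z) = col x z"
  shows "\<exists>\<phi>'. piso (Y \<union> Z) \<phi>'"
proof -
  let ?f = "\<lambda>x. if col x x \<in> Y then \<phi> x else \<psi> x"
  have fY: "?f x = \<phi> x" if "x \<in> X False k" "k \<in> Y" for x k using that by (simp add: X_iff)
  have fZ: "?f x = \<psi> x" if "x \<in> X False k" "k \<in> Z" for x k using that dis by (auto simp: X_iff)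
  have "piso (Y \<union> Z) ?f"
    unfolding piso_def
  proof (intro conjI ballI)
    fix k x assume "k \<in> Y \<union> Z" "x \<in> X False k"
    then show "?f x \<in> X True k" using fY fZ pisoD(1)[OF phi] pisoD(1)[OF psi] by (metis Un_iff)
  next
    fix k l x y assume h: "k \<in> Y \<union> Z" "l \<in> Y \<union> Z" "x \<in> X False k" "y \<in> X False l"
    consider "k \<in> Y" "l \<in> Y" | "k \<in> Y" "l \<in> Z" | "k \<in> Z" "l \<in> Y" | "k \<in> Z" "l \<in> Z" using h by blast
    then show "col (?f x) (?f y) = col x y"
    proof cases
      case 1
      then show ?thesis using fY[OF h(3)] fY[OF h(4)] pisoD(2)[OF phi _ _ h(3,4)] by simp
    next
      case 2
      then have "col (\<psi> y) (\<phi> x) = col y x" using cross h by blast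
      then have "col (\<phi> x) (\<psi> y) = col x y"
        using col_swap_iff[OF pisoD(1)[OF psi 2(2) h(4)] pisoD(1)[OF phi 2(1) h(3)] h(4,3)] by simp
      then show ?thesis using fY[OF h(3) 2(1)] fZ[OF h(4) 2(2)] by simp
    next
      case 3
      then show ?thesis using fZ[OF h(3)] fY[OF h(4)] cross h by simp
    next
      case 4
      then show ?thesis using fZ[OF h(3)] fZ[OF h(4)] pisoD(2)[OF psi _ _ h(3,4)] by simp
    qed
  qed
  then show ?thesis by blast
qed

text \<open>One reference point settles the colours towards all of \<open>m\<close>: some
  \<open>w\<close> has the right colours towards both images, and \<open>Q k m1 m\<close> forbids
  \<open>x'\<close> to agree with \<open>w\<close> at \<open>z1\<close> and to differ from it at
  \<open>z\<close>.\<close>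

lemma cross_base:
  assumes phi: "piso Y \<phi>" and Q: "Q k m1 m" and m: "m1 \<in> Y" "m \<in> Y"
    and z1: "z1 \<in> X False m1" and z: "z \<in> X False m" and x: "x \<in> X False k" "x' \<in> X True k"
    and eq: "col x' (\<phi> z1) = col x z1"
  shows "col x' (\<phi> z) = col x z"
proof -
  have f: "\<phi> z1 \<in> X True m1" "\<phi> z \<in> X True m" using pisoD(1)[OF phi] m z1 z by auto
  obtain w where w: "w \<in> X True k" "col x z1 = col w (\<phi> z1)" "col x z = col w (\<phi> z)"
    using third_point[OF z1 z f _ x(1)] pisoD(2)[OF phi m z1 z] by metis
  then show ?thesis using QD[OF Q w(1) x(2) f] eq by simp
qed

text \<open>One correct point \<open>x0\<close> settles its whole fiber. By \<open>Q m k k\<close>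
  all points of \<open>k\<close> split \<open>m\<close> alike; the copy \<open>w\<close> of
  \<open>z\<close> and \<open>\<phi> z\<close> are not separated by the image of \<open>x0\<close>,
  hence not by that of \<open>x\<close>.\<close>

lemma cross_lift:
  assumes phi: "piso Y \<phi>" and Q: "Q m k k" and m: "m \<in> Y" and psi: "piso Z \<psi>" and k: "k \<in> Z"
    and x0: "x0 \<in> X False k" and eq: "\<And>z. z \<in> X False m \<Longrightarrow> col (\<psi> x0) (\<phi> z) = col x0 z"
    and x: "x \<in> X False k" and z: "z \<in> X False m"
  shows "col (\<psi> x) (\<phi> z) = col x z"
proof -
  have f: "\<psi> x0 \<in> X True k" "\<psi> x \<in> X True k" "\<phi> z \<in> X True m"
    using pisoD(1)[OF phi] pisoD(1)[OF psi] m k x x0 z by auto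
  obtain w where w: "w \<in> X True m" "col x0 z = col (\<psi> x0) w" "col x z = col (\<psi> x) w"
    using third_point[OF x0 x f(1,2) _ z] pisoD(2)[OF psi k k x0 x] by metis
  then have "col (\<psi> x0) w = col (\<psi> x0) (\<phi> z)" using eq[OF z] by simp
  then show ?thesis using Q_swapD[OF Q w(1) f(3) f(1) f(2)] w by simp
qed

lemma piso_single:
  assumes "x \<in> X False k" "x' \<in> X True k"
  shows "\<exists>\<psi>. piso {k} \<psi> \<and> \<psi> x = x'"
  using fiber_iso[OF assms] by (auto simp: piso_def)

text \<open>The image of \<open>x0\<close> is copied over the pair of reference points
  \<open>z1\<close>, \<open>z2\<close>. This is the place where two matchings are the limit;
  \<open>m1 = m2\<close> is allowed.\<close>

lemma piso_insert:
  assumes phi: "piso Y \<phi>" and k: "k \<notin> Y" and m: "m1 \<in> Y" "m2 \<in> Y" and T: "Y \<subseteq> T" "k \<in> T"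
    and cover: "\<And>m. m \<in> Y \<Longrightarrow> Q k m1 m \<or> Q k m2 m" and Qk: "\<And>m. m \<in> Y \<Longrightarrow> Q m k k"
  shows "\<exists>\<phi>'. piso (insert k Y) \<phi>'"
proof -
  obtain x0 z1 z2 where z: "x0 \<in> X False k" "z1 \<in> X False m1" "z2 \<in> X False m2"
    using X_T T m by (metis all_not_in_conv subset_eq)
  have f: "\<phi> z1 \<in> X True m1" "\<phi> z2 \<in> X True m2" using pisoD(1)[OF phi] m z by auto
  obtain x' where x': "x' \<in> X True k" "col x0 z1 = col x' (\<phi> z1)" "col x0 z2 = col x' (\<phi> z2)"
    using third_point[OF z(2,3) f _ z(1)] pisoD(2)[OF phi m z(2,3)] by metis
  obtain \<psi> where psi: "piso {k} \<psi>" "\<psi> x0 = x'" using piso_single[OF z(1) x'(1)] by blast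
  have base: "col (\<psi> x0) (\<phi> v) = col x0 v" if "n \<in> Y" "v \<in> X False n" for n v
    using cover[OF that(1)] cross_base[OF phi _ m(1) that(1) z(2) that(2) z(1) x'(1)]
      cross_base[OF phi _ m(2) that(1) z(3) that(2) z(1) x'(1)] x' psi(2) by auto
  have "\<exists>\<phi>'. piso (Y \<union> {k}) \<phi>'"
  proof (rule piso_combine[OF phi psi(1)])
    show "col (\<psi> x) (\<phi> v) = col x v" if "k' \<in> {k}" "n \<in> Y" "x \<in> X False k'" "v \<in> X False n" for k' n x v
      using cross_lift[OF phi Qk[OF that(2)] that(2) psi(1) _ z(1) base[OF that(2)] _ that(4)] that by auto
  qed (use k in auto)
  then show ?thesis by simp
qed

section \<open>Interspaces that are 8-cycles\<close>

definition c8 :: "'k \<Rightarrow> 'k \<Rightarrow> bool" where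
  "c8 k l \<longleftrightarrow> bip k l \<and> \<not> Q k l l"

lemma c8_sym: "c8 k l \<Longrightarrow> c8 l k"
  using bip_sym Q_sym unfolding c8_def by blast

lemma c8_twins:
  assumes "c8 k l" "x1 \<in> X s k" "x2 \<in> X s k" "\<And>y. y \<in> X s l \<Longrightarrow> col x1 y = col x2 y"
  shows "x1 = x2"
  using twins_Q[of k l x1 s x2] assms unfolding c8_def by blast

text \<open>With degree 2, two common neighbours are all neighbours, so no point of \<open>l\<close>
  would separate \<open>x1\<close> from \<open>x2\<close>; on an 8-cycle this forces them to be
  equal.\<close>

lemma c8_two_common:
  assumes c: "c8 k l" and x: "x1 \<in> X s k" "x2 \<in> X s k" and y: "y1 \<in> X s l" "y2 \<in> X s l" "y1 \<noteq> y2"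
    and eq: "col x1 y1 = col x2 y1" "col x1 y2 = col x1 y1" "col x2 y2 = col x1 y1"
  shows "x1 = x2"
proof (rule c8_twins[OF c x])
  have b: "bip k l" using c by (simp add: c8_def)
  fix y assume v: "y \<in> X s l"
  show "col x1 y = col x2 y"
  proof (cases "y = y1 \<or> y = y2")
    case True then show ?thesis using eq by auto
  next
    case False
    then have "col x1 y1 \<noteq> col x1 y" "col x1 y1 \<noteq> col x2 y"
      using bip_two[OF b x(1) y(1,2) v] bip_two[OF b x(2) y(1,2) v] eq y by auto
    then show ?thesis using bip_three[OF b x(1) y(1) x(1) v x(2) v] by simp
  qed
qed

text \<open>If \<open>z\<close> splits the fiber of \<open>k\<close> in the same way as \<open>y\<close> does, then so does a second point \<open>z2\<close>,
  and some \<open>z3\<close> splits it like the other neighbour \<open>y1\<close> of \<open>x1\<close>: three neighbours of \<open>x1\<close> in \<open>m\<close>.\<close>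

lemma c8_antipodal:
  assumes c: "c8 k l" and bm: "bip k m" and lm: "indep l m"
    and x: "x1 \<in> X s k" "x2 \<in> X s k" "x1 \<noteq> x2" and z: "z \<in> X s m" and eq: "col x1 z = col x2 z"
    and y: "y \<in> X s l"
  shows "col x1 y \<noteq> col x2 y"
proof
  assume eqy: "col x1 y = col x2 y"
  have b: "bip k l" using c by (simp add: c8_def)
  have same: "col w y = col x1 y \<longleftrightarrow> col w z = col x1 z" if w: "w \<in> X s k" for w
  proof -
    have "col w y = col x1 y \<longleftrightarrow> w = x1 \<or> w = x2"
      using bip_two'[OF b y x(1,2) w] x(3) eqy by metis
    moreover have "col w z = col x1 z \<longleftrightarrow> w = x1 \<or> w = x2"
      using bip_two'[OF bm z x(1,2) w] x(3) eq by metis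
    ultimately show ?thesis by simp
  qed
  \<comment> \<open>By \<open>same\<close>, the points \<open>y\<close> and \<open>z\<close> split
    \<open>k\<close> identically. That they do so, and which colours go together, depends only on
    the colour of the pair \<open>y\<close>, \<open>z\<close>.\<close>
  have transf: "col w y' = col x1 y \<longleftrightarrow> col w z' = col x1 z"
    if h: "y' \<in> X s l" "z' \<in> X s m" "col y' z' = col y z" "w \<in> X s k" for y' z' w
  proof -
    obtain v where "v \<in> X s k" "col w y' = col v y" "col w z' = col v z"
      using third_point[OF h(1,2) y z h(3,4)] by metis
    then show ?thesis using same by simp
  qed
  have "\<not> uniq y z" using lm y z unfolding indep_def by blast
  then obtain z2 where z2: "z2 \<in> X s m" "z2 \<noteq> z" "col y z2 = col y z"
    using uniq_iff[OF z] by blast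
  obtain y1 where y1: "y1 \<in> X s l" "y1 \<noteq> y" "col x1 y1 = col x1 y" using bip_partner[OF b x(1) y] .
  have x2y1: "col x2 y1 \<noteq> col x1 y"
    using c8_two_common[OF c x(1,2) y y1(1)] y1 eqy x(3) by auto
  obtain z3 where z3: "z3 \<in> X s m" "col y1 z3 = col y z" using second_point[OF y y1(1) z] by metis
  have "col x1 z2 = col x1 z" "col x2 z2 = col x1 z"
    using transf[OF y z2(1,3) x(1)] transf[OF y z2(1,3) x(2)] eqy by auto
  moreover have "col x1 z3 = col x1 z" "col x2 z3 \<noteq> col x1 z"
    using transf[OF y1(1) z3 x(1)] transf[OF y1(1) z3 x(2)] y1 x2y1 by auto
  ultimately show False using bip_two[OF bm x(1) z z2(1) z3(1)] z2(2) eq by metis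
qed

text \<open>Points with equal colours towards a point of \<open>m\<close> or of \<open>m'\<close>
  are antipodal on the 8-cycle, and a point has only one antipode. So both fibers split
  \<open>k\<close> along the antipodal matching.\<close>

lemma c8_Q:
  assumes c: "c8 k l" and bm: "bip k m" "bip k m'" and lm: "indep l m" "indep l m'"
  shows "Q k m m'"
  unfolding Q_def
proof (intro allI ballI impI)
  fix s x1 x2 z z'
  assume x: "x1 \<in> X s k" "x2 \<in> X s k" and z: "z \<in> X s m" "z' \<in> X s m'" and eq: "col x1 z = col x2 z"
  have b: "bip k l" using c by (simp add: c8_def)
  show "col x1 z' = col x2 z'"
  proof (cases "x1 = x2")
    case False
    obtain x3 where x3: "x3 \<in> X s k" "x3 \<noteq> x1" "col z' x3 = col z' x1"
      using bip_partner[OF bip_sym[OF bm(2)] z(2) x(1)] .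
    have eq3: "col x1 z' = col x3 z'" using x3 col_swap_iff[OF x(1) z(2) x3(1) z(2)] by simp
    have "x2 = x3"
    proof (rule c8_twins[OF c x(2) x3(1)])
      fix y assume y: "y \<in> X s l"
      have "col x1 y \<noteq> col x2 y" using c8_antipodal[OF c bm(1) lm(1) x False z(1) eq y] .
      moreover have "col x1 y \<noteq> col x3 y"
        using c8_antipodal[OF c bm(2) lm(2) x(1) x3(1) _ z(2) eq3 y] x3 by auto
      ultimately show "col x2 y = col x3 y" using bip_three[OF b x(1) y x(2) y x3(1) y] by simp
    qed
    then show ?thesis using eq3 by simp
  qed simp
qed

lemma fourth_color_eq:
  assumes "X s k = {a, b, c, d}" "X s' k = {a', b', c', d'}" "distinct [a, b, c, d]" "distinct [a', b', c', d']"
    and "col a b = col a' b'" "col a c = col a' c'"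
  shows "col a d = col a' d'"
proof -
  have "image_mset (col a) (mset_set {a, b, c, d}) = image_mset (col a') (mset_set {a', b', c', d'})"
    using color_mset_eq[of a s k a' s' k] assms by simp
  moreover have "col a a = k" "col a' a' = k" using assms(1,2) X_iff by auto
  ultimately show ?thesis using assms by simp
qed

text \<open>The point copied over the pair \<open>x'\<close>, \<open>y'\<close> is another neighbour
  of \<open>y'\<close>, and besides \<open>x'\<close> there is only one.\<close>

lemma common_nbr:
  assumes b: "bip k l" and y: "y \<in> X s l" "y' \<in> X s' l" and x: "x \<in> X s k" "x1 \<in> X s k" "x \<noteq> x1"
    and x': "x' \<in> X s' k" "x1' \<in> X s' k" "x' \<noteq> x1'"
    and c: "col x y = i" "col x1 y = i" "col x' y' = i" "col x1' y' = i"
  shows "col x x1 = col x' x1'"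
proof -
  obtain w where w: "w \<in> X s' k" "col x x1 = col x' w" "col x1 y = col w y'"
    using third_point[OF x(1) y(1) x'(1) y(2) _ x(2)] c by metis
  have "w \<noteq> x'" using w diag_X[OF x(1,2) x'(1)] x(3) by auto
  then have "w = x1'" using bip_two'[OF b y(2) x'(1,2) w(1)] c w x'(3) by metis
  then show ?thesis using w by simp
qed

text \<open>The edges of an 8-cycle \<open>x - y - x1 - y2 - x3 - y3 - x2 - y1 - x\<close>.\<close>

definition frame :: "bool \<Rightarrow> 'k \<Rightarrow> 'k \<Rightarrow> 'k \<Rightarrow> 'p \<Rightarrow> 'p \<Rightarrow> 'p \<Rightarrow> 'p \<Rightarrow> 'p \<Rightarrow> 'p \<Rightarrow> 'p \<Rightarrow> 'p \<Rightarrow> bool" where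
  "frame s k l i x x1 x2 x3 y y1 y2 y3 \<longleftrightarrow>
    X s k = {x, x1, x2, x3} \<and> distinct [x, x1, x2, x3] \<and>
    X s l = {y, y1, y2, y3} \<and> distinct [y, y1, y2, y3] \<and>
    col x y = i \<and> col x y1 = i \<and> col x1 y = i \<and> col x1 y2 = i \<and>
    col x2 y1 = i \<and> col x2 y3 = i \<and> col x3 y2 = i \<and> col x3 y3 = i"

text \<open>Points at distance 2 on the cycle have a common neighbour. The two antipodal pairs,
  \<open>x\<close>, \<open>x3\<close> and \<open>x1\<close>, \<open>x2\<close>, get the colour that
  is left over among those seen from one end.\<close>

lemma frame_col:
  assumes b: "bip k l" and f: "frame s k l i x x1 x2 x3 y y1 y2 y3"
    and f': "frame s' k l i x' x1' x2' x3' y' y1' y2' y3'"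
  shows "col x x1 = col x' x1'" "col x x2 = col x' x2'" "col x x3 = col x' x3'"
    "col x1 x2 = col x1' x2'" "col x1 x3 = col x1' x3'" "col x2 x3 = col x2' x3'"
proof -
  note F = f[unfolded frame_def] f'[unfolded frame_def]
  have inx: "x \<in> X s k" "x1 \<in> X s k" "x2 \<in> X s k" "x3 \<in> X s k"
    "x' \<in> X s' k" "x1' \<in> X s' k" "x2' \<in> X s' k" "x3' \<in> X s' k"
    "y \<in> X s l" "y1 \<in> X s l" "y2 \<in> X s l" "y3 \<in> X s l"
    "y' \<in> X s' l" "y1' \<in> X s' l" "y2' \<in> X s' l" "y3' \<in> X s' l" using F by blast+
  show 1: "col x x1 = col x' x1'" using common_nbr[OF b inx(9,13) inx(1,2) _ inx(5,6)] F by simp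
  show 2: "col x x2 = col x' x2'" using common_nbr[OF b inx(10,14) inx(1,3) _ inx(5,7)] F by simp
  show 3: "col x1 x3 = col x1' x3'" using common_nbr[OF b inx(11,15) inx(2,4) _ inx(6,8)] F by simp
  show 4: "col x2 x3 = col x2' x3'" using common_nbr[OF b inx(12,16) inx(3,4) _ inx(7,8)] F by simp
  show "col x x3 = col x' x3'" using fourth_color_eq[of s k x x1 x2 x3 s' x' x1' x2' x3'] F 1 2 by simp
  have "col x1 x = col x1' x'" using 1 col_swap_iff[OF inx(1,2) inx(5,6)] by simp
  moreover have "X s k = {x1, x, x3, x2}" "X s' k = {x1', x', x3', x2'}" using F by auto
  moreover have "distinct [x1, x, x3, x2]" "distinct [x1', x', x3', x2']" using F by auto
  ultimately show "col x1 x2 = col x1' x2'"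
    using fourth_color_eq[of s k x1 x x3 x2 s' x1' x' x3' x2'] 3 by blast
qed

lemma frame_swap:
  assumes "frame s k l i x x1 x2 x3 y y1 y2 y3"
  shows "frame s l k (col y x) y y1 y2 y3 x x1 x2 x3"
proof -
  note F = assms[unfolded frame_def]
  have inx: "x \<in> X s k" "x1 \<in> X s k" "x2 \<in> X s k" "x3 \<in> X s k"
    "y \<in> X s l" "y1 \<in> X s l" "y2 \<in> X s l" "y3 \<in> X s l" using F by blast+
  have e: "col v u = col y x" if "u \<in> X s k" "v \<in> X s l" "col u v = i" for u v
    using col_swap_iff[OF that(1,2) inx(1,5)] that F by simp
  show ?thesis unfolding frame_def
    using F e[OF inx(1,6)] e[OF inx(2,5)] e[OF inx(2,7)] e[OF inx(3,6)] e[OF inx(3,8)]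
      e[OF inx(4,7)] e[OF inx(4,8)] by simp
qed

text \<open>From the edge \<open>x\<close>, \<open>y\<close> the walk continues in both directions
  because every point has exactly two neighbours. It cannot close after four edges, by
  \<open>c8_two_common\<close>, so degree 2 forces the last two points to complete one
  cycle.\<close>

lemma frame_ex:
  assumes c: "c8 k l" and x: "x \<in> X s k" and y: "y \<in> X s l"
  shows "\<exists>x1 x2 x3 y1 y2 y3. frame s k l (col x y) x x1 x2 x3 y y1 y2 y3"
proof -
  have b: "bip k l" using c by (simp add: c8_def)
  define i where "i = col x y"
  obtain y1 where y1: "y1 \<in> X s l" "y1 \<noteq> y" "col x y1 = i" using bip_partner[OF b x y] unfolding i_def .
  obtain x1 where x1: "x1 \<in> X s k" "x1 \<noteq> x" "col y x1 = col y x" using bip_partner[OF bip_sym[OF b] y x] .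
  have x1y: "col x1 y = i" using x1 col_swap_iff[OF x1(1) y x y] unfolding i_def by simp
  obtain x2 where x2: "x2 \<in> X s k" "x2 \<noteq> x" "col y1 x2 = col y1 x" using bip_partner[OF bip_sym[OF b] y1(1) x] .
  have x2y1: "col x2 y1 = i" using x2 col_swap_iff[OF x2(1) y1(1) x y1(1)] y1 by simp
  obtain y2 where y2: "y2 \<in> X s l" "y2 \<noteq> y" "col x1 y2 = i" using bip_partner[OF b x1(1) y] x1y by metis
  have xy: "col x y = i" by (simp add: i_def)
  have tc: "u = v" if "u \<in> X s k" "v \<in> X s k" "p \<in> X s l" "q \<in> X s l" "p \<noteq> q"
    "col u p = i" "col v p = i" "col u q = i" "col v q = i" for u v p q
    using c8_two_common[OF c that(1-5)] that(6-9) by simp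
  have row: "col u r \<noteq> i" if "u \<in> X s k" "p \<in> X s l" "q \<in> X s l" "r \<in> X s l" "p \<noteq> q" "p \<noteq> r" "q \<noteq> r"
    "col u p = i" "col u q = i" for u p q r
    using bip_two[OF b that(1-7)] that(8,9) by auto
  have colm: "col r u \<noteq> i" if "u \<in> X s l" "p \<in> X s k" "q \<in> X s k" "r \<in> X s k" "p \<noteq> q" "p \<noteq> r" "q \<noteq> r"
    "col p u = i" "col q u = i" for u p q r
    using bip_two'[OF b that(1-7)] that(8,9) by auto
  have n1: "y2 \<noteq> y1" using tc[OF x x1(1) y y1(1)] xy y1 x1y y2 x1 by auto
  have n2: "x2 \<noteq> x1" using tc[OF x x1(1) y y1(1)] xy y1 x1y x2y1 x1 by auto
  obtain y3 where y3: "X s l = {y, y1, y2, y3}" "distinct [y, y1, y2, y3]"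
  proof -
    have "card {y, y1, y2} < card (X s l)" using bip_card[OF b x y] y1 y2 n1 by simp
    then obtain y3 where "y3 \<in> X s l" "y3 \<notin> {y, y1, y2}"
      by (metis card_mono finite.emptyI finite.insertI not_le subsetI)
    moreover from this have "{y, y1, y2, y3} = X s l"
      using bip_card[OF b x y] y1 y2 n1 y by (intro card_seteq) auto
    ultimately show ?thesis using y1 y2 n1 that[of y3] by auto
  qed
  obtain x3 where x3: "X s k = {x, x1, x2, x3}" "distinct [x, x1, x2, x3]"
  proof -
    have "card {x, x1, x2} < card (X s k)" using bip_card[OF bip_sym[OF b] y x] x1 x2 n2 by simp
    then obtain x3 where "x3 \<in> X s k" "x3 \<notin> {x, x1, x2}"
      by (metis card_mono finite.emptyI finite.insertI not_le subsetI)
    moreover from this have "{x, x1, x2, x3} = X s k"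
      using bip_card[OF bip_sym[OF b] y x] x1 x2 n2 x by (intro card_seteq) auto
    ultimately show ?thesis using x1 x2 n2 that[of x3] by auto
  qed
  have in3: "x3 \<in> X s k" "y3 \<in> X s l" using x3 y3 by auto
  have x3y: "col x3 y \<noteq> i" using colm[OF y x x1(1) in3(1)] x3 xy x1y by auto
  have x3y1: "col x3 y1 \<noteq> i" using colm[OF y1(1) x x2(1) in3(1)] x3 y1 x2y1 by auto
  have x2y: "col x2 y \<noteq> i" using colm[OF y x x1(1) x2(1)] x3 xy x1y by auto
  have two: "\<exists>p\<in>X s l. \<exists>q\<in>X s l. p \<noteq> q \<and> col u p = i \<and> col u q = i" if u: "u \<in> X s k" for u
  proof -
    obtain p where p: "p \<in> X s l" "col u p = i" using second_point[OF x u y] xy by metis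
    then show ?thesis using bip_partner[OF b u p(1)] by metis
  qed
  have x3': "col x3 y2 = i" "col x3 y3 = i" using two[OF in3(1)] x3y x3y1 y3 by auto
  have "col x2 y2 \<noteq> i" using colm[OF y2(1) x1(1) in3(1) x2(1)] x3 x3' y2 by auto
  then have "col x2 y3 = i" using two[OF x2(1)] x2y y3 by auto
  then have "frame s k l i x x1 x2 x3 y y1 y2 y3"
    unfolding frame_def using x3 y3 xy y1 x1y y2 x2y1 x3' by blast
  then show ?thesis unfolding i_def by blast
qed

text \<open>Both cycles are unrolled from edges of the same colour and identified along the way;
  non-edges then agree too, since a single other colour is available.\<close>

lemma piso_pair:
  assumes c: "c8 k l" and kl: "k \<noteq> l" and x: "x \<in> X False k" and y: "y \<in> X False l"
    and x': "x' \<in> X True k" and y': "y' \<in> X True l" and eq: "col x y = col x' y'"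
  shows "\<exists>\<psi>. piso {k, l} \<psi> \<and> \<psi> x = x' \<and> \<psi> y = y'"
proof -
  have b: "bip k l" using c by (simp add: c8_def)
  obtain x1 x2 x3 y1 y2 y3 where f: "frame False k l (col x y) x x1 x2 x3 y y1 y2 y3"
    using frame_ex[OF c x y] by blast
  obtain x1' x2' x3' y1' y2' y3' where f': "frame True k l (col x y) x' x1' x2' x3' y' y1' y2' y3'"
    using frame_ex[OF c x' y'] eq by auto
  define i where "i = col x y"
  note F = f[unfolded frame_def, folded i_def] and F' = f'[unfolded frame_def, folded i_def]
  have inx: "x \<in> X False k" "x1 \<in> X False k" "x2 \<in> X False k" "x3 \<in> X False k"
    "y \<in> X False l" "y1 \<in> X False l" "y2 \<in> X False l" "y3 \<in> X False l" using F by blast+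
  have inx': "x' \<in> X True k" "x1' \<in> X True k" "x2' \<in> X True k" "x3' \<in> X True k"
    "y' \<in> X True l" "y1' \<in> X True l" "y2' \<in> X True l" "y3' \<in> X True l" using F' by blast+
  have xy: "col x y = i" by (simp add: i_def)
  have eqT: "col y x = col y' x'" using eq col_swap_iff[OF x y x' y'] by simp
  note g = frame_swap[OF f] and g' = frame_swap[OF f', folded eqT]
  note xx = frame_col[OF b f f'] and yy = frame_col[OF bip_sym[OF b] g g']
  have non: "col u v \<noteq> i" if "u \<in> X s k" "v \<in> X s l" "p \<in> X s l" "q \<in> X s l" "p \<noteq> q" "p \<noteq> v" "q \<noteq> v"
    "col u p = i" "col u q = i" for u p q v s
    using bip_two[OF b that(1,3,4,2,5-7)] that(8,9) by auto
  have n: "col x y2 \<noteq> i" "col x y3 \<noteq> i" "col x1 y1 \<noteq> i" "col x1 y3 \<noteq> i"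
    "col x2 y \<noteq> i" "col x2 y2 \<noteq> i" "col x3 y \<noteq> i" "col x3 y1 \<noteq> i"
    using F xy non[OF inx(1,7,5,6)] non[OF inx(1,8,5,6)] non[OF inx(2,6,5,7)] non[OF inx(2,8,5,7)]
      non[OF inx(3,5,6,8)] non[OF inx(3,7,6,8)] non[OF inx(4,5,7,8)] non[OF inx(4,6,7,8)] by auto
  have n': "col x' y2' \<noteq> i" "col x' y3' \<noteq> i" "col x1' y1' \<noteq> i" "col x1' y3' \<noteq> i"
    "col x2' y' \<noteq> i" "col x2' y2' \<noteq> i" "col x3' y' \<noteq> i" "col x3' y1' \<noteq> i"
    using F' non[OF inx'(1,7,5,6)] non[OF inx'(1,8,5,6)] non[OF inx'(2,6,5,7)] non[OF inx'(2,8,5,7)]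
      non[OF inx'(3,5,6,8)] non[OF inx'(3,7,6,8)] non[OF inx'(4,5,7,8)] non[OF inx'(4,6,7,8)] by auto
  have same: "col u v = col u' v'" if h: "u \<in> X False k" "v \<in> X False l" "u' \<in> X True k" "v' \<in> X True l"
    "col u v \<noteq> i" "col u' v' \<noteq> i" for u v u' v'
    using bip_three[OF b x y h(1-4)] h(5,6) unfolding i_def by simp
  have disj: "u \<noteq> v" if "u \<in> X False k" "v \<in> X False l" for u v using that kl X_disj by blast
  have dist: "distinct [x, x1, x2, x3, y, y1, y2, y3]"
    using F disj[OF inx(1) inx(5)] disj[OF inx(1) inx(6)] disj[OF inx(1) inx(7)] disj[OF inx(1) inx(8)]
      disj[OF inx(2) inx(5)] disj[OF inx(2) inx(6)] disj[OF inx(2) inx(7)] disj[OF inx(2) inx(8)]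
      disj[OF inx(3) inx(5)] disj[OF inx(3) inx(6)] disj[OF inx(3) inx(7)] disj[OF inx(3) inx(8)]
      disj[OF inx(4) inx(5)] disj[OF inx(4) inx(6)] disj[OF inx(4) inx(7)] disj[OF inx(4) inx(8)] by simp
  define \<psi> where "\<psi> u = (if u = x then x' else if u = x1 then x1' else if u = x2 then x2'
    else if u = x3 then x3' else if u = y then y' else if u = y1 then y1' else if u = y2 then y2' else y3')" for u
  have px: "\<psi> x = x'" "\<psi> x1 = x1'" "\<psi> x2 = x2'" "\<psi> x3 = x3'" using dist by (auto simp: \<psi>_def)
  have py: "\<psi> y = y'" "\<psi> y1 = y1'" "\<psi> y2 = y2'" "\<psi> y3 = y3'" using dist by (auto simp: \<psi>_def)
  have Xk: "X False k = {x, x1, x2, x3}" "X True k = {x', x1', x2', x3'}"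
    and Xl: "X False l = {y, y1, y2, y3}" "X True l = {y', y1', y2', y3'}" using F F' by simp_all
  have mem: "\<psi> u \<in> X True k" if "u \<in> X False k" for u using that px inx' Xk by auto
  have mem': "\<psi> u \<in> X True l" if "u \<in> X False l" for u using that py inx' Xl by auto
  have kk: "col (\<psi> u) (\<psi> v) = col u v" if h: "u \<in> X False k" "v \<in> X False k" for u v
  proof -
    have "col p p = k" if "p \<in> X s k" for p s using that by (simp add: X_iff)
    then have d: "col x x = k" "col x1 x1 = k" "col x2 x2 = k" "col x3 x3 = k"
      "col x' x' = k" "col x1' x1' = k" "col x2' x2' = k" "col x3' x3' = k" using inx inx' by blast+
    have t: "col x1 x = col x1' x'" "col x2 x = col x2' x'" "col x3 x = col x3' x'"
      "col x2 x1 = col x2' x1'" "col x3 x1 = col x3' x1'" "col x3 x2 = col x3' x2'"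
      using xx col_swap_iff[OF inx(1,2) inx'(1,2)]
        col_swap_iff[OF inx(1,3) inx'(1,3)]
        col_swap_iff[OF inx(1,4) inx'(1,4)]
        col_swap_iff[OF inx(2,3) inx'(2,3)]
        col_swap_iff[OF inx(2,4) inx'(2,4)]
        col_swap_iff[OF inx(3,4) inx'(3,4)] by simp_all
    have "u = x \<or> u = x1 \<or> u = x2 \<or> u = x3" "v = x \<or> v = x1 \<or> v = x2 \<or> v = x3" using h Xk by auto
    then show ?thesis by (elim disjE) (simp_all add: px d t xx)
  qed
  have ll: "col (\<psi> u) (\<psi> v) = col u v" if h: "u \<in> X False l" "v \<in> X False l" for u v
  proof -
    have "col p p = l" if "p \<in> X s l" for p s using that by (simp add: X_iff)
    then have d: "col y y = l" "col y1 y1 = l" "col y2 y2 = l" "col y3 y3 = l"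
      "col y' y' = l" "col y1' y1' = l" "col y2' y2' = l" "col y3' y3' = l" using inx inx' by blast+
    have t: "col y1 y = col y1' y'" "col y2 y = col y2' y'" "col y3 y = col y3' y'"
      "col y2 y1 = col y2' y1'" "col y3 y1 = col y3' y1'" "col y3 y2 = col y3' y2'"
      using yy col_swap_iff[OF inx(5,6) inx'(5,6)]
        col_swap_iff[OF inx(5,7) inx'(5,7)]
        col_swap_iff[OF inx(5,8) inx'(5,8)]
        col_swap_iff[OF inx(6,7) inx'(6,7)]
        col_swap_iff[OF inx(6,8) inx'(6,8)]
        col_swap_iff[OF inx(7,8) inx'(7,8)] by simp_all
    have "u = y \<or> u = y1 \<or> u = y2 \<or> u = y3" "v = y \<or> v = y1 \<or> v = y2 \<or> v = y3" using h Xl by auto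
    then show ?thesis by (elim disjE) (simp_all add: py d t yy)
  qed
  have kl': "col (\<psi> u) (\<psi> v) = col u v" if h: "u \<in> X False k" "v \<in> X False l" for u v
  proof -
    have e: "col (\<psi> u) (\<psi> v) = i \<longleftrightarrow> col u v = i"
    proof -
      have u: "u = x \<or> u = x1 \<or> u = x2 \<or> u = x3" "v = y \<or> v = y1 \<or> v = y2 \<or> v = y3" using h Xk Xl by auto
      from u(1) show ?thesis
        using u(2) n n' F F' xy by (elim disjE) (simp_all add: px py)
    qed
    show ?thesis
    proof (cases "col u v = i")
      case True then show ?thesis using e by simp
    next
      case False then show ?thesis using e same[OF h mem[OF h(1)] mem'[OF h(2)]] by simp
    qed
  qed
  have lk: "col (\<psi> v) (\<psi> u) = col v u" if h: "u \<in> X False k" "v \<in> X False l" for u v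
    using kl'[OF h] col_swap_iff[OF mem[OF h(1)] mem'[OF h(2)] h] by simp
  have "piso {k, l} \<psi>"
    unfolding piso_def using mem mem' kk ll kl' lk by blast
  then show ?thesis using px py by blast
qed

lemma piso_insert2:
  assumes phi: "piso Y \<phi>" and kl: "k \<notin> Y" "l \<notin> Y" "k \<noteq> l" and c: "c8 k l"
    and m: "m1 \<in> Y" "m2 \<in> Y" and T: "Y \<subseteq> T" "k \<in> T" "l \<in> T"
    and cover: "\<And>m. m \<in> Y \<Longrightarrow> Q k m1 m" "\<And>m. m \<in> Y \<Longrightarrow> Q l m2 m"
    and Qk: "\<And>m. m \<in> Y \<Longrightarrow> Q m k k" "\<And>m. m \<in> Y \<Longrightarrow> Q m l l"
  shows "\<exists>\<phi>'. piso (Y \<union> {k, l}) \<phi>'"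
proof -
  obtain x0 y0 z1 z2 where z: "x0 \<in> X False k" "z1 \<in> X False m1" "z2 \<in> X False m2" and y0: "y0 \<in> X False l"
    using X_T T m by (metis all_not_in_conv subset_eq)
  have f: "\<phi> z1 \<in> X True m1" "\<phi> z2 \<in> X True m2" using pisoD(1)[OF phi] m z by auto
  \<comment> \<open>Although \<open>m1\<close> covers \<open>k\<close>, the colour towards
    \<open>z2\<close> is fixed as well: in the next step \<open>y'\<close> is copied over the pair
    \<open>x'\<close>, \<open>\<phi> z2\<close>, which needs the right colour for that.\<close>
  obtain x' where x': "x' \<in> X True k" "col x0 z1 = col x' (\<phi> z1)" "col x0 z2 = col x' (\<phi> z2)"
    using third_point[OF z(2,3) f _ z(1)] pisoD(2)[OF phi m z(2,3)] by metis
  obtain y' where y': "y' \<in> X True l" "col x0 y0 = col x' y'" "col y0 z2 = col y' (\<phi> z2)"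
    using third_point[OF z(1,3) x'(1) f(2) x'(3) y0] by metis
  obtain \<psi> where psi: "piso {k, l} \<psi>" "\<psi> x0 = x'" "\<psi> y0 = y'"
    using piso_pair[OF c kl(3) z(1) y0 x'(1) y'(1,2)] by blast
  have bx: "col (\<psi> x0) (\<phi> v) = col x0 v" if "n \<in> Y" "v \<in> X False n" for n v
    using cross_base[OF phi cover(1)[OF that(1)] m(1) that(1) z(2) that(2) z(1) x'(1)] x' psi(2) by simp
  have "col (\<psi> y0) (\<phi> v) = col y0 v" if "n \<in> Y" "v \<in> X False n" for n v
    using cross_base[OF phi cover(2)[OF that(1)] m(2) that(1) z(3) that(2) y0 y'(1)] y' psi(3) by simp
  note by0 = this
  show ?thesis
  proof (rule piso_combine[OF phi psi(1)])
    show "col (\<psi> x) (\<phi> v) = col x v" if "k' \<in> {k, l}" "n \<in> Y" "x \<in> X False k'" "v \<in> X False n" for k' n x v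
      using that cross_lift[OF phi Qk(1)[OF that(2)] that(2) psi(1) _ z(1) bx[OF that(2)] _ that(4)]
       cross_lift[OF phi Qk(2)[OF that(2)] that(2) psi(1) _ y0 by0[OF that(2)] _ that(4)] by auto
  qed (use kl in auto)
qed

section \<open>Extending partial isomorphisms fiber by fiber\<close>

lemma c8_cover:
  assumes c: "c8 k l" and ind: "\<And>m. m \<in> Y \<Longrightarrow> indep k m \<and> indep m k \<and> indep l m" and Y: "Y \<noteq> {}"
  shows "\<exists>m1\<in>Y. \<forall>m\<in>Y. Q k m1 m" "m \<in> Y \<Longrightarrow> Q m k k"
proof -
  have b: "bip k m" if "m \<in> Y" "\<not> unif k m" for m using ind that by (auto simp: bip_def)
  \<comment> \<open>A non-uniform interspace is preferred, because its splitting is the common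
    matching. If there is none, every fiber covers every other trivially.\<close>
  obtain m1 where "m1 \<in> Y" "(\<exists>m\<in>Y. \<not> unif k m) \<longrightarrow> \<not> unif k m1" using Y by blast
  moreover from this have "Q k m1 m" if "m \<in> Y" for m
    using unif_Q c8_Q[OF c b b, of m1 m] ind that by blast
  ultimately show "\<exists>m1\<in>Y. \<forall>m\<in>Y. Q k m1 m" by blast
  show "Q m k k" if m: "m \<in> Y"
  proof (cases "unif k m")
    case True
    then show ?thesis using unif_Q unif_sym by blast
  next
    case False
    then have "bip k m" using b m by blast
    then show ?thesis using Q_sym c8_Q[OF c] ind[OF m] by blast
  qed
qed

definition antichain :: "'k set \<Rightarrow> bool" where
  "antichain Y \<longleftrightarrow> Y \<subseteq> T \<and> (\<forall>k\<in>Y. \<forall>l\<in>Y. k \<noteq> l \<longrightarrow> indep k l)"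

lemma antichain_sub: "antichain Y \<Longrightarrow> Z \<subseteq> Y \<Longrightarrow> antichain Z"
  unfolding antichain_def by blast

lemma piso_step_c8:
  assumes Y: "antichain Y" and kl: "k \<in> Y" "l \<in> Y" "k \<noteq> l" and c: "c8 k l"
    and phi: "piso (Y - {k, l}) \<phi>"
  shows "\<exists>\<phi>. piso Y \<phi>"
proof (cases "Y = {k, l}")
  case True
  have "k \<in> T" "l \<in> T" using Y kl by (auto simp: antichain_def)
  then obtain x x' y where x: "x \<in> X False k" "x' \<in> X True k" and y: "y \<in> X False l"
    using X_T by (metis all_not_in_conv)
  obtain y' where "y' \<in> X True l" "col x y = col x' y'" using second_point[OF x y] by blast
  then show ?thesis using piso_pair[OF c kl(3) x(1) y x(2)] True by blast
next
  case False
  let ?Y = "Y - {k, l}"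
  have Y': "Y - {k, l} \<noteq> {}" using False kl by blast
  have ind: "indep k m \<and> indep m k \<and> indep l m" "indep l m \<and> indep m l \<and> indep k m" if "m \<in> Y - {k, l}" for m
    using Y kl that by (auto simp: antichain_def)
  obtain m1 where m1: "m1 \<in> ?Y" "\<forall>m\<in>?Y. Q k m1 m" using c8_cover(1)[OF c ind(1) Y'] by blast
  obtain m2 where m2: "m2 \<in> ?Y" "\<forall>m\<in>?Y. Q l m2 m" using c8_cover(1)[OF c8_sym[OF c] ind(2) Y'] by blast
  have T: "?Y \<subseteq> T" "k \<in> T" "l \<in> T" using Y kl by (auto simp: antichain_def)
  have "\<exists>\<phi>. piso (?Y \<union> {k, l}) \<phi>"
    by (rule piso_insert2[OF phi _ _ kl(3) c m1(1) m2(1) T])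
      (use m1 m2 c8_cover(2)[OF c ind(1) Y'] c8_cover(2)[OF c8_sym[OF c] ind(2) Y'] in auto)
  moreover have "?Y \<union> {k, l} = Y" using kl by blast
  ultimately show ?thesis by simp
qed

lemma piso_step:
  assumes Y: "antichain Y" and k: "k \<in> Y" and phi: "piso (Y - {k}) \<phi>"
    and cover: "Y - {k} \<noteq> {} \<Longrightarrow> \<exists>m1\<in>Y - {k}. \<exists>m2\<in>Y - {k}. \<forall>m\<in>Y - {k}. Q k m1 m \<or> Q k m2 m"
    and Qk: "\<And>m. m \<in> Y - {k} \<Longrightarrow> Q m k k"
  shows "\<exists>\<phi>. piso Y \<phi>"
proof (cases "Y = {k}")
  case True
  have "k \<in> T" using Y k by (auto simp: antichain_def)
  then show ?thesis using X_T piso_single True by (metis all_not_in_conv)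
next
  case False
  then obtain m1 m2 where m: "m1 \<in> Y - {k}" "m2 \<in> Y - {k}" "\<And>m. m \<in> Y - {k} \<Longrightarrow> Q k m1 m \<or> Q k m2 m"
    using cover k by blast
  have T: "Y - {k} \<subseteq> T" "k \<in> T" using Y k by (auto simp: antichain_def)
  have "\<exists>\<phi>. piso (insert k (Y - {k})) \<phi>"
    by (rule piso_insert[OF phi _ m(1,2) T m(3) Qk]) auto
  then show ?thesis using k by (simp add: insert_absorb)
qed

definition big :: "'k \<Rightarrow> bool" where "big k \<longleftrightarrow> card (X False k) = 4"

lemma bip_big: "bip k l \<Longrightarrow> k \<in> T \<Longrightarrow> l \<in> T \<Longrightarrow> big l"
  unfolding big_def using bip_card X_T by (metis all_not_in_conv)

lemma no_c8_Q:
  assumes "antichain Y" "k \<in> Y" "l \<in> Y" "k \<noteq> l" "\<not> c8 k l"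
  shows "Q k l l"
  using assms unif_Q by (auto simp: antichain_def c8_def bip_def)

lemma piso_three_big:
  assumes "antichain Y" and "card {k \<in> Y. big k} \<le> 3"
  shows "\<exists>\<phi>. piso Y \<phi>"
  using assms
proof (induction "card Y" arbitrary: Y rule: less_induct)
  case less
  note Y = less.prems(1)
  have finY: "finite Y" using Y finite_T by (auto simp: antichain_def intro: finite_subset)
  have IH: "\<exists>\<phi>. piso Z \<phi>" if "Z \<subset> Y" for Z
  proof (rule less.hyps)
    show "card Z < card Y" using finY that by (rule psubset_card_mono)
    show "antichain Z" using antichain_sub[OF Y] that by blast
    have "card {k \<in> Z. big k} \<le> card {k \<in> Y. big k}" using finY that by (intro card_mono) auto
    then show "card {k \<in> Z. big k} \<le> 3" using less.prems(2) by simp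
  qed
  show ?case
  proof (cases "\<exists>k\<in>Y. \<exists>l\<in>Y. k \<noteq> l \<and> c8 k l")
    case True
    then obtain k l where kl: "k \<in> Y" "l \<in> Y" "k \<noteq> l" "c8 k l" by blast
    obtain \<phi> where "piso (Y - {k, l}) \<phi>" using IH[of "Y - {k, l}"] kl by blast
    then show ?thesis using piso_step_c8[OF Y kl] by blast
  next
    case False
    have QQ: "Q k l l" if "k \<in> Y" "l \<in> Y" "k \<noteq> l" for k l using no_c8_Q[OF Y that] False that by blast
    show ?thesis
    proof (cases "Y = {}")
      case True
      then show ?thesis by (intro exI[of _ id]) (simp add: piso_def)
    next
      case ne: False
      \<comment> \<open>The fiber removed here is the one added last. A fiber of fewer than 4 points
        is uniform towards all others and can always be added; if none is left, there are at most
        three fibers, and the remaining ones serve as the two references.\<close>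
      define k where "k = (if \<exists>k\<in>Y. \<not> big k then SOME k. k \<in> Y \<and> \<not> big k else SOME k. k \<in> Y)"
      have "k \<in> Y \<and> ((\<exists>k\<in>Y. \<not> big k) \<longrightarrow> \<not> big k)"
        unfolding k_def using ne someI_ex[of "\<lambda>k. k \<in> Y \<and> \<not> big k"] someI_ex[of "\<lambda>k. k \<in> Y"] by auto
      then have k: "k \<in> Y" "(\<exists>k\<in>Y. \<not> big k) \<longrightarrow> \<not> big k" by auto
      obtain \<phi> where phi: "piso (Y - {k}) \<phi>" using IH[of "Y - {k}"] k by blast
      show ?thesis
      proof (rule piso_step[OF Y k(1) phi])
        show "Q m k k" if "m \<in> Y - {k}" for m using QQ[of m k] k that by blast
        assume ne': "Y - {k} \<noteq> {}"
        show "\<exists>m1\<in>Y - {k}. \<exists>m2\<in>Y - {k}. \<forall>m\<in>Y - {k}. Q k m1 m \<or> Q k m2 m"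
        proof (cases "big k")
          case False
          have "Q k m1 m" if "m \<in> Y - {k}" for m m1
          proof (rule unif_Q, rule ccontr)
            assume "\<not> unif k m"
            then have "bip k m" using Y k that by (auto simp: antichain_def bip_def)
            then have "big k" using bip_big[OF bip_sym] Y k that by (auto simp: antichain_def)
            then show False using False by simp
          qed
          then show ?thesis using ne' by blast
        next
          case True
          then have "{k \<in> Y. big k} = Y" using k by blast
          then have "card (Y - {k}) \<le> 2" using less.prems(2) k finY by simp
          moreover have "card (Y - {k}) \<noteq> 0" using ne' finY by simp
          ultimately have "card (Y - {k}) = 1 \<or> card (Y - {k}) = 2" by linarith
          then obtain m1 m2 where "Y - {k} = {m1, m2}"
            using card_1_singletonE[of "Y - {k}"] card_2_iff[of "Y - {k}"] by (metis insert_absorb2)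
          then show ?thesis using QQ[of k] k by auto
        qed
      qed
    qed
  qed
qed

text \<open>The obstruction: the other three fibers induce three different perfect matchings on each
  fiber. Seen as involutions, these form a Klein four-group together with the identity.\<close>

definition klein :: bool where
  "klein \<longleftrightarrow> card T = 4 \<and> (\<forall>k\<in>T. \<forall>l\<in>T. k \<noteq> l \<longrightarrow> bip k l \<and> Q k l l) \<and>
     (\<forall>k\<in>T. \<forall>l\<in>T. \<forall>m\<in>T. k \<noteq> l \<and> k \<noteq> m \<and> l \<noteq> m \<longrightarrow> \<not> Q k l m)"

text \<open>Proper parts of \<open>T\<close> are handled by \<open>piso_three_big\<close>, so the
  last step fails whichever fiber comes last. An 8-cycle, a repeated matching or a uniform
  interspace would let it succeed.\<close>

lemma piso_four_big:
  assumes Y: "antichain T" and T4: "card T = 4" and no: "\<nexists>\<phi>. piso T \<phi>"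
  shows klein
proof -
  have sub: "\<exists>\<phi>. piso Z \<phi>" if "Z \<subset> T" for Z
  proof (rule piso_three_big)
    show "antichain Z" using antichain_sub[OF Y] that by blast
    have "card {k \<in> Z. big k} \<le> card Z" using finite_T that by (intro card_mono) (auto intro: finite_subset)
    moreover have "card Z < card T" using finite_T that by (rule psubset_card_mono)
    ultimately show "card {k \<in> Z. big k} \<le> 3" using T4 by simp
  qed
  have nc: "\<not> c8 k l" if "k \<in> T" "l \<in> T" "k \<noteq> l" for k l
    using sub[of "T - {k, l}"] piso_step_c8[OF Y that] no that by blast
  have QQ: "Q k l l" if "k \<in> T" "l \<in> T" "k \<noteq> l" for k l using no_c8_Q[OF Y that] nc that by blast
  have nQ: "\<not> Q k l m" if klm: "k \<in> T" "l \<in> T" "m \<in> T" "k \<noteq> l" "k \<noteq> m" "l \<noteq> m" for k l m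
  proof
    assume Q: "Q k l m"
    have "card (T - {k, l, m}) = 1" using T4 finite_T klm by (subst card_Diff_subset) auto
    then obtain n where n: "T - {k, l, m} = {n}" by (rule card_1_singletonE)
    obtain \<phi> where phi: "piso (T - {k}) \<phi>" using sub[of "T - {k}"] klm by blast
    have Qm: "Q m k k" if "m \<in> T - {k}" for m using QQ[of m k] klm that by auto
    have "\<exists>\<phi>. piso T \<phi>"
    proof (rule piso_step[OF Y klm(1) phi _ Qm])
      have "Q k l v \<or> Q k n v" if "v \<in> T - {k}" for v
      proof -
        have "v = m \<or> v = l \<or> v = n" using that n by blast
        moreover have "Q k l l" "Q k n n" using QQ klm n by blast+
        ultimately show ?thesis using Q by blast
      qed
      moreover have "n \<in> T - {k}" "l \<in> T - {k}" using n klm by auto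
      ultimately show "\<exists>m1\<in>T - {k}. \<exists>m2\<in>T - {k}. \<forall>m\<in>T - {k}. Q k m1 m \<or> Q k m2 m" by blast
    qed
    then show False using no by simp
  qed
  have "bip k l" if kl: "k \<in> T" "l \<in> T" "k \<noteq> l" for k l
  proof -
    have "card (T - {k, l}) = 2" using T4 finite_T kl by (subst card_Diff_subset) auto
    then have "T - {k, l} \<noteq> {}" by (metis card.empty zero_neq_numeral)
    then obtain m where "m \<in> T" "m \<noteq> k" "m \<noteq> l" by blast
    \<comment> \<open>If \<open>k\<close> and \<open>l\<close> were uniform, \<open>Q k m l\<close>
      would hold trivially for any third fiber \<open>m\<close>.\<close>
    then have "\<not> Q k m l" using nQ kl by auto
    then have "\<not> unif k l" using unif_Q by blast
    then show ?thesis using Y kl by (auto simp: antichain_def bip_def)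
  qed
  then show ?thesis unfolding klein_def using T4 QQ nQ by blast
qed

lemma card_side: "card {p \<in> P. sd p = s} = (\<Sum>k\<in>T. card (X s k))"
proof -
  have "{p \<in> P. sd p = s} = (\<Union>k\<in>T. X s k)" by (auto simp: T_def X_def)
  then show ?thesis using finite_T X_disj by (subst card_UN_disjoint[symmetric]) auto
qed

lemma card_sides: "card {p \<in> P. sd p = s} = card {p \<in> P. sd p = s'}"
  unfolding card_side by (rule sum.cong[OF refl card_X])

theorem piso_or_klein:
  assumes "card {p \<in> P. \<not> sd p} \<le> 16"
  shows "(\<exists>\<phi>. piso UNIV \<phi>) \<or> card {p \<in> P. \<not> sd p} = 16 \<and> klein"
proof -
  obtain B where B: "B \<subseteq> T" "dom B"
    "\<And>k l s p q. k \<in> B \<Longrightarrow> l \<in> B \<Longrightarrow> k \<noteq> l \<Longrightarrow> p \<in> X s k \<Longrightarrow> q \<in> X s l \<Longrightarrow> \<not> uniq p q"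
    using ex_dom by metis
  have aB: "antichain B" using B by (simp add: antichain_def indep_def)
  show ?thesis
  proof (cases "\<exists>\<phi>. piso B \<phi>")
    case True
    then show ?thesis using piso_extend_all[OF B(2)] by blast
  next
    case False
    let ?G = "{k \<in> B. big k}"
    have finG: "finite ?G" and GT: "?G \<subseteq> T" using B(1) finite_T by (auto intro: finite_subset)
    have G4: "card ?G \<ge> 4"
    proof (rule ccontr)
      assume "\<not> card ?G \<ge> 4"
      then have "card ?G \<le> 3" by simp
      then show False using piso_three_big[OF aB] False by blast
    qed
    have s: "(\<Sum>k\<in>T. card (X False k)) = (\<Sum>k\<in>?G. card (X False k)) + (\<Sum>k\<in>T - ?G. card (X False k))"
      using sum.subset_diff[OF GT finite_T] by (simp add: add.commute)
    have g: "(\<Sum>k\<in>?G. card (X False k)) = 4 * card ?G" by (simp add: big_def)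
    have cs: "card {p \<in> P. \<not> sd p} = (\<Sum>k\<in>T. card (X False k))" using card_side[of False] by simp
    \<comment> \<open>Four fibers of size 4 exhaust the points, so no fiber remains outside
      \<open>?G\<close>; in particular none has been discarded.\<close>
    have "4 * card ?G \<ge> 16" using G4 by simp
    then have "(\<Sum>k\<in>T - ?G. card (X False k)) = 0" and c16: "card {p \<in> P. \<not> sd p} = 16" and cG: "card ?G = 4"
      using assms s g cs G4 by linarith+
    then have "T - ?G = {}" using finite_T X_T[of _ False] by auto
    then have TG: "T = ?G" using GT by blast
    then have "T = B" using B(1) by blast
    then have klein using piso_four_big aB False cG TG by simp
    then show ?thesis using c16 by blast
  qed
qed

end

section \<open>Coordinates for the obstruction\<close>

type_synonym bool2 = "bool \<times> bool"

definition add2 :: "bool2 \<Rightarrow> bool2 \<Rightarrow> bool2" where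
  "add2 v w = (fst v \<noteq> fst w, snd v \<noteq> snd w)"

definition dot2 :: "bool2 \<Rightarrow> bool2 \<Rightarrow> bool" where
  "dot2 v w \<longleftrightarrow> (fst v \<and> fst w) \<noteq> (snd v \<and> snd w)"

text \<open>A point is a fiber \<open>i\<close> and an element \<open>e\<close> of it, both in \<open>bool \<times> bool = F\<^sub>2\<^sup>2\<close>; the parameter \<open>\<epsilon>\<close> exchanges the
  two relations between selected pairs of fibers.\<close>

definition k4_color :: "(bool2 \<Rightarrow> bool2 \<Rightarrow> bool) \<Rightarrow> bool2 \<times> bool2 \<Rightarrow> bool2 \<times> bool2 \<Rightarrow> bool2 \<times> bool2 \<times> bool2" where
  "k4_color \<epsilon> p q = (fst p, fst q, if fst p = fst q then add2 (snd p) (snd q)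
     else (dot2 (add2 (fst p) (fst q)) (add2 (snd p) (snd q)) \<noteq> \<epsilon> (fst p) (fst q), False))"

lemma dot2_add2: "dot2 w (add2 v v') \<longleftrightarrow> dot2 w v \<noteq> dot2 w v'"
  by (auto simp: dot2_def add2_def)

lemma dot2_ext:
  assumes "\<And>w. w \<noteq> (False, False) \<Longrightarrow> dot2 w v = dot2 w v'"
  shows "v = v'"
  using assms[of "(True, False)"] assms[of "(False, True)"] by (simp add: dot2_def prod_eq_iff)

lemma add2_eq: "add2 a b = (False, False) \<longleftrightarrow> a = b"
  by (auto simp: add2_def prod_eq_iff)

lemma add2_cancel: "add2 a (add2 a b) = b" "add2 a b = c \<longleftrightarrow> b = add2 a c"
  by (auto simp: add2_def prod_eq_iff)

section \<open>The three matchings of a fiber\<close>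

context scheme_pair
begin

definition twin :: "'k \<Rightarrow> 'p \<Rightarrow> 'p \<Rightarrow> bool" where
  "twin l x y \<longleftrightarrow> (\<forall>z\<in>X False l. col x z = col y z)"

context
  assumes K: klein
begin

lemma klein_bip: "k \<in> T \<Longrightarrow> l \<in> T \<Longrightarrow> k \<noteq> l \<Longrightarrow> bip k l"
  and klein_Q: "k \<in> T \<Longrightarrow> l \<in> T \<Longrightarrow> k \<noteq> l \<Longrightarrow> Q k l l"
  and klein_not_Q: "k \<in> T \<Longrightarrow> l \<in> T \<Longrightarrow> m \<in> T \<Longrightarrow> k \<noteq> l \<Longrightarrow> k \<noteq> m \<Longrightarrow> l \<noteq> m \<Longrightarrow> \<not> Q k l m"
  and klein_card: "card T = 4"
  using K by (auto simp: klein_def)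

lemma twin_iff:
  assumes "k \<in> T" "l \<in> T" "k \<noteq> l" "x \<in> X False k" "y \<in> X False k" "z \<in> X False l"
  shows "twin l x y \<longleftrightarrow> col x z = col y z"
  using QD[OF klein_Q[OF assms(1-3)] assms(4,5,6)] assms(6) unfolding twin_def by blast

lemma twin_sym: "twin l x y \<longleftrightarrow> twin l y x"
  and twin_trans: "twin l x y \<Longrightarrow> twin l y z \<Longrightarrow> twin l x z"
  and twin_refl: "twin l x x"
  unfolding twin_def by auto

lemma twin_nontrans:
  assumes kl: "k \<in> T" "l \<in> T" "k \<noteq> l" and x: "x \<in> X False k" "y \<in> X False k" "z \<in> X False k"
    and n: "\<not> twin l x y" "\<not> twin l y z"
  shows "twin l x z"
proof -
  obtain u where u: "u \<in> X False l" using X_T[OF kl(2), of False] by blast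
  have "col x u = col z u"
    by (rule bip_three[OF klein_bip[OF kl] x(2) u x(1) u x(3) u])
      (use n twin_iff[OF kl x(1,2) u] twin_iff[OF kl x(2,3) u] in auto)
  then show ?thesis using twin_iff[OF kl x(1,3) u] by simp
qed

text \<open>There are exactly two classes, so being separated by \<open>l\<close> is additive modulo
  2. This is the source of linearity in the coordinates.\<close>

lemma twin_xor:
  assumes "k \<in> T" "l \<in> T" "k \<noteq> l" "x \<in> X False k" "y \<in> X False k" "z \<in> X False k"
  shows "twin l y z \<longleftrightarrow> (twin l x y \<longleftrightarrow> twin l x z)"
  using twin_nontrans[OF assms(1-3), of y x z] twin_trans[of l] twin_sym[of l] assms by blast

lemma twin_unique:
  assumes kl: "k \<in> T" "l \<in> T" "k \<noteq> l" and x: "x \<in> X False k" "y \<in> X False k" "z \<in> X False k"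
    and t: "twin l x y" "twin l x z" "y \<noteq> x" "z \<noteq> x"
  shows "y = z"
proof -
  obtain u where u: "u \<in> X False l" using X_T[OF kl(2), of False] by blast
  show ?thesis using bip_two'[OF klein_bip[OF kl] u x(1,2,3)] t twin_iff[OF kl x(1,2) u] twin_iff[OF kl x(1,3) u] by auto
qed

lemma twin_ex:
  assumes kl: "k \<in> T" "l \<in> T" "k \<noteq> l" and x: "x \<in> X False k"
  shows "\<exists>y\<in>X False k. y \<noteq> x \<and> twin l x y"
proof -
  obtain u where u: "u \<in> X False l" using X_T[OF kl(2), of False] by blast
  obtain y where y: "y \<in> X False k" "y \<noteq> x" "col u y = col u x"
    using bip_partner[OF bip_sym[OF klein_bip[OF kl]] u x] .
  then have "col x u = col y u" using col_swap_iff[OF x u y(1) u] by simp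
  then show ?thesis using twin_iff[OF kl x y(1) u] y by blast
qed

lemma twin_col:
  assumes "x \<in> X False k" "y \<in> X False k" "x' \<in> X False k" "y' \<in> X False k" "col x y = col x' y'" "twin l x y"
  shows "twin l x' y'"
  using twins_transfer[OF assms(1-5), of l] assms(6) unfolding twin_def by blast

lemma twin_col_iff:
  assumes "x \<in> X False k" "y \<in> X False k" "x' \<in> X False k" "y' \<in> X False k" "col x y = col x' y'"
  shows "twin l x y \<longleftrightarrow> twin l x' y'"
  using twin_col[OF assms] twin_col[OF assms(3,4,1,2) assms(5)[symmetric]] by blast

text \<open>Copying preserves being matched, and the matched partner of \<open>x'\<close> is unique;
  so the copy of \<open>y\<close> over \<open>x'\<close> is \<open>y'\<close>.\<close>

lemma twin_col_eq:
  assumes kl: "k \<in> T" "l \<in> T" "k \<noteq> l"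
    and x: "x \<in> X False k" "y \<in> X False k" "x' \<in> X False k" "y' \<in> X False k"
    and t: "twin l x y" "twin l x' y'" "x \<noteq> y" "x' \<noteq> y'"
  shows "col x y = col x' y'"
proof -
  obtain w where w: "w \<in> X False k" "col x y = col x' w" using second_point[OF x(1,3,2)] by blast
  have "w \<noteq> x'" using diag_X[OF x(1,2,3)] w t by auto
  moreover have "twin l x' w" using twin_col[OF x(1,2,3) w t(1)] .
  ultimately have "w = y'" using twin_unique[OF kl x(3) w(1) x(4)] t by auto
  then show ?thesis using w by simp
qed

text \<open>A common edge of two matchings could be copied to every point of the fiber, and the
  matchings would coincide, against \<open>klein\<close>.\<close>

lemma twin_two:
  assumes k: "k \<in> T" "l \<in> T" "m \<in> T" "k \<noteq> l" "k \<noteq> m" "l \<noteq> m"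
    and x: "x \<in> X False k" "y \<in> X False k" and t: "twin l x y" "twin m x y"
  shows "x = y"
proof (rule ccontr)
  assume ne: "x \<noteq> y"
  have "Q k l m"
    unfolding Q_def
  proof (intro allI ballI impI)
    fix s x1 x2 z z'
    assume h: "x1 \<in> X s k" "x2 \<in> X s k" "z \<in> X s l" "z' \<in> X s m" "col x1 z = col x2 z"
    show "col x1 z' = col x2 z'"
    proof (cases "x1 = x2")
      case False
      obtain w where w: "w \<in> X s k" "col x y = col x1 w" using second_point[OF x(1) h(1) x(2)] by blast
      have wx: "w \<noteq> x1" using diag_X[OF x h(1)] w ne by auto
      have a: "col x1 z = col w z"
        using twins_transfer[OF x h(1) w(1,2) _ h(3)] t(1) unfolding twin_def by blast
      have b: "col x1 z' = col w z'"
        using twins_transfer[OF x h(1) w(1,2) _ h(4)] t(2) unfolding twin_def by blast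
      have "w = x2" using bip_two'[OF klein_bip[OF k(1,2,4)] h(3,1,2) w(1)] False wx a h(5) by auto
      then show ?thesis using b by simp
    qed simp
  qed
  then show False using klein_not_Q k by blast
qed

text \<open>Three edge-disjoint perfect matchings of four points contain each pair exactly once. So
  of the three conditions exactly one holds if \<open>x\<close> and \<open>y\<close> differ, and all
  hold if they are equal: an odd number in either case.\<close>

lemma twin_parity:
  assumes T4: "T = {k, l1, l2, l3}" "distinct [k, l1, l2, l3]" and x: "x \<in> X False k" "y \<in> X False k"
  shows "twin l3 x y \<longleftrightarrow> (twin l1 x y \<longleftrightarrow> twin l2 x y)"
proof (cases "x = y")
  case True
  then show ?thesis by (simp add: twin_refl)
next
  case ne: False
  have k: "k \<in> T" "l1 \<in> T" "l2 \<in> T" "l3 \<in> T" "k \<noteq> l1" "k \<noteq> l2" "k \<noteq> l3" "l1 \<noteq> l2" "l1 \<noteq> l3" "l2 \<noteq> l3"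
    using T4 by auto
  obtain p1 where p1: "p1 \<in> X False k" "p1 \<noteq> x" "twin l1 x p1" using twin_ex[OF k(1,2,5) x(1)] by blast
  obtain p2 where p2: "p2 \<in> X False k" "p2 \<noteq> x" "twin l2 x p2" using twin_ex[OF k(1,3,6) x(1)] by blast
  obtain p3 where p3: "p3 \<in> X False k" "p3 \<noteq> x" "twin l3 x p3" using twin_ex[OF k(1,4,7) x(1)] by blast
  have d: "p1 \<noteq> p2" "p1 \<noteq> p3" "p2 \<noteq> p3"
    using twin_two[OF k(1,2,3,5,6,8) x(1) p1(1) p1(3)] twin_two[OF k(1,2,4,5,7,9) x(1) p1(1) p1(3)]
      twin_two[OF k(1,3,4,6,7,10) x(1) p2(1) p2(3)] p1 p2 p3 by auto
  have "{x, p1, p2, p3} = X False k"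
    using x p1 p2 p3 d card_X_le[of False k] by (intro card_seteq) auto
  then have "y \<in> {x, p1, p2, p3}" using x by simp
  then have "y = p1 \<or> y = p2 \<or> y = p3" using ne by auto
  moreover have "twin l1 x y \<longleftrightarrow> y = p1" using twin_unique[OF k(1,2,5) x(1,2) p1(1)] p1 ne by auto
  moreover have "twin l2 x y \<longleftrightarrow> y = p2" using twin_unique[OF k(1,3,6) x(1,2) p2(1)] p2 ne by auto
  moreover have "twin l3 x y \<longleftrightarrow> y = p3" using twin_unique[OF k(1,4,7) x(1,2) p3(1)] p3 ne by auto
  ultimately show ?thesis using d by auto
qed

text \<open>The coordinate \<open>e\<close> of \<open>x\<close> in the fiber \<open>k\<close> records for two of the three matchings whether \<open>x\<close>
  and the base point \<open>b k\<close> are unmatched; \<open>twin_parity\<close> gives the third.\<close>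

theorem klein_coordinates:
  "\<exists>\<rho>. inj_on \<rho> {p \<in> P. \<not> sd p} \<and>
     (\<forall>p\<in>P. \<forall>q\<in>P. \<forall>p'\<in>P. \<forall>q'\<in>P. \<not> sd p \<and> \<not> sd q \<and> \<not> sd p' \<and> \<not> sd q' \<longrightarrow>
       (col p q = col p' q' \<longleftrightarrow> k4_color (\<lambda>_ _. False) (\<rho> p) (\<rho> q) = k4_color (\<lambda>_ _. False) (\<rho> p') (\<rho> q')))"
proof -
  have "card T = card (UNIV :: bool2 set)" using klein_card by (simp add: card_UNIV_bool flip: UNIV_Times_UNIV)
  \<comment> \<open>The labelling of the four fibers by vectors is arbitrary, since
    \<open>klein\<close> is symmetric in them.\<close>
  then obtain \<tau> :: "'k \<Rightarrow> bool2" where tau: "bij_betw \<tau> T UNIV"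
    using finite_same_card_bij[OF finite_T finite_UNIV] by blast
  define \<theta> where "\<theta> = inv_into T \<tau>"
  have th: "\<theta> v \<in> T" "\<tau> (\<theta> v) = v" for v
    using tau unfolding \<theta>_def by (auto simp: bij_betw_def inv_into_into f_inv_into_f)
  have tau_inj: "k = l" if "\<tau> k = \<tau> l" "k \<in> T" "l \<in> T" for k l
    using tau that by (auto simp: bij_betw_def inj_on_def)
  define b where "b k = (SOME x. x \<in> X False k)" for k
  have b: "b k \<in> X False k" if "k \<in> T" for k
    unfolding b_def using X_T[OF that, of False] by (simp add: some_in_eq)
  define e where "e k x = (\<not> twin (\<theta> (add2 (\<tau> k) (True, False))) (b k) x,
    \<not> twin (\<theta> (add2 (\<tau> k) (False, True))) (b k) x)" for k x
  have e: "dot2 (add2 (\<tau> k) (\<tau> l)) (e k x) \<longleftrightarrow> \<not> twin l (b k) x"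
    if kl: "k \<in> T" "l \<in> T" "k \<noteq> l" and x: "x \<in> X False k" for k l x
  proof -
    define l1 l2 l3 where "l1 = \<theta> (add2 (\<tau> k) (True, False))" "l2 = \<theta> (add2 (\<tau> k) (False, True))"
      "l3 = \<theta> (add2 (\<tau> k) (True, True))"
    have t: "\<tau> l1 = add2 (\<tau> k) (True, False)" "\<tau> l2 = add2 (\<tau> k) (False, True)"
      "\<tau> l3 = add2 (\<tau> k) (True, True)" by (simp_all add: l1_l2_l3_def th)
    have lT: "l1 \<in> T" "l2 \<in> T" "l3 \<in> T" by (simp_all add: l1_l2_l3_def th)
    have d: "distinct [k, l1, l2, l3]" using t by (auto simp: add2_def prod_eq_iff)
    have T4: "T = {k, l1, l2, l3}"
      using lT kl d klein_card finite_T by (intro card_seteq[symmetric]) auto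
    \<comment> \<open>The functional of \<open>(True, True)\<close> is the sum of the two that are
      recorded, and the parity law says the same of the matchings.\<close>
    have par: "twin l3 (b k) x \<longleftrightarrow> (twin l1 (b k) x \<longleftrightarrow> twin l2 (b k) x)"
      using twin_parity[OF T4 d b[OF kl(1)] x] .
    have ek: "e k x = (\<not> twin l1 (b k) x, \<not> twin l2 (b k) x)" by (simp add: e_def l1_l2_l3_def)
    have "l = l1 \<or> l = l2 \<or> l = l3" using T4 kl by auto
    then show ?thesis
      by (elim disjE) (auto simp: t add2_cancel(1) ek dot2_def par)
  qed
  have exy: "dot2 (add2 (\<tau> k) (\<tau> l)) (add2 (e k x) (e k y)) \<longleftrightarrow> \<not> twin l x y"
    if kl: "k \<in> T" "l \<in> T" "k \<noteq> l" and x: "x \<in> X False k" "y \<in> X False k" for k l x y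
    using e[OF kl x(1)] e[OF kl x(2)] twin_xor[OF kl b[OF kl(1)] x] by (simp add: dot2_add2)
  have e_eq: "add2 (e k x) (e k y) = add2 (e k x') (e k y') \<longleftrightarrow>
      (\<forall>l\<in>T. l \<noteq> k \<longrightarrow> twin l x y = twin l x' y')"
    if k: "k \<in> T" and x: "x \<in> X False k" "y \<in> X False k" "x' \<in> X False k" "y' \<in> X False k" for k x y x' y'
  proof
    assume "add2 (e k x) (e k y) = add2 (e k x') (e k y')"
    then show "\<forall>l\<in>T. l \<noteq> k \<longrightarrow> twin l x y = twin l x' y'" using exy[OF k] x by metis
  next
    assume h: "\<forall>l\<in>T. l \<noteq> k \<longrightarrow> twin l x y = twin l x' y'"
    show "add2 (e k x) (e k y) = add2 (e k x') (e k y')"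
    proof (rule dot2_ext)
      fix w :: bool2 assume w: "w \<noteq> (False, False)"
      define l where "l = \<theta> (add2 (\<tau> k) w)"
      have l: "l \<in> T" "add2 (\<tau> k) (\<tau> l) = w" by (simp_all add: l_def th add2_cancel)
      have "l \<noteq> k" using l w add2_eq[of "\<tau> k" "\<tau> k"] by auto
      then show "dot2 w (add2 (e k x) (e k y)) = dot2 w (add2 (e k x') (e k y'))"
        using exy[OF k l(1), of x y] exy[OF k l(1), of x' y'] x h l by auto
    qed
  qed
  have other: "\<exists>l m. l \<in> T \<and> m \<in> T \<and> k \<noteq> l \<and> k \<noteq> m \<and> l \<noteq> m" if k: "k \<in> T" for k
  proof -
    have "\<theta> (add2 (\<tau> k) (True, False)) \<noteq> k" "\<theta> (add2 (\<tau> k) (False, True)) \<noteq> k"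
      "\<theta> (add2 (\<tau> k) (True, False)) \<noteq> \<theta> (add2 (\<tau> k) (False, True))"
      using th(2) by (metis add2_eq add2_cancel(2) prod.inject)+
    then show ?thesis using th(1) by metis
  qed
  have twin_all: "x = y" if k: "k \<in> T" and x: "x \<in> X False k" "y \<in> X False k"
    and t: "\<forall>l\<in>T. l \<noteq> k \<longrightarrow> twin l x y" for k x y
    using other[OF k] twin_two[OF k _ _ _ _ _ x] t by metis
  define \<rho> where "\<rho> p = (\<tau> (col p p), e (col p p) p)" for p
  have rho: "\<rho> p = (\<tau> k, e k p)" if "p \<in> X False k" for p k using that by (simp add: \<rho>_def X_iff)
  have inT: "k \<in> T" if "p \<in> X False k" for p k using that X_notT[of k False] by auto
  have "inj_on \<rho> {p \<in> P. \<not> sd p}"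
  proof (rule inj_onI)
    fix p q assume "p \<in> {p \<in> P. \<not> sd p}" "q \<in> {p \<in> P. \<not> sd p}" and eq: "\<rho> p = \<rho> q"
    then have p: "p \<in> X False (col p p)" "q \<in> X False (col q q)" by (auto simp: X_iff)
    then have c: "col q q = col p p" using eq rho tau_inj inT by (metis prod.inject)
    have k: "col p p \<in> T" using inT p by blast
    have "e (col p p) p = e (col p p) q" using eq rho p c by simp
    then have "add2 (e (col p p) p) (e (col p p) q) = add2 (e (col p p) p) (e (col p p) p)" by simp
    then have "\<forall>l\<in>T. l \<noteq> col p p \<longrightarrow> twin l p q"
      using e_eq[OF k p(1) p(2)[unfolded c] p(1) p(1)] twin_refl by blast
    then show "p = q" using twin_all[OF k p(1) p(2)[unfolded c]] by blast
  qed
  moreover have "col p q = col p' q' \<longleftrightarrow> k4_color (\<lambda>_ _. False) (\<rho> p) (\<rho> q) = k4_color (\<lambda>_ _. False) (\<rho> p') (\<rho> q')"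
    if P: "p \<in> P" "q \<in> P" "p' \<in> P" "q' \<in> P" "\<not> sd p" "\<not> sd q" "\<not> sd p'" "\<not> sd q'" for p q p' q'
  proof -
    define k l k' l' where "k = col p p" "l = col q q" "k' = col p' p'" "l' = col q' q'"
    have x: "p \<in> X False k" "q \<in> X False l" "p' \<in> X False k'" "q' \<in> X False l'"
      using P by (auto simp: k_l_k'_l'_def X_iff)
    have kT: "k \<in> T" "l \<in> T" "k' \<in> T" "l' \<in> T" using x inT by blast+
    have r: "\<rho> p = (\<tau> k, e k p)" "\<rho> q = (\<tau> l, e l q)" "\<rho> p' = (\<tau> k', e k' p')" "\<rho> q' = (\<tau> l', e l' q')"
      using x rho by auto
    show ?thesis
    proof (cases "k = k' \<and> l = l'")
      case False
      then have "col p q \<noteq> col p' q'" using type_eq[OF x] by blast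
      moreover have "\<tau> k \<noteq> \<tau> k' \<or> \<tau> l \<noteq> \<tau> l'" using False tau_inj kT by blast
      ultimately show ?thesis by (auto simp: r k4_color_def)
    next
      case True
      then have x': "p' \<in> X False k" "q' \<in> X False l" using x by auto
      show ?thesis
      proof (cases "k = l")
        case kl: True
        have y: "q \<in> X False k" "q' \<in> X False k" using x x' kl by auto
        have "k4_color (\<lambda>_ _. False) (\<rho> p) (\<rho> q) = k4_color (\<lambda>_ _. False) (\<rho> p') (\<rho> q') \<longleftrightarrow>
            (\<forall>m\<in>T. m \<noteq> k \<longrightarrow> twin m p q = twin m p' q')"
          using e_eq[OF kT(1) x(1) y(1) x'(1) y(2)] True kl by (auto simp: k4_color_def r)
        also have "\<dots> \<longleftrightarrow> col p q = col p' q'"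
        proof
          assume "col p q = col p' q'"
          then show "\<forall>m\<in>T. m \<noteq> k \<longrightarrow> twin m p q = twin m p' q'"
            using twin_col_iff[OF x(1) y(1) x'(1) y(2)] by blast
        next
          assume h: "\<forall>m\<in>T. m \<noteq> k \<longrightarrow> twin m p q = twin m p' q'"
          show "col p q = col p' q'"
          proof (cases "p = q \<or> p' = q'")
            case True
            then have "(\<forall>m\<in>T. m \<noteq> k \<longrightarrow> twin m p q) \<and> (\<forall>m\<in>T. m \<noteq> k \<longrightarrow> twin m p' q')"
              using h twin_refl by blast
            then have "p = q" "p' = q'" using twin_all[OF kT(1) x(1) y(1)] twin_all[OF kT(1) x'(1) y(2)] by blast+
            then show ?thesis using x x' by (simp add: X_iff)
          next
            case ne: False
            obtain l1 l2 where l: "l1 \<in> T" "l2 \<in> T" "k \<noteq> l1" "k \<noteq> l2" "l1 \<noteq> l2" using other[OF kT(1)] by blast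
            have "card (T - {k, l1, l2}) = 1" using klein_card finite_T kT l by (subst card_Diff_subset) auto
            then obtain l3 where l3: "T - {k, l1, l2} = {l3}" by (rule card_1_singletonE)
            have T4: "T = {k, l1, l2, l3}" "distinct [k, l1, l2, l3]" using l3 l kT by auto
            \<comment> \<open>Distinct points are matched by some fiber \<open>m\<close>, and all
              pairs matched by the same \<open>m\<close> have one colour.\<close>
            have "\<exists>m\<in>T. m \<noteq> k \<and> twin m p q" using twin_parity[OF T4 x(1) y(1)] T4 by auto
            then obtain m where "m \<in> T" "m \<noteq> k" "twin m p q" "twin m p' q'" using h by blast
            then show ?thesis using twin_col_eq[OF kT(1), of m p q p' q'] x x' y ne by auto
          qed
        qed
        finally show ?thesis by simp
      next
        case kl: False
        have t: "\<tau> k \<noteq> \<tau> l" using kl tau_inj kT by blast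
        have "k4_color (\<lambda>_ _. False) (\<rho> p) (\<rho> q) = k4_color (\<lambda>_ _. False) (\<rho> p') (\<rho> q') \<longleftrightarrow>
            dot2 (add2 (\<tau> k) (\<tau> l)) (add2 (e k p) (e l q)) = dot2 (add2 (\<tau> k) (\<tau> l)) (add2 (e k p') (e l q'))"
          using True t by (simp add: k4_color_def r)
        \<comment> \<open>By bilinearity the comparison separates into a change of the first point
          and a change of the second.\<close>
        also have "\<dots> \<longleftrightarrow> dot2 (add2 (\<tau> k) (\<tau> l)) (add2 (e k p) (e k p')) =
            dot2 (add2 (\<tau> l) (\<tau> k)) (add2 (e l q) (e l q'))"
          by (auto simp: dot2_def add2_def)
        also have "\<dots> \<longleftrightarrow> (twin l p p' \<longleftrightarrow> twin k q q')"
          using exy[OF kT(1,2) kl x(1) x'(1)] exy[OF kT(2,1) _ x(2) x'(2)] kl by auto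
        also have "\<dots> \<longleftrightarrow> col p q = col p' q'"
        proof -
          have a: "twin l p p' \<longleftrightarrow> col p q = col p' q" using twin_iff[OF kT(1,2) kl x(1) x'(1) x(2)] .
          have "twin k q q' \<longleftrightarrow> col q p' = col q' p'" using twin_iff[OF kT(2,1) _ x(2) x'(2) x'(1)] kl by simp
          then have c: "twin k q q' \<longleftrightarrow> col p' q = col p' q'" using col_swap_iff[OF x(2) x'(1) x'(2) x'(1)] by simp
          \<comment> \<open>Only two colours occur between \<open>k\<close> and \<open>l\<close>, so
            two changes of colour in succession cancel.\<close>
          have "col p q = col p' q'" if "col p' q \<noteq> col p q" "col p' q \<noteq> col p' q'"
            using bip_three[OF klein_bip[OF kT(1,2) kl] x'(1) x(2) x(1,2) x'(1,2)] that .
          then show ?thesis using a c by auto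
        qed
        finally show ?thesis by simp
      qed
    qed
  qed
  ultimately show ?thesis by blast
qed

end

end

section \<open>From algebraic isomorphisms to pairs of colourings\<close>

definition rel :: "('a \<times> 'a) set set \<Rightarrow> 'a \<Rightarrow> 'a \<Rightarrow> ('a \<times> 'a) set" where
  "rel C u v = (THE R. R \<in> C \<and> (u, v) \<in> R)"

lemma rel_eq:
  assumes "coherent_configuration V C" "R \<in> C" "(u, v) \<in> R"
  shows "rel C u v = R"
proof -
  have "disjoint C" using assms(1) by (simp add: coherent_configuration_def partition_on_def)
  then have uniq: "S = R" if "S \<in> C \<and> (u, v) \<in> S" for S
    using disjointD[of C S R] assms(2,3) that by blast
  show ?thesis unfolding rel_def by (rule the_equality) (use assms(2,3) in blast, rule uniq)
qed

lemma rel_in: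
  assumes C: "coherent_configuration V C" and "u \<in> V" "v \<in> V"
  shows "rel C u v \<in> C" "(u, v) \<in> rel C u v"
proof -
  have "\<Union>C = V \<times> V" using C by (simp add: coherent_configuration_def partition_on_def)
  then obtain R where "R \<in> C" "(u, v) \<in> R" using assms by (metis UnionE mem_Sigma_iff)
  then show "rel C u v \<in> C" "(u, v) \<in> rel C u v" using rel_eq[OF C] by auto
qed

lemma rel_iff:
  assumes "coherent_configuration V C" "R \<in> C" "u \<in> V" "v \<in> V"
  shows "rel C u v = R \<longleftrightarrow> (u, v) \<in> R"
  using rel_eq[OF assms(1,2)] rel_in[OF assms(1,3,4)] by blast

lemma card_intersection_number:
  assumes C: "coherent_configuration V C" and "R \<in> C" "S \<in> C" "T \<in> C" and uv: "(u, v) \<in> T"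
  shows "card {w. (u, w) \<in> R \<and> (w, v) \<in> S} = intersection_number R S T"
proof -
  obtain n where n: "\<forall>(u, v)\<in>T. card {w. (u, w) \<in> R \<and> (w, v) \<in> S} = n"
    using assms unfolding coherent_configuration_def by blast
  have "intersection_number R S T = n"
    unfolding intersection_number_def
  proof (rule the_equality)
    show "\<forall>(u, v)\<in>T. card {w. (u, w) \<in> R \<and> (w, v) \<in> S} = n" by (rule n)
    show "m = n" if "\<forall>(u, v)\<in>T. card {w. (u, w) \<in> R \<and> (w, v) \<in> S} = m" for m
      using bspec[OF that uv] bspec[OF n uv] by simp
  qed
  then show ?thesis using n uv by auto
qed

lemma coherent_nonempty: "coherent_configuration V C \<Longrightarrow> R \<in> C \<Longrightarrow> R \<noteq> {}"
  by (auto simp: coherent_configuration_def partition_on_def)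

lemma coherent_diag: "coherent_configuration V C \<Longrightarrow> R \<in> C \<Longrightarrow> (x, x) \<in> R \<Longrightarrow> R \<subseteq> Id"
  unfolding coherent_configuration_def by blast

lemma coherent_converse: "coherent_configuration V C \<Longrightarrow> R \<in> C \<Longrightarrow> R\<inverse> \<in> C"
  unfolding coherent_configuration_def by blast

lemma coherent_finite: "coherent_configuration V C \<Longrightarrow> finite V"
  unfolding coherent_configuration_def by blast

lemma coherent_path_finite:
  assumes "coherent_configuration V C" "R \<in> C"
  shows "finite {w. (u, w) \<in> R \<and> (w, v) \<in> S}"
  by (rule finite_subset[OF _ coherent_finite[OF assms(1)]])
    (use coherent_configuration_subset[OF assms] in auto)

lemma rel_converse:
  assumes C: "coherent_configuration V C" and uv: "u \<in> V" "v \<in> V"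
  shows "rel C v u = (rel C u v)\<inverse>"
  using rel_eq[OF C coherent_converse[OF C rel_in(1)[OF C uv]]] rel_in(2)[OF C uv] by blast

section \<open>The two sides of an algebraic isomorphism\<close>

locale algebraic_pair =
  fixes V :: "'a set" and C and V' :: "'b set" and C' and f
  assumes C: "coherent_configuration V C" and C': "coherent_configuration V' C'"
    and f: "algebraic_isomorphism C C' f"
    and fiber_le_4: "max_fiber_size C \<le> 4"
begin

lemma f_in: "R \<in> C \<Longrightarrow> f R \<in> C'"
  and f_inj: "R \<in> C \<Longrightarrow> S \<in> C \<Longrightarrow> f R = f S \<Longrightarrow> R = S"
  and f_surj: "R' \<in> C' \<Longrightarrow> \<exists>R\<in>C. f R = R'"
  and f_int: "R \<in> C \<Longrightarrow> S \<in> C \<Longrightarrow> T \<in> C \<Longrightarrow>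
    intersection_number R S T = intersection_number (f R) (f S) (f T)"
  using f unfolding algebraic_isomorphism_def bij_betw_def inj_on_def by auto

text \<open>The existence of a path is the nonvanishing of an intersection number.\<close>

lemma path_iff:
  assumes R: "R \<in> C" "S \<in> C" "T \<in> C" and uv: "(u, v) \<in> T" "(u', v') \<in> f T"
  shows "(\<exists>w. (u, w) \<in> R \<and> (w, v) \<in> S) \<longleftrightarrow> (\<exists>w. (u', w) \<in> f R \<and> (w, v') \<in> f S)"
proof -
  let ?A = "{w. (u, w) \<in> R \<and> (w, v) \<in> S}" and ?B = "{w. (u', w) \<in> f R \<and> (w, v') \<in> f S}"
  have "card ?A = card ?B"
    using card_intersection_number[OF C R uv(1)] card_intersection_number[OF C' R[THEN f_in] uv(2)]
      f_int[OF R] by simp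
  moreover have "finite ?A" "finite ?B"
    by (rule coherent_path_finite[OF C R(1)], rule coherent_path_finite[OF C' f_in[OF R(1)]])
  ultimately have "?A = {} \<longleftrightarrow> ?B = {}"
    using card_0_eq[of ?A] card_0_eq[of ?B] by argo
  then show ?thesis by blast
qed

text \<open>Only intersection numbers are assumed to be preserved, so loops have to be recognised
  through them. The loop relation at the start of a pair in \<open>f T\<close> composes with
  \<open>f T\<close>; pulled back, its preimage contains a loop of \<open>T\<close> and hence equals
  \<open>T\<close>.\<close>

lemma f_diag:
  assumes T: "T \<in> C" "T \<subseteq> Id"
  shows "f T \<subseteq> Id"
proof -
  obtain a b where ab: "(a, b) \<in> f T" using coherent_nonempty[OF C' f_in[OF T(1)]] by auto
  then have "a \<in> V'" using coherent_configuration_subset[OF C' f_in[OF T(1)]] by blast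
  then have aa: "rel C' a a \<in> C'" "(a, a) \<in> rel C' a a" using rel_in[OF C'] by auto
  obtain D where D: "D \<in> C" "f D = rel C' a a" using f_surj[OF aa(1)] by blast
  obtain x where x: "(x, x) \<in> T" using coherent_nonempty[OF C T(1)] T(2) by auto
  have "\<exists>w. (x, w) \<in> D \<and> (w, x) \<in> T" using path_iff[OF D(1) T(1) T(1) x ab] D aa ab by auto
  then have "(x, x) \<in> D" using T(2) by auto
  then have "D = T" using rel_eq[OF C D(1)] rel_eq[OF C T(1) x] by auto
  then show ?thesis using aa D coherent_diag[OF C' aa(1)] by simp
qed

lemma f_diag_rev:
  assumes T: "T \<in> C" "f T \<subseteq> Id"
  shows "T \<subseteq> Id"
proof -
  obtain u v where uv: "(u, v) \<in> T" using coherent_nonempty[OF C T(1)] by auto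
  then have "u \<in> V" using coherent_configuration_subset[OF C T(1)] by blast
  then have D: "rel C u u \<in> C" "(u, u) \<in> rel C u u" using rel_in[OF C] by auto
  obtain a where a: "(a, a) \<in> f T" using coherent_nonempty[OF C' f_in[OF T(1)]] T(2) by auto
  have "\<exists>w. (a, w) \<in> f (rel C u u) \<and> (w, a) \<in> f T" using path_iff[OF D(1) T(1) T(1) uv a] D uv by auto
  then have "(a, a) \<in> f (rel C u u)" using T(2) by auto
  then have "f (rel C u u) = f T"
    using rel_eq[OF C' f_in[OF D(1)]] rel_eq[OF C' f_in[OF T(1)] a] by auto
  then have "rel C u u = T" using f_inj D(1) T(1) by blast
  then show ?thesis using coherent_diag[OF C T(1)] D(2) by simp
qed

text \<open>The closed walk along \<open>T\<close> and back along \<open>T\<inverse>\<close> over a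
  loop is copied; its second step lies in \<open>f (T\<inverse>)\<close> and reverses a pair of
  \<open>f T\<close>.\<close>

lemma f_converse:
  assumes T: "T \<in> C"
  shows "f (T\<inverse>) = (f T)\<inverse>"
proof -
  obtain u v where uv: "(u, v) \<in> T" using coherent_nonempty[OF C T(1)] by auto
  then have "u \<in> V" using coherent_configuration_subset[OF C T(1)] by blast
  then have D: "rel C u u \<in> C" "(u, u) \<in> rel C u u" using rel_in[OF C] by auto
  have "f (rel C u u) \<subseteq> Id" using f_diag[OF D(1) coherent_diag[OF C D]] .
  then obtain a where a: "(a, a) \<in> f (rel C u u)" using coherent_nonempty[OF C' f_in[OF D(1)]] by auto
  have Ti: "T\<inverse> \<in> C" using coherent_converse[OF C T] .
  obtain w where w: "(a, w) \<in> f T" "(w, a) \<in> f (T\<inverse>)" using path_iff[OF T Ti D(1) D(2) a] uv by auto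
  have "rel C' w a = f (T\<inverse>)" using rel_eq[OF C' f_in[OF Ti] w(2)] .
  moreover have "rel C' w a = (f T)\<inverse>"
    using rel_eq[OF C' coherent_converse[OF C' f_in[OF T]]] w(1) by blast
  ultimately show ?thesis by simp
qed

definition P :: "('a + 'b) set" where "P = Inl ` V \<union> Inr ` V'"

definition sd :: "'a + 'b \<Rightarrow> bool" where "sd p = (case p of Inl _ \<Rightarrow> False | Inr _ \<Rightarrow> True)"

text \<open>Using \<open>f\<close> on the left identifies the relations of both sides. Pairs across
  the sides get \<open>{}\<close>, which is no basis relation.\<close>

fun col :: "'a + 'b \<Rightarrow> 'a + 'b \<Rightarrow> ('b \<times> 'b) set" where
  "col (Inl u) (Inl v) = f (rel C u v)"
| "col (Inr u) (Inr v) = rel C' u v"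
| "col _ _ = {}"

text \<open>The law \<open>count\<close> ranges over all values of the colour type. A set that is no
  basis relation is the colour of no pair on one side, so its count is 0.\<close>

definition nn :: "('b \<times> 'b) set \<Rightarrow> ('b \<times> 'b) set \<Rightarrow> ('b \<times> 'b) set \<Rightarrow> nat" where
  "nn R S T = (if R \<in> C' \<and> S \<in> C' then intersection_number R S T else 0)"

lemma same_side_cases:
  assumes "p \<in> P" "q \<in> P" "sd p = sd q"
  obtains u v where "p = Inl u" "q = Inl v" "u \<in> V" "v \<in> V"
  | u v where "p = Inr u" "q = Inr v" "u \<in> V'" "v \<in> V'"
  using assms unfolding P_def sd_def by auto

lemma col_in: "p \<in> P \<Longrightarrow> q \<in> P \<Longrightarrow> sd p = sd q \<Longrightarrow> col p q \<in> C'"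
  by (erule same_side_cases) (use f_in rel_in[OF C] rel_in[OF C'] in auto)

lemma f_rel_iff: "R \<in> C \<Longrightarrow> u \<in> V \<Longrightarrow> v \<in> V \<Longrightarrow> f (rel C u v) = f R \<longleftrightarrow> (u, v) \<in> R"
  using rel_iff[OF C] f_inj rel_in[OF C] by metis

lemma col_count:
  assumes p: "p \<in> P" "q \<in> P" "sd p = sd q"
  shows "card {w \<in> P. sd w = sd p \<and> col p w = i \<and> col w q = j} = nn i j (col p q)"
proof (cases "i \<in> C' \<and> j \<in> C'")
  case False
  then have "{w \<in> P. sd w = sd p \<and> col p w = i \<and> col w q = j} = {}"
    using col_in[OF p(1)] col_in[OF _ p(2)] p(3) by fastforce
  then have "card {w \<in> P. sd w = sd p \<and> col p w = i \<and> col w q = j} = 0" by (simp only: card.empty)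
  then show ?thesis using False by (simp only: nn_def if_False)
next
  case ij: True
  from p show ?thesis
  proof (cases rule: same_side_cases)
    case (1 u v)
    obtain R S where RS: "R \<in> C" "f R = i" "S \<in> C" "f S = j" using f_surj ij by metis
    have T: "rel C u v \<in> C" "(u, v) \<in> rel C u v" using rel_in[OF C 1(3,4)] by auto
    have "{w \<in> P. sd w = sd p \<and> col p w = i \<and> col w q = j} = Inl ` {w. (u, w) \<in> R \<and> (w, v) \<in> S}"
    proof -
      have "w \<in> V \<and> f (rel C u w) = i \<and> f (rel C w v) = j \<longleftrightarrow> (u, w) \<in> R \<and> (w, v) \<in> S" for w
        using coherent_configuration_subset[OF C RS(1)] f_rel_iff[OF RS(1) 1(3), of w]
          f_rel_iff[OF RS(3) _ 1(4), of w] RS(2,4) by blast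
      then have "{w. (u, w) \<in> R \<and> (w, v) \<in> S} = {w \<in> V. f (rel C u w) = i \<and> f (rel C w v) = j}" by simp
      then show ?thesis by (auto simp: 1 P_def sd_def)
    qed
    then have "card {w \<in> P. sd w = sd p \<and> col p w = i \<and> col w q = j} = intersection_number R S (rel C u v)"
      using card_intersection_number[OF C RS(1,3) T] by (simp add: card_image)
    then show ?thesis using f_int[OF RS(1,3) T(1)] ij RS by (simp add: nn_def 1)
  next
    case (2 u v)
    have T: "rel C' u v \<in> C'" "(u, v) \<in> rel C' u v" using rel_in[OF C' 2(3,4)] by auto
    have ij': "i \<in> C'" "j \<in> C'" using ij by auto
    have "{w \<in> P. sd w = sd p \<and> col p w = i \<and> col w q = j} = Inr ` {w. (u, w) \<in> i \<and> (w, v) \<in> j}"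
    proof -
      have "w \<in> V' \<and> rel C' u w = i \<and> rel C' w v = j \<longleftrightarrow> (u, w) \<in> i \<and> (w, v) \<in> j" for w
        using coherent_configuration_subset[OF C' ij'(1)] rel_iff[OF C' ij'(1) 2(3), of w]
          rel_iff[OF C' ij'(2) _ 2(4), of w] by blast
      then have "{w. (u, w) \<in> i \<and> (w, v) \<in> j} = {w \<in> V'. rel C' u w = i \<and> rel C' w v = j}" by simp
      then show ?thesis by (auto simp: 2 P_def sd_def)
    qed
    then have "card {w \<in> P. sd w = sd p \<and> col p w = i \<and> col w q = j} = intersection_number i j (rel C' u v)"
      using card_intersection_number[OF C' ij' T] by (simp add: card_image)
    then show ?thesis using ij by (simp add: nn_def 2)
  qed
qed

lemma col_diag_iff:
  assumes "p \<in> P" "q \<in> P" "sd p = sd q"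
  shows "col p q \<subseteq> Id \<longleftrightarrow> p = q"
  using assms
proof (cases rule: same_side_cases)
  case (1 u v)
  have T: "rel C u v \<in> C" "(u, v) \<in> rel C u v" using rel_in[OF C 1(3,4)] by auto
  have "f (rel C u v) \<subseteq> Id \<longleftrightarrow> rel C u v \<subseteq> Id" using f_diag f_diag_rev T(1) by blast
  also have "\<dots> \<longleftrightarrow> u = v" using T coherent_diag[OF C T(1)] by auto
  finally show ?thesis by (simp add: 1)
next
  case (2 u v)
  have T: "rel C' u v \<in> C'" "(u, v) \<in> rel C' u v" using rel_in[OF C' 2(3,4)] by auto
  have "rel C' u v \<subseteq> Id \<longleftrightarrow> u = v" using T coherent_diag[OF C' T(1)] by auto
  then show ?thesis by (simp add: 2)
qed

lemma col_converse:
  assumes "p \<in> P" "q \<in> P" "sd p = sd q"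
  shows "col q p = (col p q)\<inverse>"
  using assms
proof (cases rule: same_side_cases)
  case (1 u v)
  then show ?thesis using rel_converse[OF C 1(3,4)] f_converse rel_in[OF C 1(3,4)] by simp
next
  case (2 u v)
  then show ?thesis using rel_converse[OF C' 2(3,4)] by simp
qed

lemma card_fiber_le:
  assumes "u \<in> V"
  shows "card {w \<in> V. rel C w w = rel C u u} \<le> 4"
proof -
  let ?X = "{w \<in> V. rel C w w = rel C u u}"
  have T: "rel C u u \<in> C" "(u, u) \<in> rel C u u" using rel_in[OF C assms assms] by auto
  have "(a, b) \<in> rel C u u \<longleftrightarrow> a = b \<and> a \<in> V \<and> rel C a a = rel C u u" for a b
    using coherent_diag[OF C T] coherent_configuration_subset[OF C T(1)] rel_iff[OF C T(1), of a a] by blast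
  then have "Id_on ?X = rel C u u" by (intro set_eqI) auto
  then have "?X \<in> fibers C" using T(1) by (simp add: fibers_def)
  moreover have "Y \<subseteq> V" if "Y \<in> fibers C" for Y
    using coherent_configuration_subset[OF C] that by (auto simp: fibers_def)
  then have "fibers C \<subseteq> Pow V" by blast
  then have "finite (fibers C)" using coherent_finite[OF C] finite_subset by blast
  ultimately have "card ?X \<le> max_fiber_size C"
    unfolding max_fiber_size_def by (intro cSUP_upper) auto
  then show ?thesis using fiber_le_4 by simp
qed

lemma scheme_pair: "scheme_pair P sd col nn"
proof
  show "finite P" using C C' by (simp add: P_def coherent_finite)
  show "card {w \<in> P. sd w = sd p \<and> col p w = i \<and> col w q = j} = nn i j (col p q)"
    if "p \<in> P" "q \<in> P" "sd p = sd q" for p q i j using col_count[OF that] .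
  show "p = q" if "p \<in> P" "q \<in> P" "w \<in> P" "sd p = sd q" "col p q = col w w" for p q w
    using col_diag_iff[of p q] col_diag_iff[of w w] that by simp
  show "col q p = col q' p'"
    if "p \<in> P" "q \<in> P" "p' \<in> P" "q' \<in> P" "sd p = sd q" "sd p' = sd q'" "col p q = col p' q'" for p q p' q'
    using col_converse[of p q] col_converse[of p' q'] that by simp
  show "\<exists>p'\<in>P. sd p' = s \<and> col p' p' = col p p" if p: "p \<in> P" for p s
  proof -
    have in1: "col p p \<in> C'" "col p p \<subseteq> Id" using col_in col_diag_iff p by auto
    show ?thesis
    proof (cases s)
      case True
      obtain a where a: "(a, a) \<in> col p p" using coherent_nonempty[OF C' in1(1)] in1(2) by auto
      then have "a \<in> V'" using coherent_configuration_subset[OF C' in1(1)] by blast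
      moreover have "rel C' a a = col p p" using rel_eq[OF C' in1(1) a] .
      ultimately show ?thesis using True by (intro bexI[of _ "Inr a"]) (auto simp: P_def sd_def)
    next
      case False
      obtain D where D: "D \<in> C" "f D = col p p" using f_surj[OF in1(1)] by blast
      have "D \<subseteq> Id" using f_diag_rev D in1 by simp
      then obtain a where a: "(a, a) \<in> D" using coherent_nonempty[OF C D(1)] by auto
      then have "a \<in> V" using coherent_configuration_subset[OF C D(1)] by blast
      moreover have "rel C a a = D" using rel_eq[OF C D(1) a] .
      ultimately show ?thesis using False D by (intro bexI[of _ "Inl a"]) (auto simp: P_def sd_def)
    qed
  qed
  show "card {q \<in> P. \<not> sd q \<and> col q q = col p p} \<le> 4" if p: "p \<in> P" "\<not> sd p" for p
  proof -
    obtain u where u: "p = Inl u" "u \<in> V" using p by (auto simp: P_def sd_def)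
    have "rel C v v = rel C u u \<longleftrightarrow> f (rel C v v) = f (rel C u u)" if "v \<in> V" for v
      using f_inj[OF rel_in(1)[OF C that that] rel_in(1)[OF C u(2) u(2)]] by auto
    then have "{q \<in> P. \<not> sd q \<and> col q q = col p p} = Inl ` {w \<in> V. rel C w w = rel C u u}"
      by (auto simp: P_def sd_def u)
    then show ?thesis using card_fiber_le[OF u(2)] by (simp add: card_image)
  qed
qed

sublocale scheme_pair P sd col nn by (rule scheme_pair)

lemma side: "{p \<in> P. \<not> sd p} = Inl ` V" "{p \<in> P. sd p} = Inr ` V'"
  by (auto simp: P_def sd_def)

lemma induced_if_piso:
  assumes phi: "piso UNIV \<phi>"
  shows "\<exists>\<psi>. combinatorial_isomorphism V C V' C' \<psi> \<and> (\<forall>R\<in>C. f R = map_prod \<psi> \<psi> ` R)"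
proof -
  have inX: "Inl u \<in> X False (col (Inl u) (Inl u))" if "u \<in> V" for u
  proof -
    have "Inl u \<in> P" "sd (Inl u) = False" using that by (auto simp: P_def sd_def)
    then show ?thesis unfolding X_iff by (intro conjI refl)
  qed
  have "\<exists>a. a \<in> V' \<and> \<phi> (Inl u) = Inr a" if "u \<in> V" for u
    using pisoD(1)[OF phi UNIV_I inX[OF that]] unfolding X_iff by (auto simp: P_def sd_def)
  then obtain \<psi> where psi: "\<psi> u \<in> V'" "\<phi> (Inl u) = Inr (\<psi> u)" if "u \<in> V" for u by metis
  have eq: "rel C' (\<psi> u) (\<psi> v) = f (rel C u v)" if "u \<in> V" "v \<in> V" for u v
    using pisoD(2)[OF phi UNIV_I UNIV_I inX[OF that(1)] inX[OF that(2)]] psi that by simp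
  have "inj_on \<psi> V"
  proof (rule inj_onI)
    fix u v assume uv: "u \<in> V" "v \<in> V" "\<psi> u = \<psi> v"
    have "col (Inl u) (Inl v) = col (Inr (\<psi> u)) (Inr (\<psi> u))"
      using eq[OF uv(1,2)] by (simp only: col.simps uv(3))
    moreover have "Inl u \<in> P" "Inl v \<in> P" "Inr (\<psi> u) \<in> P" using uv(1,2) psi(1)[OF uv(1)] by (simp_all add: P_def)
    ultimately have "(Inl u :: 'a + 'b) = Inl v" using diag[of "Inl u" "Inl v" "Inr (\<psi> u)"] by (simp add: sd_def)
    then show "u = v" by simp
  qed
  \<comment> \<open>Surjectivity follows by counting, as corresponding fibers have equal
    size.\<close>
  moreover have "card V = card V'" using card_sides[of False True] side by (simp add: card_image)
  ultimately have bij: "bij_betw \<psi> V V'"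
    using psi(1) coherent_finite[OF C'] card_image[of \<psi> V] card_subset_eq[of V' "\<psi> ` V"]
    by (auto simp: bij_betw_def)
  have img: "f R = map_prod \<psi> \<psi> ` R" if R: "R \<in> C" for R
  proof (intro equalityI subsetI)
    fix z assume z: "z \<in> map_prod \<psi> \<psi> ` R"
    then obtain u v where uv: "(u, v) \<in> R" "z = (\<psi> u, \<psi> v)" by auto
    have V: "u \<in> V" "v \<in> V" using coherent_configuration_subset[OF C R] uv by auto
    show "z \<in> f R" using rel_in(2)[OF C' psi(1)[OF V(1)] psi(1)[OF V(2)]] eq[OF V] rel_eq[OF C R uv(1)] uv by simp
  next
    fix z assume z: "z \<in> f R"
    obtain a b where ab: "z = (a, b)" by fastforce
    have "a \<in> V'" "b \<in> V'" using coherent_configuration_subset[OF C' f_in[OF R]] z ab by auto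
    then obtain u v where uv: "u \<in> V" "v \<in> V" "a = \<psi> u" "b = \<psi> v" using bij by (auto simp: bij_betw_def)
    have "f (rel C u v) = f R" using eq[OF uv(1,2)] rel_eq[OF C' f_in[OF R]] z ab uv by simp
    then have "(u, v) \<in> R" using f_rel_iff[OF R uv(1,2)] by simp
    then show "z \<in> map_prod \<psi> \<psi> ` R" using ab uv by force
  qed
  show ?thesis
    using bij img f_in by (intro exI[of _ \<psi>]) (auto simp: combinatorial_isomorphism_def)
qed

text \<open>Coordinates on side \<open>False\<close> suffice: there the colours are images of the
  relations of \<open>C\<close> under the injective \<open>f\<close>, so they classify pairs in the
  same way.\<close>

lemma k4_if_not_induced:
  assumes "card V \<le> 16"
    and no: "\<nexists>\<psi>. combinatorial_isomorphism V C V' C' \<psi> \<and> (\<forall>R\<in>C. f R = map_prod \<psi> \<psi> ` R)"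
  shows "card V = 16 \<and> (\<exists>\<rho>. inj_on \<rho> V \<and> (\<forall>u\<in>V. \<forall>v\<in>V. \<forall>u'\<in>V. \<forall>v'\<in>V.
    rel C u v = rel C u' v' \<longleftrightarrow>
    k4_color (\<lambda>_ _. False) (\<rho> u) (\<rho> v) = k4_color (\<lambda>_ _. False) (\<rho> u') (\<rho> v')))"
proof -
  have cV: "card {p \<in> P. \<not> sd p} = card V" unfolding side by (simp add: card_image)
  have np: "\<nexists>\<phi>. piso UNIV \<phi>" using induced_if_piso no by blast
  have 16: "card V = 16" and K: klein using piso_or_klein assms(1) np cV by auto
  obtain \<rho> where rho: "inj_on \<rho> {p \<in> P. \<not> sd p}"
    "\<forall>p\<in>P. \<forall>q\<in>P. \<forall>p'\<in>P. \<forall>q'\<in>P. \<not> sd p \<and> \<not> sd q \<and> \<not> sd p' \<and> \<not> sd q' \<longrightarrow>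
       (col p q = col p' q' \<longleftrightarrow> k4_color (\<lambda>_ _. False) (\<rho> p) (\<rho> q) = k4_color (\<lambda>_ _. False) (\<rho> p') (\<rho> q'))"
    using klein_coordinates[OF K] by blast
  have "inj_on (\<rho> \<circ> Inl) V" using rho(1) unfolding side by (intro comp_inj_on) auto
  moreover have "rel C u v = rel C u' v' \<longleftrightarrow>
    k4_color (\<lambda>_ _. False) ((\<rho> \<circ> Inl) u) ((\<rho> \<circ> Inl) v) = k4_color (\<lambda>_ _. False) ((\<rho> \<circ> Inl) u') ((\<rho> \<circ> Inl) v')"
    if V: "u \<in> V" "v \<in> V" "u' \<in> V" "v' \<in> V" for u v u' v'
  proof -
    have "rel C u v = rel C u' v' \<longleftrightarrow> f (rel C u v) = f (rel C u' v')"
      using f_inj[OF rel_in(1)[OF C V(1,2)] rel_in(1)[OF C V(3,4)]] by auto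
    then show ?thesis using rho(2)[rule_format, of "Inl u" "Inl v" "Inl u'" "Inl v'"] V by (simp add: P_def sd_def)
  qed
  ultimately show ?thesis using 16 by blast
qed

end

section \<open>The non-separable configuration on 16 points\<close>

definition color_class :: "'a set \<Rightarrow> ('a \<Rightarrow> 'a \<Rightarrow> 'k) \<Rightarrow> 'k \<Rightarrow> ('a \<times> 'a) set" where
  "color_class V c k = {(x, y) \<in> V \<times> V. c x y = k}"

definition colors :: "'a set \<Rightarrow> ('a \<Rightarrow> 'a \<Rightarrow> 'k) \<Rightarrow> 'k set" where
  "colors V c = (\<lambda>(x, y). c x y) ` (V \<times> V)"

abbreviation color_classes :: "'a set \<Rightarrow> ('a \<Rightarrow> 'a \<Rightarrow> 'k) \<Rightarrow> ('a \<times> 'a) set set" where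
  "color_classes V c \<equiv> color_class V c ` colors V c"

lemma color_class_iff: "(x, y) \<in> color_class V c k \<longleftrightarrow> x \<in> V \<and> y \<in> V \<and> c x y = k"
  by (auto simp: color_class_def)

lemma colorsI: "x \<in> V \<Longrightarrow> y \<in> V \<Longrightarrow> c x y \<in> colors V c"
  by (auto simp: colors_def)

lemma colorsE:
  assumes "k \<in> colors V c" obtains x y where "x \<in> V" "y \<in> V" "c x y = k"
  using assms by (auto simp: colors_def)

lemma color_path: "u \<in> V \<Longrightarrow> v \<in> V \<Longrightarrow>
    {w. (u, w) \<in> color_class V c i \<and> (w, v) \<in> color_class V c j} = {w \<in> V. c u w = i \<and> c w v = j}"
  by (auto simp: color_class_iff)

lemma color_class_converse:
  assumes conv: "\<And>u v u' v'. u \<in> V \<Longrightarrow> v \<in> V \<Longrightarrow> u' \<in> V \<Longrightarrow> v' \<in> V \<Longrightarrow> c u v = c u' v' \<Longrightarrow> c v u = c v' u'"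
    and "x \<in> V" "y \<in> V"
  shows "(color_class V c (c x y))\<inverse> = color_class V c (c y x)"
proof -
  have "c b a = c x y \<longleftrightarrow> c a b = c y x" if "a \<in> V" "b \<in> V" for a b
    using conv[OF that(2,1) assms(2,3)] conv[OF that assms(3,2)] by blast
  then show ?thesis by (auto simp: color_class_iff)
qed

lemma color_classes_coherent:
  assumes fin: "finite V"
    and diag: "\<And>u v w. u \<in> V \<Longrightarrow> v \<in> V \<Longrightarrow> w \<in> V \<Longrightarrow> c u v = c w w \<Longrightarrow> u = v"
    and conv: "\<And>u v u' v'. u \<in> V \<Longrightarrow> v \<in> V \<Longrightarrow> u' \<in> V \<Longrightarrow> v' \<in> V \<Longrightarrow> c u v = c u' v' \<Longrightarrow> c v u = c v' u'"
    and count: "\<And>u v u' v' i j. u \<in> V \<Longrightarrow> v \<in> V \<Longrightarrow> u' \<in> V \<Longrightarrow> v' \<in> V \<Longrightarrow> c u v = c u' v' \<Longrightarrow>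
      card {w \<in> V. c u w = i \<and> c w v = j} = card {w \<in> V. c u' w = i \<and> c w v' = j}"
  shows "coherent_configuration V (color_classes V c)"
  unfolding coherent_configuration_def
proof (intro conjI fin)
  show "partition_on (V \<times> V) (color_classes V c)"
  proof (rule partition_onI)
    show "\<Union> (color_classes V c) = V \<times> V" by (auto simp: color_class_iff colors_def)
    show "{} \<notin> color_classes V c"
    proof
      assume "{} \<in> color_classes V c"
      then obtain x y where xy: "x \<in> V" "y \<in> V" and e: "{} = color_class V c (c x y)" by (auto simp: colors_def)
      have "(x, y) \<in> color_class V c (c x y)" using xy by (simp add: color_class_iff)
      then show False unfolding e[symmetric] by simp
    qed
    show "disjnt R S" if "R \<in> color_classes V c" "S \<in> color_classes V c" "R \<noteq> S" for R S
      using that by (auto simp: disjnt_def color_class_def)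
  qed
  show "\<forall>R\<in>color_classes V c. (\<exists>x. (x, x) \<in> R) \<longrightarrow> R \<subseteq> Id"
    using diag by (auto simp: color_class_iff)
  show "\<forall>R\<in>color_classes V c. R\<inverse> \<in> color_classes V c"
  proof
    fix R assume "R \<in> color_classes V c"
    then obtain x y where xy: "x \<in> V" "y \<in> V" "R = color_class V c (c x y)" by (auto simp: colors_def)
    have inv: "R\<inverse> = color_class V c (c y x)"
      unfolding xy(3) by (rule color_class_converse[OF _ xy(1,2)]) (rule conv)
    show "R\<inverse> \<in> color_classes V c"
      unfolding inv by (rule imageI[OF colorsI[OF xy(2,1)]])
  qed
  show "\<forall>R\<in>color_classes V c. \<forall>S\<in>color_classes V c. \<forall>T\<in>color_classes V c.
    \<exists>n. \<forall>(u, v)\<in>T. card {w. (u, w) \<in> R \<and> (w, v) \<in> S} = n"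
  proof (intro ballI)
    fix R S T assume "R \<in> color_classes V c" "S \<in> color_classes V c" "T \<in> color_classes V c"
    then obtain i j x y where h: "R = color_class V c i" "S = color_class V c j" "x \<in> V" "y \<in> V"
      "T = color_class V c (c x y)" by (auto simp: colors_def)
    have "card {w. (u, w) \<in> R \<and> (w, v) \<in> S} = card {w \<in> V. c x w = i \<and> c w y = j}" if "(u, v) \<in> T" for u v
    proof -
      have uv: "u \<in> V" "v \<in> V" "c u v = c x y" using that h by (auto simp: color_class_iff)
      show ?thesis unfolding h(1,2) color_path[OF uv(1,2)] by (rule count[OF uv(1,2) h(3,4) uv(3)])
    qed
    then show "\<exists>n. \<forall>(u, v)\<in>T. card {w. (u, w) \<in> R \<and> (w, v) \<in> S} = n" by auto
  qed
qed

lemma color_class_inj: "inj_on (color_class V c) (colors V c)"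
proof (rule inj_onI)
  fix k l assume k: "k \<in> colors V c" and eq: "color_class V c k = color_class V c l"
  obtain x y where "x \<in> V" "y \<in> V" "c x y = k" using k by (rule colorsE)
  then have "(x, y) \<in> color_class V c k" by (simp add: color_class_iff)
  then show "k = l" unfolding eq using \<open>c x y = k\<close> by (simp add: color_class_iff)
qed

lemma color_classes_algebraic:
  assumes C: "coherent_configuration V (color_classes V c)"
    and C': "coherent_configuration V' (color_classes V' c')"
    and same: "colors V c = colors V' c'"
    and count: "\<And>u v u' v' i j. u \<in> V \<Longrightarrow> v \<in> V \<Longrightarrow> u' \<in> V' \<Longrightarrow> v' \<in> V' \<Longrightarrow> c u v = c' u' v' \<Longrightarrow>
      card {w \<in> V. c u w = i \<and> c w v = j} = card {w \<in> V'. c' u' w = i \<and> c' w v' = j}"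
  shows "\<exists>f. algebraic_isomorphism (color_classes V c) (color_classes V' c') f \<and>
    (\<forall>k\<in>colors V c. f (color_class V c k) = color_class V' c' k)"
proof -
  define f where "f R = color_class V' c' (inv_into (colors V c) (color_class V c) R)" for R
  have fk: "f (color_class V c k) = color_class V' c' k" if "k \<in> colors V c" for k
    unfolding f_def using inv_into_f_f[OF color_class_inj that] by simp
  have "bij_betw f (color_classes V c) (color_classes V' c')"
    unfolding bij_betw_def
  proof
    show "inj_on f (color_classes V c)"
      using fk color_class_inj[of V' c'] same by (auto simp: inj_on_def)
    have "f ` color_classes V c = (\<lambda>k. f (color_class V c k)) ` colors V c" by (simp add: image_image)
    also have "\<dots> = color_class V' c' ` colors V c" using fk by (rule image_cong[OF refl])
    finally show "f ` color_classes V c = color_classes V' c'" by (simp only: same)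
  qed
  moreover have "intersection_number R S T = intersection_number (f R) (f S) (f T)"
    if RST: "R \<in> color_classes V c" "S \<in> color_classes V c" "T \<in> color_classes V c" for R S T
  proof -
    obtain i j k where ijk: "i \<in> colors V c" "j \<in> colors V c" "k \<in> colors V c"
      "R = color_class V c i" "S = color_class V c j" "T = color_class V c k" using RST by auto
    obtain u v where uv: "u \<in> V" "v \<in> V" "c u v = k" using ijk(3) by (rule colorsE)
    obtain u' v' where uv': "u' \<in> V'" "v' \<in> V'" "c' u' v' = k"
      using ijk(3) unfolding same by (rule colorsE)
    have "intersection_number R S T = card {w. (u, w) \<in> R \<and> (w, v) \<in> S}"
      using card_intersection_number[OF C RST, of u v] uv ijk by (simp add: color_class_iff)
    also have "\<dots> = card {w \<in> V. c u w = i \<and> c w v = j}" unfolding ijk color_path[OF uv(1,2)] ..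
    also have "\<dots> = card {w \<in> V'. c' u' w = i \<and> c' w v' = j}" using count[OF uv(1,2) uv'(1,2)] uv uv' by simp
    also have "\<dots> = card {w. (u', w) \<in> f R \<and> (w, v') \<in> f S}"
      unfolding ijk(4,5) fk[OF ijk(1)] fk[OF ijk(2)] color_path[OF uv'(1,2)] ..
    also have "\<dots> = intersection_number (f R) (f S) (f T)"
    proof (rule card_intersection_number[OF C'])
      show "f R \<in> color_classes V' c'" "f S \<in> color_classes V' c'" "f T \<in> color_classes V' c'"
        using ijk fk same by auto
      show "(u', v') \<in> f T" using uv' ijk fk by (simp add: color_class_iff)
    qed
    finally show ?thesis .
  qed
  ultimately show ?thesis
    using fk unfolding algebraic_isomorphism_def by blast
qed

text \<open>Two different nonzero vectors over the field with two elements are linearly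
  independent.\<close>

lemma dot2_solve:
  assumes "v \<noteq> (False, False)" "w \<noteq> (False, False)" "v \<noteq> w"
  shows "\<exists>a. dot2 v a = s \<and> dot2 w a = t"
  using assms by (cases v; cases w) (auto simp: dot2_def ex_bool_eq)

lemma dot2_solve1:
  assumes "v \<noteq> (False, False)"
  shows "\<exists>a. dot2 v a = s"
  using assms by (cases v) (auto simp: dot2_def ex_bool_eq)

lemma add2_comm: "add2 v w = add2 w v" by (auto simp: add2_def)

lemma add2_left: "add2 a b = add2 a c \<longleftrightarrow> b = c" "add2 b a = add2 c a \<longleftrightarrow> b = c"
  by (auto simp: add2_def prod_eq_iff)

text \<open>Seen from a third fiber \<open>l\<close>, a translation compensates any twist, because at most two of the
  three functionals on \<open>l\<close> are involved. Hence twisting preserves the intersection numbers.\<close>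

lemma k4_shift:
  assumes sym: "\<And>i j. \<epsilon> i j = \<epsilon> j i" "\<And>i j. \<epsilon>' i j = \<epsilon>' j i"
    and eq: "k4_color \<epsilon> p q = k4_color \<epsilon>' p' q'"
  shows "\<exists>a. \<forall>e. k4_color \<epsilon> p (l, e) = k4_color \<epsilon>' p' (l, add2 e a) \<and>
    k4_color \<epsilon> (l, e) q = k4_color \<epsilon>' (l, add2 e a) q'"
proof -
  obtain i x j y x' y' where pq: "p = (i, x)" "q = (j, y)" "p' = (i, x')" "q' = (j, y')"
    using eq by (cases p; cases q; cases p'; cases q') (auto simp: k4_color_def)
  have d: "dot2 w (add2 e a) \<longleftrightarrow> dot2 w e \<noteq> dot2 w a" for w e a by (rule dot2_add2)
  show ?thesis
  proof (cases "i = j")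
    case True
    then have xy: "add2 x y = add2 x' y'" using eq by (simp add: k4_color_def pq)
    show ?thesis
    proof (cases "l = i")
      case l: True
      have "add2 x x' = add2 y y'"
        using xy by (cases x; cases y; cases x'; cases y') (auto simp: add2_def)
      then have e2: "add2 e y = add2 (add2 e (add2 x x')) y'" for e by (auto simp: add2_def prod_eq_iff)
      show ?thesis
      proof (intro exI[of _ "add2 x x'"] allI conjI)
        fix e
        show "k4_color \<epsilon> p (l, e) = k4_color \<epsilon>' p' (l, add2 e (add2 x x'))"
          by (auto simp: k4_color_def pq l add2_def)
        show "k4_color \<epsilon> (l, e) q = k4_color \<epsilon>' (l, add2 e (add2 x x')) q'"
          by (simp add: k4_color_def pq l True[symmetric] e2[symmetric])
      qed
    next
      case False
      let ?w = "add2 i l"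
      have "?w \<noteq> (False, False)" using False add2_eq by metis
      then obtain a where a: "dot2 ?w a = ((dot2 ?w x \<noteq> dot2 ?w x') \<noteq> (\<epsilon> i l \<noteq> \<epsilon>' i l))"
        using dot2_solve1 by metis
      have "dot2 ?w (add2 x y) = dot2 ?w (add2 x' y')" using xy by simp
      then show ?thesis
        by (intro exI[of _ a])
          (use False True a sym[of i l] add2_comm[of l i] in \<open>auto simp: k4_color_def pq d\<close>)
    qed
  next
    case ij: False
    then have xy: "dot2 (add2 i j) (add2 x y) \<noteq> \<epsilon> i j \<longleftrightarrow> dot2 (add2 i j) (add2 x' y') \<noteq> \<epsilon>' i j"
      using eq by (auto simp: k4_color_def pq)
    consider "l = i" | "l = j" | "l \<noteq> i" "l \<noteq> j" by blast
    then show ?thesis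
    proof cases
      case 1
      show ?thesis
      proof (intro exI[of _ "add2 x x'"] allI conjI)
        fix e
        show "k4_color \<epsilon> p (l, e) = k4_color \<epsilon>' p' (l, add2 e (add2 x x'))"
          by (auto simp: k4_color_def pq 1 add2_def)
        show "k4_color \<epsilon> (l, e) q = k4_color \<epsilon>' (l, add2 e (add2 x x')) q'"
          using xy ij by (auto simp: k4_color_def pq 1 d)
      qed
    next
      case 2
      show ?thesis
      proof (intro exI[of _ "add2 y y'"] allI conjI)
        fix e
        show "k4_color \<epsilon> p (l, e) = k4_color \<epsilon>' p' (l, add2 e (add2 y y'))"
          using xy ij by (auto simp: k4_color_def pq 2 d)
        show "k4_color \<epsilon> (l, e) q = k4_color \<epsilon>' (l, add2 e (add2 y y')) q'"
          by (auto simp: k4_color_def pq 2 add2_def)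
      qed
    next
      case 3
      let ?v = "add2 i l" and ?w = "add2 l j"
      have nz: "?v \<noteq> (False, False)" "?w \<noteq> (False, False)" using 3 add2_eq by metis+
      have ne: "?v \<noteq> ?w" using ij add2_left(1)[of l i j] add2_comm[of i l] by simp
      \<comment> \<open>Adding \<open>a\<close> to \<open>e\<close> changes the two products by
        \<open>dot2 ?v a\<close> and \<open>dot2 ?w a\<close>. These must cancel the change of the
        end points together with the difference of the twists.\<close>
      define s t where "s = ((dot2 ?v x \<noteq> dot2 ?v x') \<noteq> (\<epsilon> i l \<noteq> \<epsilon>' i l))"
        and "t = ((dot2 ?w y \<noteq> dot2 ?w y') \<noteq> (\<epsilon> l j \<noteq> \<epsilon>' l j))"
      obtain a where "dot2 ?v a = s" "dot2 ?w a = t" using dot2_solve[OF nz ne, of s t] by blast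
      then show ?thesis
        by (intro exI[of _ a]) (use 3 in \<open>auto simp: k4_color_def pq d s_def t_def\<close>)
    qed
  qed
qed

lemma k4_count:
  assumes sym: "\<And>i j. \<epsilon> i j = \<epsilon> j i" "\<And>i j. \<epsilon>' i j = \<epsilon>' j i"
    and eq: "k4_color \<epsilon> p q = k4_color \<epsilon>' p' q'"
  shows "card {w. k4_color \<epsilon> p w = \<kappa> \<and> k4_color \<epsilon> w q = \<kappa>'} = card {w. k4_color \<epsilon>' p' w = \<kappa> \<and> k4_color \<epsilon>' w q' = \<kappa>'}"
    (is "card ?A = card ?B")
proof -
  \<comment> \<open>The colour names the fibers of both its points, so all \<open>w\<close> that are
    counted lie in a single fiber and one translation serves them all.\<close>
  let ?l = "fst (snd \<kappa>)"
  obtain a where a: "\<And>e. k4_color \<epsilon> p (?l, e) = k4_color \<epsilon>' p' (?l, add2 e a)"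
    "\<And>e. k4_color \<epsilon> (?l, e) q = k4_color \<epsilon>' (?l, add2 e a) q'"
    using k4_shift[OF sym eq] by metis
  have l: "\<exists>e. w = (?l, e)" if "w \<in> ?A \<or> w \<in> ?B" for w
    using that by (cases w) (auto simp: k4_color_def)
  have aa: "add2 (add2 e a) a = e" for e by (auto simp: add2_def prod_eq_iff)
  let ?h = "\<lambda>w. (fst w, add2 (snd w) a)"
  have "bij_betw ?h ?A ?B"
  proof (rule bij_betwI[where g = ?h])
    show "?h \<in> ?A \<rightarrow> ?B"
    proof
      fix w assume w: "w \<in> ?A"
      then obtain e where "w = (?l, e)" using l by blast
      then show "?h w \<in> ?B" using w a[of e] by simp
    qed
    show "?h \<in> ?B \<rightarrow> ?A"
    proof
      fix w assume w: "w \<in> ?B"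
      then obtain e where "w = (?l, e)" using l by blast
      then show "?h w \<in> ?A" using w a[of "add2 e a"] aa by simp
    qed
  qed (simp_all add: aa)
  then show ?thesis by (rule bij_betw_same_card)
qed

lemma k4_diag: "k4_color \<epsilon> p q = k4_color \<epsilon> w w \<longleftrightarrow> p = q \<and> fst p = fst w"
  by (auto simp: k4_color_def add2_def prod_eq_iff)

lemma k4_converse:
  assumes "\<And>i j. \<epsilon> i j = \<epsilon> j i" "k4_color \<epsilon> p q = k4_color \<epsilon> p' q'"
  shows "k4_color \<epsilon> q p = k4_color \<epsilon> q' p'"
proof -
  have "k4_color \<epsilon> y x = (fst (snd (k4_color \<epsilon> x y)), fst (k4_color \<epsilon> x y), snd (snd (k4_color \<epsilon> x y)))" for x y
    using assms(1)[of "fst x" "fst y"] by (simp add: k4_color_def add2_comm)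
  then show ?thesis using assms(2) by metis
qed

text \<open>A nonzero functional takes both values, so a twist does not alter which colours
  occur.\<close>

lemma k4_recolor: "\<exists>q'. k4_color \<epsilon> p q = k4_color \<epsilon>' p q'"
proof (cases "fst p = fst q")
  case True
  then show ?thesis by (intro exI[of _ q]) (simp add: k4_color_def)
next
  case False
  let ?w = "add2 (fst p) (fst q)"
  have "?w \<noteq> (False, False)" using False add2_eq by metis
  then obtain a where a: "dot2 ?w a = (dot2 ?w (snd q) \<noteq> (\<epsilon> (fst p) (fst q) \<noteq> \<epsilon>' (fst p) (fst q)))"
    using dot2_solve1 by metis
  show ?thesis
    by (intro exI[of _ "(fst q, a)"]) (use False a in \<open>auto simp: k4_color_def dot2_add2\<close>)
qed

section \<open>The parity obstruction\<close>

definition untwisted :: "bool2 \<Rightarrow> bool2 \<Rightarrow> bool" where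
  "untwisted i j \<longleftrightarrow> False"

text \<open>The choice of the pair is arbitrary; the parity argument works for any odd number of
  twisted pairs.\<close>

definition twisted :: "bool2 \<Rightarrow> bool2 \<Rightarrow> bool" where
  "twisted i j \<longleftrightarrow> {i, j} = {(False, False), (False, True)}"

text \<open>The sum of \<open>(i + j) \<bullet> (a\<^sub>i + a\<^sub>j)\<close> over the six pairs of fibers vanishes identically,
  while the twist makes it odd.\<close>

lemma twist_not_induced: "\<nexists>\<phi>. \<forall>p q. k4_color twisted (\<phi> p) (\<phi> q) = k4_color untwisted p q"
proof
  assume "\<exists>\<phi>. \<forall>p q. k4_color twisted (\<phi> p) (\<phi> q) = k4_color untwisted p q"
  then obtain \<phi> where phi: "\<And>p q. k4_color twisted (\<phi> p) (\<phi> q) = k4_color untwisted p q" by blast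
  define a where "a i = snd (\<phi> (i, (False, False)))" for i
  have f: "fst (\<phi> p) = fst p" for p using phi[of p p] by (simp add: k4_color_def)
  have e: "dot2 (add2 i j) (add2 (a i) (a j)) = twisted i j" if "i \<noteq> j" for i j
    using phi[of "(i, (False, False))" "(j, (False, False))"] that
    by (simp add: k4_color_def f a_def untwisted_def) (simp add: dot2_def add2_def)
  have t: "twisted (False, False) (False, True)" "\<not> twisted (False, False) (True, False)"
    "\<not> twisted (False, False) (True, True)" "\<not> twisted (False, True) (True, False)"
    "\<not> twisted (False, True) (True, True)" "\<not> twisted (True, False) (True, True)"
    by (auto simp: twisted_def doubleton_eq_iff)
  \<comment> \<open>In the sum, each \<open>a i\<close> is multiplied by the sum of the three
    nonzero vectors, which is zero, whereas exactly one of the six right-hand sides is true.\<close>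
  show False
    using e[of "(False, False)" "(False, True)"] e[of "(False, False)" "(True, False)"]
      e[of "(False, False)" "(True, True)"] e[of "(False, True)" "(True, False)"]
      e[of "(False, True)" "(True, True)"] e[of "(True, False)" "(True, True)"]
    unfolding dot2_add2 by (simp add: t) (auto simp: dot2_def add2_def)
qed

lemma sym_untwisted: "untwisted i j = untwisted j i" and sym_twisted: "twisted i j = twisted j i"
  by (auto simp: untwisted_def twisted_def insert_commute)

section \<open>The configuration on natural numbers and its uniqueness\<close>

context
  fixes enc :: "bool2 \<times> bool2 \<Rightarrow> nat" and c :: "nat \<Rightarrow> nat \<Rightarrow> bool2 \<times> bool2 \<times> bool2"
  assumes enc: "inj enc" and c: "\<And>p q. c (enc p) (enc q) = k4_color untwisted p q"
begin

lemma enc_count: "card {w \<in> range enc. Q w} = card {p. Q (enc p)}"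
proof -
  have "{w \<in> range enc. Q w} = enc ` {p. Q (enc p)}" by blast
  then show ?thesis using enc by (simp add: card_image inj_on_def)
qed

lemma card_enc: "card (range enc) = 16"
  using enc by (simp add: card_image flip: UNIV_Times_UNIV)

lemma k4_coherent: "coherent_configuration (range enc) (color_classes (range enc) c)"
proof (rule color_classes_coherent)
  show "u = v" if "u \<in> range enc" "v \<in> range enc" "w \<in> range enc" "c u v = c w w" for u v w
    using that by (auto simp: c k4_diag)
  show "c v u = c v' u'" if h: "u \<in> range enc" "v \<in> range enc" "u' \<in> range enc" "v' \<in> range enc" "c u v = c u' v'"
    for u v u' v'
  proof -
    obtain p q p' q' where "u = enc p" "v = enc q" "u' = enc p'" "v' = enc q'" using h by blast
    then show ?thesis using h(5) k4_converse[of untwisted p q p' q', OF sym_untwisted] by (simp add: c)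
  qed
  show "card {w \<in> range enc. c u w = i \<and> c w v = j} = card {w \<in> range enc. c u' w = i \<and> c w v' = j}"
    if h: "u \<in> range enc" "v \<in> range enc" "u' \<in> range enc" "v' \<in> range enc" "c u v = c u' v'" for u v u' v' i j
  proof -
    obtain p q p' q' where "u = enc p" "v = enc q" "u' = enc p'" "v' = enc q'" using h by blast
    then show ?thesis unfolding enc_count
      using h(5) k4_count[of untwisted untwisted p q p' q', OF sym_untwisted sym_untwisted] by (simp add: c)
  qed
qed simp

lemma k4_twisted_coherent: "coherent_configuration UNIV (color_classes UNIV (k4_color twisted))"
proof (rule color_classes_coherent)
  show "u = v" if "k4_color twisted u v = k4_color twisted w w" for u v w
    using that by (simp add: k4_diag)
  show "k4_color twisted v u = k4_color twisted v' u'" if "k4_color twisted u v = k4_color twisted u' v'"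
    for u v u' v' using k4_converse[of twisted, OF sym_twisted that] .
  show "card {w \<in> UNIV. k4_color twisted u w = i \<and> k4_color twisted w v = j} =
      card {w \<in> UNIV. k4_color twisted u' w = i \<and> k4_color twisted w v' = j}"
    if "k4_color twisted u v = k4_color twisted u' v'" for u v u' v' i j
    using k4_count[of twisted twisted, OF sym_twisted sym_twisted that] by simp
qed simp

text \<open>The twisted configuration is the target, left on its own point type thanks to
  \<open>separableD\<close>. An inducing map would preserve colours against
  \<open>twist_not_induced\<close>.\<close>

lemma k4_not_separable: "\<not> separable (range enc) (color_classes (range enc) c)"
proof
  assume sep: "separable (range enc) (color_classes (range enc) c)"
  have same: "colors (range enc) c = colors UNIV (k4_color twisted)"
  proof (intro equalityI subsetI)
    fix k assume "k \<in> colors (range enc) c"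
    then obtain p q where "k = k4_color untwisted p q" by (auto simp: colors_def c)
    then obtain q' where "k = k4_color twisted p q'" using k4_recolor[of untwisted p q twisted] by auto
    then show "k \<in> colors UNIV (k4_color twisted)" using colorsI[of p UNIV q' "k4_color twisted"] by simp
  next
    fix k assume "k \<in> colors UNIV (k4_color twisted)"
    then obtain p q where "k = k4_color twisted p q" by (auto simp: colors_def)
    then obtain q' where "k = c (enc p) (enc q')" using k4_recolor[of twisted p q untwisted] c by auto
    then show "k \<in> colors (range enc) c" by (auto intro: colorsI)
  qed
  have cnt: "card {w \<in> range enc. c u w = i \<and> c w v = j} =
      card {w \<in> UNIV. k4_color twisted u' w = i \<and> k4_color twisted w v' = j}"
    if h: "u \<in> range enc" "v \<in> range enc" "c u v = k4_color twisted u' v'" for u v u' v' i j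
  proof -
    obtain p q where "u = enc p" "v = enc q" using h by blast
    then show ?thesis unfolding enc_count
      using h(3) k4_count[of untwisted twisted p q u' v', OF sym_untwisted sym_twisted] by (simp add: c)
  qed
  obtain f where f: "algebraic_isomorphism (color_classes (range enc) c) (color_classes UNIV (k4_color twisted)) f"
    "\<forall>k\<in>colors (range enc) c. f (color_class (range enc) c k) = color_class UNIV (k4_color twisted) k"
    using color_classes_algebraic[OF k4_coherent k4_twisted_coherent same cnt] by blast
  obtain \<phi> where phi: "\<forall>R\<in>color_classes (range enc) c. f R = map_prod \<phi> \<phi> ` R"
    using separableD[OF sep k4_twisted_coherent f(1)] by blast
  have "k4_color twisted (\<phi> (enc p)) (\<phi> (enc q)) = k4_color untwisted p q" for p q
  proof -
    have k: "k4_color untwisted p q \<in> colors (range enc) c" using colorsI[of "enc p" "range enc" "enc q" c] by (simp add: c)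
    have "(enc p, enc q) \<in> color_class (range enc) c (k4_color untwisted p q)" by (simp add: color_class_iff c)
    then have "(\<phi> (enc p), \<phi> (enc q)) \<in> f (color_class (range enc) c (k4_color untwisted p q))"
      using phi k by force
    then show ?thesis using f(2) k by (simp add: color_class_iff)
  qed
  then show False using twist_not_induced by (metis comp_apply)
qed

lemma k4_max_fiber: "max_fiber_size (color_classes (range enc) c) = 4"
proof -
  have Id_on: "color_class (range enc) c (k4_color untwisted p p) = Id_on (enc ` ({fst p} \<times> UNIV))" for p
  proof (intro equalityI subrelI)
    fix x y assume "(x, y) \<in> color_class (range enc) c (k4_color untwisted p p)"
    then obtain a where "x = enc a" "y = enc a" "fst a = fst p"
      by (auto simp: color_class_iff c k4_diag)
    then show "(x, y) \<in> Id_on (enc ` ({fst p} \<times> UNIV))" by (cases a) auto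
  next
    fix x y assume "(x, y) \<in> Id_on (enc ` ({fst p} \<times> UNIV))"
    then obtain a where "x = enc a" "y = enc a" "fst a = fst p" by auto
    then show "(x, y) \<in> color_class (range enc) c (k4_color untwisted p p)"
      by (simp add: color_class_iff c k4_diag)
  qed
  have "card X = 4" if X: "X \<in> fibers (color_classes (range enc) c)" for X
  proof -
    obtain p q where pq: "Id_on X = color_class (range enc) c (k4_color untwisted p q)"
      using X by (auto simp: fibers_def colors_def c)
    have "(enc p, enc q) \<in> Id_on X" unfolding pq by (simp add: color_class_iff c)
    then have "p = q" using enc by (auto simp: inj_eq)
    then have "Id_on X = Id_on (enc ` ({fst p} \<times> UNIV))" using pq Id_on by simp
    then have "X = enc ` ({fst p} \<times> UNIV)" by (metis Domain_Id_on)
    then have "card X = card ({fst p} \<times> (UNIV :: bool2 set))"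
      using card_image[OF inj_on_subset[OF enc subset_UNIV]] by blast
    then show ?thesis by (simp add: card_cartesian_product flip: UNIV_Times_UNIV)
  qed
  moreover have "fibers (color_classes (range enc) c) \<noteq> {}"
  proof -
    let ?o = "((False, False), (False, False))"
    have "k4_color untwisted ?o ?o \<in> colors (range enc) c"
      using colorsI[of "enc ?o" "range enc" "enc ?o" c] by (simp add: c)
    then have "enc ` ({fst ?o} \<times> UNIV) \<in> fibers (color_classes (range enc) c)"
      unfolding fibers_def mem_Collect_eq Id_on[symmetric] by (rule imageI)
    then show ?thesis by blast
  qed
  ultimately have "card ` fibers (color_classes (range enc) c) = {4}" by (auto simp: image_iff)
  then show ?thesis unfolding max_fiber_size_def by simp
qed

text \<open>An injection between sets of 16 points hits every coordinate, so each basis relation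
  fills an entire colour class.\<close>

lemma k4_iso:
  assumes C: "coherent_configuration V C" and V: "card V = 16" and inj: "inj_on \<rho> V"
    and rho: "\<forall>u\<in>V. \<forall>v\<in>V. \<forall>u'\<in>V. \<forall>v'\<in>V.
      rel C u v = rel C u' v' \<longleftrightarrow> k4_color untwisted (\<rho> u) (\<rho> v) = k4_color untwisted (\<rho> u') (\<rho> v')"
  shows "combinatorial_isomorphism V C (range enc) (color_classes (range enc) c) (enc \<circ> \<rho>)"
proof -
  have inj': "inj_on (enc \<circ> \<rho>) V" using inj enc by (intro comp_inj_on) (auto intro: inj_on_subset)
  have img: "(enc \<circ> \<rho>) ` V = range enc"
    using card_image[OF inj'] V card_enc by (intro card_subset_eq) auto
  have "map_prod (enc \<circ> \<rho>) (enc \<circ> \<rho>) ` R \<in> color_classes (range enc) c" if R: "R \<in> C" for R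
  proof -
    obtain u v where uv: "(u, v) \<in> R" using coherent_nonempty[OF C R] by auto
    have uvV: "u \<in> V" "v \<in> V" using coherent_configuration_subset[OF C R] uv by auto
    let ?k = "k4_color untwisted (\<rho> u) (\<rho> v)"
    have R_iff: "(x, y) \<in> R \<longleftrightarrow> k4_color untwisted (\<rho> x) (\<rho> y) = ?k" if "x \<in> V" "y \<in> V" for x y
      using rel_iff[OF C R that] rel_eq[OF C R uv] rho that uvV by metis
    have "map_prod (enc \<circ> \<rho>) (enc \<circ> \<rho>) ` R = color_class (range enc) c ?k"
    proof (intro equalityI subsetI)
      fix z assume "z \<in> map_prod (enc \<circ> \<rho>) (enc \<circ> \<rho>) ` R"
      then obtain x y where "(x, y) \<in> R" "z = (enc (\<rho> x), enc (\<rho> y))" by auto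
      moreover from this have "x \<in> V" "y \<in> V" using coherent_configuration_subset[OF C R] by auto
      ultimately show "z \<in> color_class (range enc) c ?k" using R_iff by (simp add: color_class_iff c)
    next
      fix z assume z: "z \<in> color_class (range enc) c ?k"
      obtain m n where mn: "z = (m, n)" by fastforce
      have "m \<in> (enc \<circ> \<rho>) ` V" "n \<in> (enc \<circ> \<rho>) ` V" using z mn unfolding img by (simp_all add: color_class_iff)
      then obtain x y where xy: "x \<in> V" "y \<in> V" "m = enc (\<rho> x)" "n = enc (\<rho> y)" by auto
      have "(x, y) \<in> R" using z mn xy R_iff by (simp add: color_class_iff c)
      then show "z \<in> map_prod (enc \<circ> \<rho>) (enc \<circ> \<rho>) ` R" using mn xy by force
    qed
    moreover have "?k \<in> colors (range enc) c" using colorsI[of "enc (\<rho> u)" "range enc" "enc (\<rho> v)" c] by (simp add: c)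
    ultimately show ?thesis by simp
  qed
  then show ?thesis unfolding combinatorial_isomorphism_def bij_betw_def using inj' img by blast
qed

end

lemma not_separable_k4:
  assumes C: "coherent_configuration V C" and "card V \<le> 16" "max_fiber_size C = 4" and "\<not> separable V C"
  shows "card V = 16 \<and> (\<exists>\<rho>. inj_on \<rho> V \<and> (\<forall>u\<in>V. \<forall>v\<in>V. \<forall>u'\<in>V. \<forall>v'\<in>V.
      rel C u v = rel C u' v' \<longleftrightarrow> k4_color untwisted (\<rho> u) (\<rho> v) = k4_color untwisted (\<rho> u') (\<rho> v')))"
proof -
  obtain V' :: "nat set" and C' f where h: "coherent_configuration V' C'" "algebraic_isomorphism C C' f"
    "\<nexists>\<phi>. combinatorial_isomorphism V C V' C' \<phi> \<and> (\<forall>R\<in>C. f R = map_prod \<phi> \<phi> ` R)"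
    using assms(4) unfolding separable_def by blast
  interpret algebraic_pair V C V' C' f
    using C h assms(3) by unfold_locales auto
  have "untwisted = (\<lambda>_ _. False)" by (intro ext) (simp add: untwisted_def)
  then show ?thesis using k4_if_not_induced[OF assms(2) h(3)] by simp
qed

theorem theorem11p1:
  "(\<forall>(V :: 'a set) C.
      coherent_configuration V C \<and> card V \<le> 15 \<and> max_fiber_size C = 4 \<longrightarrow> separable V C) \<and>
   (\<exists>(V\<^sub>0 :: nat set) C\<^sub>0.
      coherent_configuration V\<^sub>0 C\<^sub>0 \<and> card V\<^sub>0 = 16 \<and> max_fiber_size C\<^sub>0 = 4 \<and> \<not> separable V\<^sub>0 C\<^sub>0 \<and>
      (\<forall>(V :: 'a set) C.
         coherent_configuration V C \<and> card V = 16 \<and> max_fiber_size C = 4 \<and> \<not> separable V C \<longrightarrow>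
         (\<exists>\<phi>. combinatorial_isomorphism V C V\<^sub>0 C\<^sub>0 \<phi>)))"
proof (intro conjI allI impI)
  show "separable V C" if "coherent_configuration V C \<and> card V \<le> 15 \<and> max_fiber_size C = 4"
    for V :: "'a set" and C
    using not_separable_k4[of V C] that by fastforce
next
  obtain enc :: "bool2 \<times> bool2 \<Rightarrow> nat" where enc: "inj enc"
    using finite_imp_inj_to_nat_seg[OF finite_UNIV] by blast
  define c where "c m n = k4_color untwisted (inv enc m) (inv enc n)" for m n
  have c: "c (enc p) (enc q) = k4_color untwisted p q" for p q by (simp add: c_def inv_f_f[OF enc])
  show "\<exists>(V\<^sub>0 :: nat set) C\<^sub>0.
      coherent_configuration V\<^sub>0 C\<^sub>0 \<and> card V\<^sub>0 = 16 \<and> max_fiber_size C\<^sub>0 = 4 \<and> \<not> separable V\<^sub>0 C\<^sub>0 \<and>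
      (\<forall>(V :: 'a set) C.
         coherent_configuration V C \<and> card V = 16 \<and> max_fiber_size C = 4 \<and> \<not> separable V C \<longrightarrow>
         (\<exists>\<phi>. combinatorial_isomorphism V C V\<^sub>0 C\<^sub>0 \<phi>))"
  proof (intro exI[of _ "range enc"] exI[of _ "color_classes (range enc) c"] conjI allI impI)
    show "coherent_configuration (range enc) (color_classes (range enc) c)" using k4_coherent[of enc c, OF enc c] .
    show "card (range enc) = 16" using card_enc[of enc c, OF enc c] .
    show "max_fiber_size (color_classes (range enc) c) = 4" using k4_max_fiber[of enc c, OF enc c] .
    show "\<not> separable (range enc) (color_classes (range enc) c)" using k4_not_separable[of enc c, OF enc c] .
    fix V :: "'a set" and C
    assume h: "coherent_configuration V C \<and> card V = 16 \<and> max_fiber_size C = 4 \<and> \<not> separable V C"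
    then obtain \<rho> where "inj_on \<rho> V" "\<forall>u\<in>V. \<forall>v\<in>V. \<forall>u'\<in>V. \<forall>v'\<in>V.
      rel C u v = rel C u' v' \<longleftrightarrow> k4_color untwisted (\<rho> u) (\<rho> v) = k4_color untwisted (\<rho> u') (\<rho> v')"
      using not_separable_k4[of V C] by auto
    then have "combinatorial_isomorphism V C (range enc) (color_classes (range enc) c) (enc \<circ> \<rho>)"
      using h by (intro k4_iso[of enc c, OF enc c]) auto
    then show "\<exists>\<phi>. combinatorial_isomorphism V C (range enc) (color_classes (range enc) c) \<phi>" by blast
  qed
qed

end
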